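(* Let $H$ be a finite dimensional Frobenius weak Hopf algebra over a field $k$ with antipode $S$. Then there exists an integer $n\ge1$ such that $S^{4n}$ is a trivial weak Hopf algebra automorphism of $H$. In other words, $S^2$ has finite order modulo trivial automorphisms.
   Context: A weak Hopf algebra over a field $k$ is a $k$-vector space $H$ with an associative unital algebra structure $(m,1)$, a coassociative counital coalgebra structure $(\Delta,\epsilon)$ (Sweedler notation $\Delta(h)=h_{(1)}\otimes h_{(2)}$) and a linear map $S:H\to H$ (antipode) such that for all $f,g,h\in H$: $\Delta(hg)=\Delta(h)\Delta(g)$; $(\Delta\otimes\mathrm{id})\Delta(1)=(\Delta(1)\otimes1)(1\otimes\Delta(1))=(1\otimes\Delta(1))(\Delta(1)\otimes1)$; $\epsilon(fgh)=\epsilon(fg_{(1)})\epsilon(g_{(2)}h)=\epsilon(fg_{(2)})\epsilon(g_{(1)}h)$; $m(\mathrm{id}\otimes S)\Delta(h)=(\epsilon\otimes\mathrm{id})(\Delta(1)(h\otimes1))$; $m(S\otimes\mathrm{id})\Delta(h)=(\mathrm{id}\otimes\epsilon)((1\otimes h)\Delta(1))$; $S(h)=S(h_{(1)})h_{(2)}S(h_{(3)})$. ($\Delta(1)\neq1\otimes1$ in general.) $H_s=\varepsilon_s(H)$, $\varepsilon_s(h)=1_{(1)}\epsilon(h1_{(2)})$, is the source base of $H$ (a subalgebra). $H$ is called Frobenius if it is a Frobenius algebra. A weak Hopf algebra automorphism of $H$ is a bijection $H\to H$ that is an algebra and coalgebra homomorphism preserving $1$ and $\epsilon$ and commuting with $S$.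 It is called trivial if it is of the form $h\mapsto S(y)y^{-1}\,h\,S(y)^{-1}y$ for some invertible $y\in H_s$. Trivial automorphisms form a normal subgroup of the group of all weak Hopf algebra automorphisms. *)

theory Defs
  imports Complex_Main
begin

text \<open>
  Elements of \<open>H \<otimes> H\<close> and \<open>H \<otimes> H \<otimes> H\<close> (tensor products over the field) are represented by
  formal sums of pure tensors: the list \<open>[(a\<^sub>1, b\<^sub>1), \<dots>, (a\<^sub>n, b\<^sub>n)]\<close> stands for
  \<open>a\<^sub>1 \<otimes> b\<^sub>1 + \<dots> + a\<^sub>n \<otimes> b\<^sub>n\<close>. The relations \<open>tensor2_eq\<close> and \<open>tensor3_eq\<close> below are the defining
  congruences of the tensor products, so that \<open>H \<otimes> H\<close> is the set of lists of pairs modulo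
  \<open>tensor2_eq\<close>, with addition induced by list append. The quotient is an abelian group, because
  \<open>(a, b)\<close> and \<open>(- a, b)\<close> add up to \<open>(0, b)\<close>. List comprehensions then
  express Sweedler notation: \<open>[\<dots>. (a, b) \<leftarrow> \<Delta> h]\<close> is the sum over \<open>h\<^sub>(\<^sub>1\<^sub>) \<otimes> h\<^sub>(\<^sub>2\<^sub>)\<close>.
\<close>

inductive tensor2_eq ::
  "('k::field \<Rightarrow> 'h::ab_group_add \<Rightarrow> 'h) \<Rightarrow> ('h \<times> 'h) list \<Rightarrow> ('h \<times> 'h) list \<Rightarrow> bool"
  for scale :: "'k::field \<Rightarrow> 'h::ab_group_add \<Rightarrow> 'h" where
  refl: "tensor2_eq scale xs xs"
| sym: "tensor2_eq scale xs ys \<Longrightarrow> tensor2_eq scale ys xs"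
| trans: "tensor2_eq scale xs ys \<Longrightarrow> tensor2_eq scale ys zs \<Longrightarrow> tensor2_eq scale xs zs"
| append: "tensor2_eq scale xs ys \<Longrightarrow> tensor2_eq scale us vs \<Longrightarrow>
    tensor2_eq scale (xs @ us) (ys @ vs)"
| commute: "tensor2_eq scale (xs @ ys) (ys @ xs)"
| zero: "tensor2_eq scale [(0, b)] []"
| add1: "tensor2_eq scale [(a + a', b)] [(a, b), (a', b)]"
| add2: "tensor2_eq scale [(a, b + b')] [(a, b), (a, b')]"
| scale: "tensor2_eq scale [(scale r a, b)] [(a, scale r b)]"

inductive tensor3_eq ::
  "('k::field \<Rightarrow> 'h::ab_group_add \<Rightarrow> 'h) \<Rightarrow> ('h \<times> 'h \<times> 'h) list \<Rightarrow> ('h \<times> 'h \<times> 'h) list \<Rightarrow> bool"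
  for scale :: "'k::field \<Rightarrow> 'h::ab_group_add \<Rightarrow> 'h" where
  refl: "tensor3_eq scale xs xs"
| sym: "tensor3_eq scale xs ys \<Longrightarrow> tensor3_eq scale ys xs"
| trans: "tensor3_eq scale xs ys \<Longrightarrow> tensor3_eq scale ys zs \<Longrightarrow> tensor3_eq scale xs zs"
| append: "tensor3_eq scale xs ys \<Longrightarrow> tensor3_eq scale us vs \<Longrightarrow>
    tensor3_eq scale (xs @ us) (ys @ vs)"
| commute: "tensor3_eq scale (xs @ ys) (ys @ xs)"
| zero: "tensor3_eq scale [(0, b, c)] []"
| add1: "tensor3_eq scale [(a + a', b, c)] [(a, b, c), (a', b, c)]"
| add2: "tensor3_eq scale [(a, b + b', c)] [(a, b, c), (a, b', c)]"
| add3: "tensor3_eq scale [(a, b, c + c')] [(a, b, c), (a, b, c')]"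
| scale12: "tensor3_eq scale [(scale r a, b, c)] [(a, scale r b, c)]"
| scale23: "tensor3_eq scale [(a, scale r b, c)] [(a, b, scale r c)]"

text \<open>
  The ring structure is the one of the type; the sort \<open>{ring, monoid_mult}\<close> is that of unital
  associative rings and, unlike \<open>ring_1\<close>, does not exclude the zero ring.
\<close>

locale unital_algebra = vector_space scale
  for scale :: "'k::field \<Rightarrow> 'h::{ring, monoid_mult} \<Rightarrow> 'h" (infixr \<open>*s\<close> 75) +
  assumes scale_mult_left: "(r *s a) * b = r *s (a * b)"
    and scale_mult_right: "a * (r *s b) = r *s (a * b)"
begin

definition finite_dim :: bool where
  "finite_dim \<longleftrightarrow> (\<exists>B. finite B \<and> span B = UNIV)"

definition frobenius_algebra :: bool where
  "frobenius_algebra \<longleftrightarrow> finite_dim \<and>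
    (\<exists>\<theta> :: 'h \<Rightarrow> 'k. Vector_Spaces.linear scale (*) \<theta> \<and>
      (\<forall>a. (\<forall>b. \<theta> (a * b) = 0) \<longrightarrow> a = 0) \<and>
      (\<forall>b. (\<forall>a. \<theta> (a * b) = 0) \<longrightarrow> b = 0))"

end

definition inverse_pair :: "'h::monoid_mult \<Rightarrow> 'h \<Rightarrow> bool" where
  "inverse_pair x y \<longleftrightarrow> x * y = 1 \<and> y * x = 1"

locale weak_hopf_algebra = unital_algebra scale
  for scale :: "'k::field \<Rightarrow> 'h::{ring, monoid_mult} \<Rightarrow> 'h" (infixr \<open>*s\<close> 75) +
  fixes \<Delta> :: "'h \<Rightarrow> ('h \<times> 'h) list"
    and \<epsilon> :: "'h \<Rightarrow> 'k"
    and S :: "'h \<Rightarrow> 'h"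
  assumes comult_add: "tensor2_eq scale (\<Delta> (g + h)) (\<Delta> g @ \<Delta> h)"
    and comult_scale: "tensor2_eq scale (\<Delta> (r *s h)) [(r *s a, b). (a, b) \<leftarrow> \<Delta> h]"
    and counit_linear: "Vector_Spaces.linear scale (*) \<epsilon>"
    and antipode_linear: "Vector_Spaces.linear scale scale S"
    and coassoc:
      "tensor3_eq scale [(a1, a2, b). (a, b) \<leftarrow> \<Delta> h, (a1, a2) \<leftarrow> \<Delta> a]
         [(a, b1, b2). (a, b) \<leftarrow> \<Delta> h, (b1, b2) \<leftarrow> \<Delta> b]"
    and counit_left: "(\<Sum>(a, b)\<leftarrow>\<Delta> h. \<epsilon> a *s b) = h"
    and counit_right: "(\<Sum>(a, b)\<leftarrow>\<Delta> h. \<epsilon> b *s a) = h"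
    and comult_mult:
      "tensor2_eq scale (\<Delta> (h * g)) [(a * c, b * d). (a, b) \<leftarrow> \<Delta> h, (c, d) \<leftarrow> \<Delta> g]"
    and weak_unit1:
      "tensor3_eq scale [(a1, a2, b). (a, b) \<leftarrow> \<Delta> 1, (a1, a2) \<leftarrow> \<Delta> a]
         [(a, b * c, d). (a, b) \<leftarrow> \<Delta> 1, (c, d) \<leftarrow> \<Delta> 1]"
    and weak_unit2:
      "tensor3_eq scale [(a1, a2, b). (a, b) \<leftarrow> \<Delta> 1, (a1, a2) \<leftarrow> \<Delta> a]
         [(a, c * b, d). (a, b) \<leftarrow> \<Delta> 1, (c, d) \<leftarrow> \<Delta> 1]"
    and weak_counit1: "\<epsilon> (f * g * h) = (\<Sum>(a, b)\<leftarrow>\<Delta> g. \<epsilon> (f * a) * \<epsilon> (b * h))"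
    and weak_counit2: "\<epsilon> (f * g * h) = (\<Sum>(a, b)\<leftarrow>\<Delta> g. \<epsilon> (f * b) * \<epsilon> (a * h))"
    and antipode_right:
      "(\<Sum>(a, b)\<leftarrow>\<Delta> h. a * S b) = (\<Sum>(a, b)\<leftarrow>\<Delta> 1. \<epsilon> (a * h) *s b)"
    and antipode_left:
      "(\<Sum>(a, b)\<leftarrow>\<Delta> h. S a * b) = (\<Sum>(a, b)\<leftarrow>\<Delta> 1. \<epsilon> (h * b) *s a)"
    and antipode_antipode:
      "S h = (\<Sum>(a, b)\<leftarrow>\<Delta> h. \<Sum>(a1, a2)\<leftarrow>\<Delta> a. S a1 * a2 * S b)"
begin

definition source_counit :: "'h \<Rightarrow> 'h" where
  "source_counit h = (\<Sum>(a, b)\<leftarrow>\<Delta> 1. \<epsilon> (h * b) *s a)"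

definition source_base :: "'h set" where
  "source_base = range source_counit"

definition weak_hopf_automorphism :: "('h \<Rightarrow> 'h) \<Rightarrow> bool" where
  "weak_hopf_automorphism \<phi> \<longleftrightarrow>
     bij \<phi> \<and> Vector_Spaces.linear scale scale \<phi> \<and>
     (\<forall>g h. \<phi> (g * h) = \<phi> g * \<phi> h) \<and> \<phi> 1 = 1 \<and>
     (\<forall>h. tensor2_eq scale (\<Delta> (\<phi> h)) [(\<phi> a, \<phi> b). (a, b) \<leftarrow> \<Delta> h]) \<and>
     (\<forall>h. \<epsilon> (\<phi> h) = \<epsilon> h) \<and>
     (\<forall>h. \<phi> (S h) = S (\<phi> h))"

text \<open>Here \<open>y'\<close> and \<open>z\<close> are the inverses of \<open>y\<close> (in the algebra \<open>H\<^sub>s\<close>) and of \<open>S y\<close> (in \<open>H\<close>).\<close>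

definition trivial_automorphism :: "('h \<Rightarrow> 'h) \<Rightarrow> bool" where
  "trivial_automorphism \<phi> \<longleftrightarrow> weak_hopf_automorphism \<phi> \<and>
     (\<exists>y\<in>source_base. \<exists>y'\<in>source_base. \<exists>z. inverse_pair y y' \<and> inverse_pair (S y) z \<and>
       (\<forall>h. \<phi> h = S y * y' * h * z * y))"

end

end

theory Submission
  imports Defs
begin

text \<open>
  The proof combines a version of Radford's formula for \<open>S\<^sup>4\<close> with two pigeonhole arguments over the
  separable bases \<open>H\<^sub>s\<close> and \<open>H\<^sub>t\<close>. Sweedler notation \<open>\<Delta>(h) = h\<^sub>1 \<otimes> h\<^sub>2\<close> is used in all comments.

  Let \<open>L\<close> be the space of left integrals, \<open>h l = \<epsilon>\<^sub>t(h) l\<close>. A trace over \<open>H\<close> produces enough integrals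
  that their left legs \<open>l\<^sub>1 \<psi>(l\<^sub>2)\<close> span \<open>H\<close> (\<open>E_in_L\<close>, \<open>E_reconstruct\<close>). This makes \<open>S\<close> bijective
  (\<open>S_bij\<close>) and identifies the right \<open>H\<^sub>s\<close>-linear endomorphisms of \<open>L\<close> with \<open>H\<^sub>t\<close> (\<open>L_endomorphism\<close>).
  A Frobenius form forces \<open>dim L = dim H\<^sub>s\<close>, and comparing dimensions of endomorphisms shows that \<open>L\<close>
  is free of rank one over \<open>H\<^sub>s\<close> (\<open>L_cyclic\<close>). After a change of the Frobenius form by a unit, its
  generator \<open>l\<close> and the new form \<open>\<mu>\<close> satisfy \<open>l\<^sub>1 \<mu>(h l\<^sub>2) = S(h)\<close> (\<open>nondegenerate_integral\<close>).

  Let \<open>\<nu>\<close> be the Nakayama automorphism of \<open>\<mu>\<close> and \<open>g = \<mu>(l\<^sub>1) l\<^sub>2\<close>. Then \<open>T\<^sub>1 = S\<^sup>2 \<nu>\<close> is an algebra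
  automorphism with \<open>\<Delta>(T\<^sub>1 b) = b\<^sub>1 \<otimes> T\<^sub>1 b\<^sub>2\<close>, there is an algebra automorphism \<open>T\<^sub>2\<close> with
  \<open>\<Delta>(T\<^sub>2 b) = T\<^sub>2 b\<^sub>1 \<otimes> b\<^sub>2\<close>, and \<open>S\<^sup>4(T\<^sub>2 b) = G T\<^sub>1(b) G\<^sup>-\<^sup>1\<close> with \<open>G = S\<^sup>3(g)\<close> (\<open>radford\<close>). The element \<open>G\<close>
  is close to being grouplike: \<open>\<Delta>(G) = (a \<otimes> b) \<Delta>(1)\<close> with units \<open>a\<close>, \<open>b\<close>. For an ordinary Hopf
  algebra one would now use that grouplike elements of \<open>H\<close> and of its dual have finite order. The
  substitute is the following. The powers of \<open>T\<^sub>1\<close>, and likewise those of \<open>G\<close>, define infinitely many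
  submodules of one finite-dimensional module, each a twisted copy of \<open>H\<^sub>s\<close> and semisimple because
  \<open>H\<^sub>s\<close> is separable. Two of them must be isomorphic (\<open>isomorphic_pair\<close>), and an isomorphism between the
  copies with indices \<open>i < j\<close> shows that \<open>T\<^sub>1\<^sup>n\<close>, for \<open>n = j - i\<close>, is conjugation by a unit of \<open>H\<^sub>s\<close>
  (\<open>left_colinear_power_inner\<close>), respectively that \<open>G\<^sup>n\<close> lies in \<open>H\<^sub>t H\<^sub>s\<close> (\<open>tw_grouplike_power\<close>). The
  case of \<open>T\<^sub>2\<close> follows by transport along \<open>S\<close>.

  Iterating Radford's formula up to a common multiple of these exponents gives \<open>S\<^sup>4\<^sup>N\<close> as conjugation
  by a twisted grouplike element, so a further power is conjugation by \<open>z y\<close> with \<open>z \<in> H\<^sub>t\<close>, \<open>y \<in> H\<^sub>s\<close>.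
  An inner automorphism of this kind that also respects the coproduct is trivial (\<open>inner_trivial\<close>).
\<close>

section \<open>Sweedler calculus and the two base algebras\<close>

text \<open>
  The conditions under which \<open>F\<close> factors through the tensor product; the target is an arbitrary abelian
  group, so that the same lemmas serve for values in the field, in \<open>H\<close>, and in iterated contractions.
\<close>
definition balanced2 :: "('k::field \<Rightarrow> 'h::ab_group_add \<Rightarrow> 'h) \<Rightarrow> ('h \<Rightarrow> 'h \<Rightarrow> 'v::ab_group_add) \<Rightarrow> bool" where
  "balanced2 sc F \<longleftrightarrow> (\<forall>a a' b. F (a + a') b = F a b + F a' b) \<and> (\<forall>a b b'. F a (b + b') = F a b + F a b') \<and>
     (\<forall>r a b. F (sc r a) b = F a (sc r b))"

definition balanced3 :: "('k::field \<Rightarrow> 'h::ab_group_add \<Rightarrow> 'h) \<Rightarrow> ('h \<Rightarrow> 'h \<Rightarrow> 'h \<Rightarrow> 'v::ab_group_add) \<Rightarrow> bool" where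
  "balanced3 sc F \<longleftrightarrow> (\<forall>a a' b c. F (a + a') b c = F a b c + F a' b c) \<and>
     (\<forall>a b b' c. F a (b + b') c = F a b c + F a b' c) \<and>
     (\<forall>a b c c'. F a b (c + c') = F a b c + F a b c') \<and>
     (\<forall>r a b c. F (sc r a) b c = F a (sc r b) c) \<and> (\<forall>r a b c. F a (sc r b) c = F a b (sc r c))"

lemma balanced2_zero: "balanced2 sc F \<Longrightarrow> F 0 b = 0"
  unfolding balanced2_def by (metis add_0 add_cancel_left_left)

lemma balanced3_zero: "balanced3 sc F \<Longrightarrow> F 0 b c = 0"
  unfolding balanced3_def by (metis add_0 add_cancel_left_left)

lemma tensor2_eq_sum:
  assumes "tensor2_eq sc xs ys" "balanced2 sc F"
  shows "(\<Sum>(a, b)\<leftarrow>xs. F a b) = (\<Sum>(a, b)\<leftarrow>ys. F a b)"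
  using assms(1)
proof induction
  case (zero b) then show ?case using balanced2_zero[OF assms(2)] by simp
next
  case (commute xs ys) then show ?case by (simp add: add.commute)
qed (use assms(2) in \<open>auto simp: balanced2_def\<close>)

lemma tensor3_eq_sum:
  assumes "tensor3_eq sc xs ys" "balanced3 sc F"
  shows "(\<Sum>(a, b, c)\<leftarrow>xs. F a b c) = (\<Sum>(a, b, c)\<leftarrow>ys. F a b c)"
  using assms(1)
proof induction
  case (zero b) then show ?case using balanced3_zero[OF assms(2)] by simp
next
  case (commute xs ys) then show ?case by (simp add: add.commute)
qed (use assms(2) in \<open>auto simp: balanced3_def\<close>)

lemma sum_list_concat_map:
  fixes f :: "'b \<Rightarrow> 'v::ab_group_add"
  shows "sum_list (map f (concat (map g xs))) = (\<Sum>x\<leftarrow>xs. \<Sum>y\<leftarrow>g x. f y)"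
  by (induction xs) auto

context weak_hopf_algebra
begin

text \<open>
  The value \<open>F(h\<^sub>1, h\<^sub>2)\<close>. All identities of tensors below are stated by evaluating an arbitrary balanced
  map on both sides; in this form they can be used as rewrite rules without a tensor product type.
\<close>
definition sw :: "'h \<Rightarrow> ('h \<Rightarrow> 'h \<Rightarrow> 'v::ab_group_add) \<Rightarrow> 'v" where
  "sw h F = (\<Sum>(a, b)\<leftarrow>\<Delta> h. F a b)"

abbreviation bil :: "('h \<Rightarrow> 'h \<Rightarrow> 'v::ab_group_add) \<Rightarrow> bool" where "bil \<equiv> balanced2 scale"
abbreviation tril :: "('h \<Rightarrow> 'h \<Rightarrow> 'h \<Rightarrow> 'v::ab_group_add) \<Rightarrow> bool" where "tril \<equiv> balanced3 scale"

lemma sw_add: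
  assumes "bil F" shows "sw (g + h) F = sw g F + sw h F"
  using tensor2_eq_sum[OF comult_add assms] by (simp add: sw_def)

lemma sw_scale:
  assumes "bil F" shows "sw (r *s h) F = sw h (\<lambda>a b. F (r *s a) b)"
  using tensor2_eq_sum[OF comult_scale assms] by (simp add: sw_def o_def case_prod_unfold)

lemma sw_plus: "sw h (\<lambda>a b. F a b + G a b) = sw h F + sw h G"
  by (simp add: sw_def case_prod_unfold sum_list_addf)

lemma sw_zero_fun[simp]: "sw h (\<lambda>a b. 0) = 0"
  by (simp add: sw_def case_prod_unfold)

lemma sw_hom:
  assumes "\<And>x y. f (x + y) = f x + f y"
  shows "f (sw h F) = sw h (\<lambda>a b. f (F a b))"
proof -
  have 0: "f 0 = 0" using assms[of 0 0] by simp
  have "f (sum_list (map (\<lambda>(a,b). F a b) xs)) = sum_list (map (\<lambda>(a,b). f (F a b)) xs)" for xs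
    by (induction xs) (auto simp: 0 assms)
  then show ?thesis by (simp add: sw_def)
qed

lemma sw_uminus: "sw h (\<lambda>a b. - F a b) = - sw h F"
  by (rule sw_hom[symmetric]) simp

lemma sw_minus: "sw h (\<lambda>a b. F a b - G a b) = sw h F - sw h G"
  using sw_plus[of h F "\<lambda>a b. - G a b"] by (simp add: sw_uminus)

lemma sw_mult_left: "(x::'c::ring) * sw h F = sw h (\<lambda>a b. x * F a b)"
  by (rule sw_hom) (simp add: distrib_left)

lemma sw_mult_right: "sw h F * (x::'c::ring) = sw h (\<lambda>a b. F a b * x)"
  by (rule sw_hom[of "\<lambda>y. y * x"]) (simp add: distrib_right)

lemma sw_scale_out: "r *s sw h F = sw h (\<lambda>a b. r *s F a b)"
  by (rule sw_hom) (simp add: scale_right_distrib)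

lemma sw_scale_left: "sw h F *s x = sw h (\<lambda>a b. F a b *s x)"
  by (rule sw_hom[of "\<lambda>r. r *s x"]) (simp add: scale_left_distrib)

lemma \<epsilon>_add: "\<epsilon> (x + y) = \<epsilon> x + \<epsilon> y" and \<epsilon>_scale: "\<epsilon> (r *s x) = r * \<epsilon> x"
  using counit_linear by (simp_all add: Vector_Spaces.linear_iff)

lemma S_add: "S (x + y) = S x + S y" and S_scale: "S (r *s x) = r *s S x"
  using antipode_linear by (simp_all add: Vector_Spaces.linear_iff)

lemma \<epsilon>_0[simp]: "\<epsilon> 0 = 0" using \<epsilon>_add[of 0 0] by (simp only: add_0_right add_cancel_right_right)
lemma S_0[simp]: "S 0 = 0" using S_add[of 0 0] by simp
lemma \<epsilon>_diff: "\<epsilon> (x - y) = \<epsilon> x - \<epsilon> y" using \<epsilon>_add[of "x - y" y] by simp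
lemma S_diff: "S (x - y) = S x - S y" using S_add[of "x - y" y] by simp

lemma sw_cong: "(\<And>a b. F a b = G a b) \<Longrightarrow> sw h F = sw h G"
  by (simp add: sw_def)

lemma sw_0:
  assumes "bil F" shows "sw 0 F = 0"
  using sw_add[OF assms, of 0 0] by simp

lemma sw_swap: "sw g (\<lambda>a b. sw h (\<lambda>c d. F a b c d)) = sw h (\<lambda>c d. sw g (\<lambda>a b. F a b c d))"
proof -
  have "sum_list (map (\<lambda>(a,b). sw h (\<lambda>c d. F a b c d)) xs) = sw h (\<lambda>c d. sum_list (map (\<lambda>(a,b). F a b c d) xs))" for xs
    by (induction xs) (auto simp: sw_plus)
  then show ?thesis by (simp add: sw_def)
qed

text \<open>
  Applying an axiom to a balanced map leaves the obligation that it is balanced. These rules expand both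
  sides of such an obligation until they agree up to associativity and commutativity.
\<close>
lemmas lins = distrib_left distrib_right scale_right_distrib scale_left_distrib scale_mult_left scale_mult_right
  sw_add sw_scale sw_plus \<epsilon>_add \<epsilon>_scale S_add S_scale balanced2_def balanced3_def
  add.assoc add.commute add.left_commute mult.assoc mult.commute mult.left_commute scale_scale

lemmas sws = sw_mult_left sw_mult_right sw_scale_out sw_scale_left sw_hom[of S, OF S_add] sw_hom[of \<epsilon>, OF \<epsilon>_add]

lemma coassoc_sw:
  assumes "tril F"
  shows "sw h (\<lambda>a b. sw a (\<lambda>a1 a2. F a1 a2 b)) = sw h (\<lambda>a b. sw b (\<lambda>b1 b2. F a b1 b2))"
  using tensor3_eq_sum[OF coassoc assms, of h]
  by (simp add: sw_def sum_list_concat_map case_prod_unfold o_def)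

lemma counit_left_sw: "sw h (\<lambda>a b. \<epsilon> a *s b) = h"
  using counit_left by (simp add: sw_def)

lemma counit_right_sw: "sw h (\<lambda>a b. \<epsilon> b *s a) = h"
  using counit_right by (simp add: sw_def)

lemma mult_sw:
  assumes "bil F" shows "sw (g * h) F = sw g (\<lambda>a b. sw h (\<lambda>c d. F (a * c) (b * d)))"
  using tensor2_eq_sum[OF comult_mult assms, of g h]
  by (simp add: sw_def sum_list_concat_map case_prod_unfold o_def)

lemma unit1_sw:
  assumes "tril F"
  shows "sw 1 (\<lambda>a b. sw a (\<lambda>a1 a2. F a1 a2 b)) = sw 1 (\<lambda>a b. sw 1 (\<lambda>c d. F a (b * c) d))"
  using tensor3_eq_sum[OF weak_unit1 assms]
  by (simp add: sw_def sum_list_concat_map case_prod_unfold o_def)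

lemma unit2_sw:
  assumes "tril F"
  shows "sw 1 (\<lambda>a b. sw a (\<lambda>a1 a2. F a1 a2 b)) = sw 1 (\<lambda>a b. sw 1 (\<lambda>c d. F a (c * b) d))"
  using tensor3_eq_sum[OF weak_unit2 assms]
  by (simp add: sw_def sum_list_concat_map case_prod_unfold o_def)

lemma counit1_sw: "\<epsilon> (f * g * h) = sw g (\<lambda>a b. \<epsilon> (f * a) * \<epsilon> (b * h))"
  using weak_counit1 by (simp add: sw_def)
lemma counit2_sw: "\<epsilon> (f * g * h) = sw g (\<lambda>a b. \<epsilon> (f * b) * \<epsilon> (a * h))"
  using weak_counit2 by (simp add: sw_def)

text \<open>
  The counital maps \<open>\<epsilon>\<^sub>t\<close> and \<open>\<epsilon>\<^sub>s\<close>; the ranges \<open>Ht\<close> and \<open>Hs\<close> below are the target and the source base.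
\<close>
definition et :: "'h \<Rightarrow> 'h" where "et h = sw 1 (\<lambda>a b. \<epsilon> (a * h) *s b)"
definition es :: "'h \<Rightarrow> 'h" where "es h = sw 1 (\<lambda>a b. \<epsilon> (h * b) *s a)"

lemma antipode_right_sw: "sw h (\<lambda>a b. a * S b) = et h"
  using antipode_right by (simp add: sw_def et_def)
lemma antipode_left_sw: "sw h (\<lambda>a b. S a * b) = es h"
  using antipode_left by (simp add: sw_def es_def)
lemma antipode_antipode_sw: "sw h (\<lambda>a b. sw a (\<lambda>a1 a2. S a1 * a2 * S b)) = S h"
  unfolding sw_def by (rule antipode_antipode[symmetric])

lemma et_add: "et (x + y) = et x + et y" by (simp add: et_def lins)
lemma et_scale: "et (r *s x) = r *s et x" by (simp add: et_def lins sws)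
lemma es_add: "es (x + y) = es x + es y" by (simp add: es_def lins)
lemma es_scale: "es (r *s x) = r *s es x" by (simp add: es_def lins sws)

lemmas lins2 = lins et_add et_scale es_add es_scale

lemma S_es: "sw h (\<lambda>a b. es a * S b) = S h"
  unfolding antipode_left_sw[symmetric] sw_mult_right by (rule antipode_antipode_sw)

lemma S_et: "sw h (\<lambda>a b. S a * et b) = S h"
proof -
  have "sw h (\<lambda>a b. S a * et b) = sw h (\<lambda>a b. sw b (\<lambda>b1 b2. S a * (b1 * S b2)))"
    by (simp add: antipode_right_sw[symmetric] sw_mult_left)
  also have "\<dots> = sw h (\<lambda>a b. sw a (\<lambda>a1 a2. S a1 * (a2 * S b)))"
    by (rule coassoc_sw[symmetric]) (simp add: lins)
  finally show ?thesis using antipode_antipode_sw by (simp add: mult.assoc)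
qed

lemma \<epsilon>_et: "\<epsilon> (g * et h) = \<epsilon> (g * h)"
  using counit2_sw[of g 1 h] by (simp add: et_def sws scale_mult_right \<epsilon>_scale mult.commute)

lemma \<epsilon>_es: "\<epsilon> (es g * h) = \<epsilon> (g * h)"
  using counit2_sw[of g 1 h] by (simp add: es_def sws scale_mult_left \<epsilon>_scale mult.commute)

lemma et_et: "et (g * et h) = et (g * h)"
  by (simp add: et_def[of "g * _"] \<epsilon>_et mult.assoc[symmetric])
lemma es_es: "es (es g * h) = es (g * h)"
  by (simp add: es_def[of "_ * h"] \<epsilon>_es mult.assoc)


lemma bilD:
  assumes "bil F"
  shows "F (x + y) z = F x z + F y z" "F z (x + y) = F z x + F z y" "F (r *s x) y = F x (r *s y)"
  using assms by (auto simp: balanced2_def)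

lemma bil_sw1: "bil F \<Longrightarrow> F (sw h G) d = sw h (\<lambda>a b. F (G a b) d)"
  by (rule sw_hom) (simp add: bilD)
lemma bil_sw2: "bil F \<Longrightarrow> F d (sw h G) = sw h (\<lambda>a b. F d (G a b))"
  by (rule sw_hom) (simp add: bilD)
lemma sw_sw_arg: "bil F \<Longrightarrow> sw (sw h G) F = sw h (\<lambda>a b. sw (G a b) F)"
  by (rule sw_hom[of "\<lambda>x. sw x F"]) (simp add: sw_add)

lemma unit1R_sw:
  assumes "tril F"
  shows "sw 1 (\<lambda>a b. sw b (\<lambda>b1 b2. F a b1 b2)) = sw 1 (\<lambda>a b. sw 1 (\<lambda>c d. F a (b * c) d))"
  using unit1_sw[OF assms] coassoc_sw[OF assms, of 1] by simp

lemma unit2R_sw: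
  assumes "tril F"
  shows "sw 1 (\<lambda>a b. sw b (\<lambda>b1 b2. F a b1 b2)) = sw 1 (\<lambda>a b. sw 1 (\<lambda>c d. F a (c * b) d))"
  using unit2_sw[OF assms] coassoc_sw[OF assms, of 1] by simp

text \<open>
  \<open>\<Delta>(z) = z 1\<^sub>1 \<otimes> 1\<^sub>2 = 1\<^sub>1 z \<otimes> 1\<^sub>2\<close> for \<open>z = \<epsilon>\<^sub>t(h)\<close>: applying \<open>\<epsilon>(- h)\<close> to the first leg of the two
  expressions of \<open>1\<^sub>1 \<otimes> 1\<^sub>2 \<otimes> 1\<^sub>3\<close> puts \<open>z\<close> on one or the other side.
\<close>
lemma sw_et:
  assumes "bil F"
  shows "sw (et h) F = sw 1 (\<lambda>a b. F (et h * a) b)" "sw (et h) F = sw 1 (\<lambda>a b. F (a * et h) b)"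
proof -
  note [simp] = bilD[OF assms] 
  have 0: "sw (et h) F = sw 1 (\<lambda>a b. sw b (\<lambda>c d. F (\<epsilon> (a * h) *s c) d))"
    unfolding et_def by (simp add: sw_sw_arg[OF assms] sw_scale assms)
  have t: "tril (\<lambda>a b c. F (\<epsilon> (a * h) *s b) c)" 
    by (simp add: lins)
  show "sw (et h) F = sw 1 (\<lambda>a b. F (et h * a) b)"
    unfolding 0 unit1R_sw[OF t]
    by (subst sw_swap, rule sw_cong) (simp add: et_def sw_mult_right bil_sw1[OF assms] scale_mult_left)
  show "sw (et h) F = sw 1 (\<lambda>a b. F (a * et h) b)"
    unfolding 0 unit2R_sw[OF t]
    by (subst sw_swap, rule sw_cong) (simp add: et_def sw_mult_left bil_sw1[OF assms] scale_mult_right)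
qed

lemma sw_es:
  assumes "bil F"
  shows "sw (es h) F = sw 1 (\<lambda>a b. F a (b * es h))" "sw (es h) F = sw 1 (\<lambda>a b. F a (es h * b))"
proof -
  note [simp] = bilD[OF assms] 
  have 0: "sw (es h) F = sw 1 (\<lambda>a b. sw a (\<lambda>c d. F c (\<epsilon> (h * b) *s d)))"
    unfolding es_def by (simp add: sw_sw_arg[OF assms] sw_scale assms)
  have t: "tril (\<lambda>a b c. F a (\<epsilon> (h * c) *s b))" 
    by (simp add: lins)
  show "sw (es h) F = sw 1 (\<lambda>a b. F a (b * es h))"
    unfolding 0 unit1_sw[OF t]
    by (simp add: es_def sw_mult_left bil_sw2[OF assms] scale_mult_right)
  show "sw (es h) F = sw 1 (\<lambda>a b. F a (es h * b))"
    unfolding 0 unit2_sw[OF t]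
    by (simp add: es_def sw_mult_right bil_sw2[OF assms] scale_mult_left)
qed

lemma et_idem[simp]: "et (et h) = et h" using et_et[of 1 h] by simp
lemma es_idem[simp]: "es (es h) = es h" using es_es[of h 1] by simp

definition Ht where "Ht = range et"
definition Hs where "Hs = range es"

lemma Ht_iff: "z \<in> Ht \<longleftrightarrow> et z = z" unfolding Ht_def by (metis et_idem rangeE rangeI)
lemma Hs_iff: "y \<in> Hs \<longleftrightarrow> es y = y" unfolding Hs_def by (metis es_idem rangeE rangeI)
lemma et_in[simp]: "et h \<in> Ht" by (simp add: Ht_def)
lemma es_in[simp]: "es h \<in> Hs" by (simp add: Hs_def)

lemma sw_one_mult:
  assumes "bil F"
  shows "sw 1 (\<lambda>a b. sw h (\<lambda>c d. F (a * c) (b * d))) = sw h F"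
    "sw h (\<lambda>c d. sw 1 (\<lambda>a b. F (c * a) (d * b))) = sw h F"
  using mult_sw[OF assms, of 1 h] mult_sw[OF assms, of h 1] by simp_all

lemma sw_Ht:
  assumes F: "bil F" and z: "z \<in> Ht"
  shows sw_Ht_left: "sw (z * h) F = sw h (\<lambda>a b. F (z * a) b)"
    and sw_Ht_right: "sw (h * z) F = sw h (\<lambda>a b. F (a * z) b)"
proof -
  note [simp] = bilD[OF F]
  have "sw (et z * h) F = sw 1 (\<lambda>a b. sw h (\<lambda>c d. F (et z * a * c) (b * d)))"
    unfolding mult_sw[OF F] by (rule sw_et) (simp add: lins)
  also have "\<dots> = sw h (\<lambda>a b. F (et z * a) b)"
    by (subst sw_one_mult(1)[symmetric]) (simp_all add: lins)
  finally show "sw (z * h) F = sw h (\<lambda>a b. F (z * a) b)" using z by (simp add: Ht_iff)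
  have "sw (h * et z) F = sw h (\<lambda>c d. sw 1 (\<lambda>a b. F (c * (a * et z)) (d * b)))"
    unfolding mult_sw[OF F] by (subst sw_et(2)) (simp_all add: lins)
  also have "\<dots> = sw h (\<lambda>a b. F (a * et z) b)"
    by (subst (2) sw_one_mult(2)[symmetric]) (simp_all add: lins)
  finally show "sw (h * z) F = sw h (\<lambda>a b. F (a * z) b)" using z by (simp add: Ht_iff)
qed

lemma sw_Hs:
  assumes F: "bil F" and y: "y \<in> Hs"
  shows sw_Hs_left: "sw (y * h) F = sw h (\<lambda>a b. F a (y * b))"
    and sw_Hs_right: "sw (h * y) F = sw h (\<lambda>a b. F a (b * y))"
proof -
  note [simp] = bilD[OF F]
  have "sw (es y * h) F = sw 1 (\<lambda>a b. sw h (\<lambda>c d. F (a * c) (es y * b * d)))"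
    unfolding mult_sw[OF F] by (rule sw_es) (simp add: lins)
  also have "\<dots> = sw h (\<lambda>a b. F a (es y * b))"
    by (subst sw_one_mult(1)[symmetric]) (simp_all add: lins)
  finally show "sw (y * h) F = sw h (\<lambda>a b. F a (y * b))" using y by (simp add: Hs_iff)
  have "sw (h * es y) F = sw h (\<lambda>c d. sw 1 (\<lambda>a b. F (c * a) (d * (b * es y))))"
    unfolding mult_sw[OF F] by (subst sw_es(1)) (simp_all add: lins)
  also have "\<dots> = sw h (\<lambda>a b. F a (b * es y))"
    by (subst (2) sw_one_mult(2)[symmetric]) (simp_all add: lins)
  finally show "sw (h * y) F = sw h (\<lambda>a b. F a (b * y))" using y by (simp add: Hs_iff)
qed

lemma one_in_Ht[simp]: "1 \<in> Ht" unfolding Ht_iff et_def by (simp add: counit_left_sw)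
lemma one_in_Hs[simp]: "1 \<in> Hs" unfolding Hs_iff es_def by (simp add: counit_right_sw)

text \<open>
  Contracting the outer legs of \<open>(\<Delta>(1) \<otimes> 1)(1 \<otimes> \<Delta>(1)) = (1 \<otimes> \<Delta>(1))(\<Delta>(1) \<otimes> 1)\<close> leaves an element of
  \<open>Ht\<close> and an element of \<open>Hs\<close> in the middle, in the two possible orders.
\<close>
lemma Ht_Hs_commute:
  assumes "z \<in> Ht" "y \<in> Hs" shows "z * y = y * z"
proof -
  define F where "F a b d = \<epsilon> (a * z) *s (\<epsilon> (y * d) *s b)" for a b d
  have t: "tril F" unfolding F_def by (simp add: lins)
  have "sw 1 (\<lambda>a b. sw 1 (\<lambda>c d. F a (b * c) d)) = et z * es y"
    unfolding F_def et_def es_def by (subst sw_swap) (simp add: sws lins)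
  moreover have "sw 1 (\<lambda>a b. sw 1 (\<lambda>c d. F a (c * b) d)) = es y * et z"
    unfolding F_def et_def es_def by (simp add: sws lins)
  ultimately show ?thesis using unit1_sw[OF t] unit2_sw[OF t] assms by (simp add: Ht_iff Hs_iff)
qed

text \<open>
  With \<open>sw_1_es\<close>, this expresses that \<open>\<Delta>(1)\<close> lies in \<open>Hs \<otimes> Ht\<close>.
\<close>
lemma sw_1_et:
  assumes "bil F" shows "sw 1 (\<lambda>a b. F a (et b)) = sw 1 F"
proof -
  note [simp] = bilD[OF assms]
  have t: "tril (\<lambda>a b d. F a (\<epsilon> b *s d))" by (simp add: lins)
  have "sw 1 (\<lambda>a b. F a (et b)) = sw 1 (\<lambda>a b. sw 1 (\<lambda>c d. F a (\<epsilon> (c * b) *s d)))"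
    by (rule sw_cong) (simp add: et_def bil_sw2[OF assms])
  also have "\<dots> = sw 1 (\<lambda>a b. F a b)"
    by (subst unit2R_sw[OF t, symmetric], rule sw_cong) (simp only: bil_sw2[OF assms, symmetric] counit_left_sw)
  finally show ?thesis by simp
qed

lemma sw_1_es:
  assumes "bil F" shows "sw 1 (\<lambda>a b. F (es a) b) = sw 1 F"
proof -
  note [simp] = bilD[OF assms]
  have t: "tril (\<lambda>a b d. F a (\<epsilon> b *s d))" by (simp add: lins)
  have "sw 1 (\<lambda>a b. F (es a) b) = sw 1 (\<lambda>a b. sw 1 (\<lambda>c d. F c (\<epsilon> (a * d) *s b)))"
    by (rule sw_cong) (simp add: es_def bil_sw1[OF assms])
  also have "\<dots> = sw 1 (\<lambda>a b. sw 1 (\<lambda>c d. F a (\<epsilon> (c * b) *s d)))" by (subst sw_swap) simp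
  also have "\<dots> = sw 1 (\<lambda>a b. F a b)"
    by (subst unit2R_sw[OF t, symmetric], rule sw_cong) (simp only: bil_sw2[OF assms, symmetric] counit_left_sw)
  finally show ?thesis by simp
qed

lemma et_Ht: "z \<in> Ht \<Longrightarrow> et (z * h) = z * et h"
proof -
  assume z: "z \<in> Ht"
  have "sw z (\<lambda>a b. \<epsilon> (a * h) *s b) = sw 1 (\<lambda>a b. \<epsilon> (a * (z * h)) *s b)" 
    using sw_Ht_right[OF _ z, of "\<lambda>a b. \<epsilon> (a * h) *s b" 1] by (simp add: lins)
  moreover have "sw z (\<lambda>a b. \<epsilon> (a * h) *s b) = z * et h"
  proof -
    have "sw z (\<lambda>a b. \<epsilon> (a * h) *s b) = sw z (\<lambda>a b. \<epsilon> (a * et h) *s b)" by (simp add: \<epsilon>_et)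
    also have "\<dots> = sw (z * et h) (\<lambda>a b. \<epsilon> a *s b)"
      by (rule sw_Ht_right[symmetric]) (simp_all add: lins)
    finally show ?thesis by (simp add: counit_left_sw)
  qed
  ultimately show ?thesis by (simp add: et_def[of "z * h"])
qed

lemma es_Hs: "y \<in> Hs \<Longrightarrow> es (h * y) = es h * y"
proof -
  assume y: "y \<in> Hs"
  have "sw y (\<lambda>a b. \<epsilon> (h * b) *s a) = sw 1 (\<lambda>a b. \<epsilon> (h * y * b) *s a)" 
    using sw_Hs_left[OF _ y, of "\<lambda>a b. \<epsilon> (h * b) *s a" 1] by (simp add: lins)
  moreover have "sw y (\<lambda>a b. \<epsilon> (h * b) *s a) = es h * y"
  proof -
    have "sw y (\<lambda>a b. \<epsilon> (h * b) *s a) = sw y (\<lambda>a b. \<epsilon> (es h * b) *s a)" by (simp add: \<epsilon>_es)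
    also have "\<dots> = sw (es h * y) (\<lambda>a b. \<epsilon> b *s a)"
      by (rule sw_Hs_left[symmetric]) (simp_all add: lins)
    finally show ?thesis by (simp add: counit_right_sw)
  qed
  ultimately show ?thesis by (simp add: es_def[of "h * y"])
qed

lemma Ht_mult: "z \<in> Ht \<Longrightarrow> w \<in> Ht \<Longrightarrow> z * w \<in> Ht" by (metis Ht_iff et_Ht)
lemma Hs_mult: "z \<in> Hs \<Longrightarrow> w \<in> Hs \<Longrightarrow> z * w \<in> Hs" by (metis Hs_iff es_Hs)
lemma Ht_add: "z \<in> Ht \<Longrightarrow> w \<in> Ht \<Longrightarrow> z + w \<in> Ht" by (simp add: Ht_iff et_add)
lemma Hs_add: "z \<in> Hs \<Longrightarrow> w \<in> Hs \<Longrightarrow> z + w \<in> Hs" by (simp add: Hs_iff es_add)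
lemma Ht_scale: "z \<in> Ht \<Longrightarrow> r *s z \<in> Ht" by (simp add: Ht_iff et_scale)
lemma Hs_scale: "z \<in> Hs \<Longrightarrow> r *s z \<in> Hs" by (simp add: Hs_iff es_scale)
lemma et_0[simp]: "et 0 = 0" using et_add[of 0 0] by simp
lemma es_0[simp]: "es 0 = 0" using es_add[of 0 0] by simp
lemma Ht_0[simp]: "0 \<in> Ht" by (simp add: Ht_iff)
lemma Hs_0[simp]: "0 \<in> Hs" by (simp add: Hs_iff)
lemma Ht_subspace: "subspace Ht" by (auto simp: subspace_def Ht_add Ht_scale)
lemma Hs_subspace: "subspace Hs" by (auto simp: subspace_def Hs_add Hs_scale)

section \<open>The antipode on products and on the bases\<close>

lemma sw_eps:
  "z \<in> Ht \<Longrightarrow> sw h (\<lambda>a b. \<epsilon> (a * z) *s b) = h * z"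
  "z \<in> Ht \<Longrightarrow> sw h (\<lambda>a b. \<epsilon> (z * a) *s b) = z * h"
  "y \<in> Hs \<Longrightarrow> sw h (\<lambda>a b. \<epsilon> (b * y) *s a) = h * y"
  "y \<in> Hs \<Longrightarrow> sw h (\<lambda>a b. \<epsilon> (y * b) *s a) = y * h"
     apply (subst sw_Ht_right[symmetric, of "\<lambda>a b. \<epsilon> a *s b"]; simp add: lins counit_left_sw)
    apply (subst sw_Ht_left[symmetric, of "\<lambda>a b. \<epsilon> a *s b"]; simp add: lins counit_left_sw)
   apply (subst sw_Hs_right[symmetric, of "\<lambda>a b. \<epsilon> b *s a"]; simp add: lins counit_right_sw)
  apply (subst sw_Hs_left[symmetric, of "\<lambda>a b. \<epsilon> b *s a"]; simp add: lins counit_right_sw)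
  done

lemma et_conj: "et (g * h) = sw g (\<lambda>g1 g2. g1 * et h * S g2)"
proof -
  have "et (g * h) = sw (g * et h) (\<lambda>a b. a * S b)" by (simp add: antipode_right_sw et_et)
  also have "\<dots> = sw g (\<lambda>g1 g2. g1 * et h * S g2)" by (rule sw_Ht_right) (simp_all add: lins)
  finally show ?thesis .
qed

lemma es_conj: "es (g * h) = sw h (\<lambda>h1 h2. S h1 * es g * h2)"
proof -
  have "es (g * h) = sw (es g * h) (\<lambda>a b. S a * b)" by (simp add: antipode_left_sw es_es)
  also have "\<dots> = sw h (\<lambda>h1 h2. S h1 * (es g * h2))" by (rule sw_Hs_left) (simp_all add: lins)
  finally show ?thesis by (simp add: mult.assoc)
qed

text \<open>
  Since \<open>S(x) = S(x\<^sub>1) \<epsilon>\<^sub>t(x\<^sub>2)\<close>, the element \<open>S(g h)\<close> equals \<open>S(g\<^sub>1 h\<^sub>1) g\<^sub>2 h\<^sub>2 S(h\<^sub>3) S(g\<^sub>3)\<close>. Collapsing the first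
  three factors gives \<open>\<epsilon>\<^sub>s(g\<^sub>1 h\<^sub>1) S(h\<^sub>2) S(g\<^sub>2) = S(h\<^sub>1) \<epsilon>\<^sub>s(g\<^sub>1) \<epsilon>\<^sub>t(h\<^sub>2) S(g\<^sub>2)\<close>, and the two counital factors
  commute.
\<close>
lemma S_mult: "S (g * h) = S h * S g"
proof -
  have "S (g * h) = sw g (\<lambda>g1 g2. sw h (\<lambda>h1 h2. S (g1 * h1) * et (g2 * h2)))"
    unfolding S_et[of "g * h", symmetric] by (rule mult_sw) (simp add: lins2)
  also have "\<dots> = sw g (\<lambda>g1 g2. sw g2 (\<lambda>p q. sw h (\<lambda>h1 h2. S (g1 * h1) * p * et h2 * S q)))"
    unfolding et_conj sw_mult_left by (rule sw_cong, subst sw_swap) (simp add: mult.assoc)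
  also have "\<dots> = sw g (\<lambda>a q. sw a (\<lambda>g1 p. sw h (\<lambda>h1 h2. S (g1 * h1) * p * et h2 * S q)))"
    by (rule coassoc_sw[symmetric]) (simp add: lins2)
  also have "\<dots> = sw g (\<lambda>a q. sw a (\<lambda>g1 p. sw h (\<lambda>h1 h2. sw h2 (\<lambda>u v. S (g1 * h1) * p * u * S v * S q))))"
    by (simp add: antipode_right_sw[symmetric] sw_mult_left sw_mult_right mult.assoc)
  also have "\<dots> = sw g (\<lambda>a q. sw a (\<lambda>g1 p. sw h (\<lambda>b v. sw b (\<lambda>h1 u. S (g1 * h1) * p * u * S v * S q))))"
    by (rule sw_cong, rule sw_cong, rule coassoc_sw[symmetric]) (simp add: lins2)
  also have "\<dots> = sw g (\<lambda>a q. sw h (\<lambda>b v. es (a * b) * S v * S q))"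
    apply (rule sw_cong, subst sw_swap, rule sw_cong)
    apply (subst antipode_left_sw[symmetric], subst mult_sw)
    by (simp_all add: lins2 sw_mult_right)
  also have "\<dots> = sw g (\<lambda>a q. sw h (\<lambda>b v. sw b (\<lambda>u w. S u * es a * w * S v * S q)))"
    by (simp add: es_conj sw_mult_right)
  also have "\<dots> = sw g (\<lambda>a q. sw h (\<lambda>u c. sw c (\<lambda>w v. S u * es a * w * S v * S q)))"
    by (rule sw_cong, rule coassoc_sw) (simp add: lins2)
  also have "\<dots> = sw g (\<lambda>a q. sw h (\<lambda>u c. S u * (es a * et c) * S q))"
    by (simp add: antipode_right_sw[symmetric] sw_mult_left sw_mult_right mult.assoc)
  also have "\<dots> = sw g (\<lambda>a q. sw h (\<lambda>u c. S u * et c) * (es a * S q))"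
    by (subst Ht_Hs_commute[symmetric, of "et _"]) (simp_all add: sw_mult_right mult.assoc)
  also have "\<dots> = S h * S g" by (simp add: S_et S_es sw_mult_left[symmetric])
  finally show ?thesis .
qed

lemma \<epsilon>_S: "\<epsilon> (S h) = \<epsilon> h"
proof -
  have "\<epsilon> (S h) = sw h (\<lambda>a b. \<epsilon> (S a * et b))" by (simp add: S_et[symmetric, of h] sws)
  also have "\<dots> = sw h (\<lambda>a b. \<epsilon> (S a * b))" by (simp add: \<epsilon>_et)
  also have "\<dots> = \<epsilon> (es h)" by (simp add: antipode_left_sw[symmetric] sws)
  finally show ?thesis using \<epsilon>_es[of h 1] by simp
qed

lemma sw_1_et_es: "bil F \<Longrightarrow> sw 1 (\<lambda>a b. F (es a) (et b)) = sw 1 F"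
proof -
  assume F: "bil F"
  note [simp] = bilD[OF F]
  have "sw 1 (\<lambda>a b. F (es a) (et b)) = sw 1 (\<lambda>a b. F (es a) b)"
    by (rule sw_1_et) (simp add: lins2)
  then show ?thesis by (simp add: sw_1_es[OF F])
qed

lemma S_1[simp]: "S 1 = 1"
proof -
  have "S 1 = sw 1 (\<lambda>a b. S a * et b)" by (simp add: S_et)
  also have "\<dots> = sw 1 (\<lambda>a b. S a * b)" by (rule sw_1_et) (simp add: lins)
  finally show ?thesis using one_in_Hs by (simp add: antipode_left_sw Hs_iff)
qed

lemma S_Hs: assumes "y \<in> Hs" shows "S y = et y"
proof -
  have "et y = sw (y * 1) (\<lambda>a b. a * S b)" by (simp add: antipode_right_sw)
  also have "\<dots> = sw 1 (\<lambda>a b. a * S (y * b))" by (rule sw_Hs_left) (simp_all add: assms lins)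
  also have "\<dots> = et 1 * S y" by (simp add: S_mult sw_mult_right antipode_right_sw[symmetric] mult.assoc)
  finally show ?thesis using one_in_Ht by (simp add: Ht_iff)
qed

lemma S_Ht: assumes "z \<in> Ht" shows "S z = es z"
proof -
  have "es z = sw (1 * z) (\<lambda>a b. S a * b)" by (simp add: antipode_left_sw)
  also have "\<dots> = sw 1 (\<lambda>a b. S (a * z) * b)" by (rule sw_Ht_right) (simp_all add: assms lins)
  also have "\<dots> = S z * es 1" by (simp add: S_mult sw_mult_left antipode_left_sw[symmetric] mult.assoc)
  finally show ?thesis using one_in_Hs by (simp add: Hs_iff)
qed

lemma S_Hs_in[simp]: "y \<in> Hs \<Longrightarrow> S y \<in> Ht" by (simp add: S_Hs)
lemma S_Ht_in[simp]: "z \<in> Ht \<Longrightarrow> S z \<in> Hs" by (simp add: S_Ht)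

lemma \<epsilon>_mult_Hs: "y \<in> Hs \<Longrightarrow> \<epsilon> (h * S y) = \<epsilon> (h * y)" by (simp add: S_Hs \<epsilon>_et)
lemma \<epsilon>_Ht_mult: "z \<in> Ht \<Longrightarrow> \<epsilon> (S z * h) = \<epsilon> (z * h)" by (simp add: S_Ht \<epsilon>_es)

text \<open>
  \<open>\<Delta>(1) = S(1\<^sub>2) \<otimes> S(1\<^sub>1)\<close>. The legs of \<open>\<Delta>(1)\<close> lie in \<open>Hs\<close> and \<open>Ht\<close>, where \<open>S\<close> is given by the counital
  maps; writing these out turns the claim into the weak multiplicativity of \<open>\<epsilon>\<close> at \<open>1\<close>.
\<close>
lemma sw_1_S:
  assumes F: "bil F" shows "sw 1 (\<lambda>a b. F (S b) (S a)) = sw 1 F"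
proof -
  note [simp] = bilD[OF F]
  have "sw 1 (\<lambda>a b. F (S b) (S a)) = sw 1 (\<lambda>a b. F (S (et b)) (S (es a)))"
    by (rule sw_1_et_es[symmetric]) (simp add: lins)
  also have "\<dots> = sw 1 (\<lambda>a b. F (es (et b)) (et (es a)))" by (simp add: S_Hs S_Ht)
  also have "\<dots> = sw 1 (\<lambda>a b. F (es b) (et a))"
    by (rule sw_1_et_es) (simp add: lins2)
  also have "\<dots> = sw 1 (\<lambda>a b. sw 1 (\<lambda>c d. sw 1 (\<lambda>e f. (F (\<epsilon> (b * d) *s c) (\<epsilon> (e * a) *s f)))))"
    by (rule sw_cong, subst sw_swap) (simp only: es_def et_def bil_sw1[OF F] bil_sw2[OF F])
  also have "\<dots> = sw 1 (\<lambda>c d. sw 1 (\<lambda>e f. F c (sw 1 (\<lambda>a b. \<epsilon> (e * a) * \<epsilon> (b * d)) *s f)))"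
    apply (subst sw_swap, rule sw_cong, subst sw_swap, rule sw_cong)
    apply (simp only: sw_scale_left bil_sw2[OF F] bilD(3)[OF F] scale_scale)
    apply (simp only: mult.commute)
    done
  also have "\<dots> = sw 1 (\<lambda>c d. sw 1 (\<lambda>e f. F c (\<epsilon> (e * d) *s f)))"
    by (simp only: counit1_sw[of _ 1, symmetric] mult_1_right)
  also have "\<dots> = sw 1 (\<lambda>c d. F c (et d))"
    by (rule sw_cong) (simp only: et_def bil_sw2[OF F])
  finally show ?thesis by (simp add: sw_1_et[OF F])
qed

text \<open>
  A preimage of \<open>z\<close> is obtained by contracting the flipped form of \<open>\<Delta>(1)\<close> given by \<open>sw_1_S\<close>.
\<close>
lemma Ht_S_image: assumes "z \<in> Ht" obtains y where "y \<in> Hs" "S y = z"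
proof
  define y where "y = sw 1 (\<lambda>a b. \<epsilon> (S b * z) *s es a)"
  have "y = es (sw 1 (\<lambda>a b. \<epsilon> (S b * z) *s a))"
    unfolding y_def sw_hom[of es, OF es_add] by (simp add: es_scale)
  then show "y \<in> Hs" by simp
  have "S y = sw 1 (\<lambda>a b. \<epsilon> (S b * z) *s S (es a))" unfolding y_def by (simp add: sws S_scale)
  also have "\<dots> = sw 1 (\<lambda>a b. \<epsilon> (S b * z) *s S a)" by (rule sw_1_es) (simp add: lins2)
  also have "\<dots> = sw 1 (\<lambda>a b. \<epsilon> (a * z) *s b)" by (rule sw_1_S[of "\<lambda>a b. \<epsilon> (a * z) *s b"]) (simp add: lins)
  finally show "S y = z" using assms by (simp add: Ht_iff et_def)
qed

lemma Hs_S_image: assumes "y \<in> Hs" obtains z where "z \<in> Ht" "S z = y"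
proof
  define z where "z = sw 1 (\<lambda>a b. \<epsilon> (y * S a) *s et b)"
  have "z = et (sw 1 (\<lambda>a b. \<epsilon> (y * S a) *s b))"
    unfolding z_def sw_hom[of et, OF et_add] by (simp add: et_scale)
  then show "z \<in> Ht" by simp
  have "S z = sw 1 (\<lambda>a b. \<epsilon> (y * S a) *s S (et b))" unfolding z_def by (simp add: sws S_scale)
  also have "\<dots> = sw 1 (\<lambda>a b. \<epsilon> (y * S a) *s S b)" by (rule sw_1_et) (simp add: lins2)
  also have "\<dots> = sw 1 (\<lambda>a b. \<epsilon> (y * b) *s a)" by (rule sw_1_S[of "\<lambda>a b. \<epsilon> (y * b) *s a"]) (simp add: lins)
  finally show "S z = y" using assms by (simp add: Hs_iff es_def)
qed

text \<open>
  This lemma and the next three move a counital map on one leg of \<open>\<Delta>(h)\<close> into \<open>\<Delta>(1)\<close>: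
  \<open>h\<^sub>1 \<otimes> \<epsilon>\<^sub>t(h\<^sub>2) = 1\<^sub>1 h \<otimes> 1\<^sub>2\<close> and its three mirror images. They are what lets antipode cancellations
  such as \<open>h\<^sub>1 \<otimes> h\<^sub>2 S(h\<^sub>3)\<close> be carried out.
\<close>
lemma sw_et_right:
  assumes F: "bil F" shows "sw h (\<lambda>a b. F a (et b)) = sw 1 (\<lambda>a b. F (a * h) b)"
proof -
  note [simp] = bilD[OF F]
  have "sw h (\<lambda>a b. F a (et b)) = sw 1 (\<lambda>c d. sw h (\<lambda>a b. F (\<epsilon> (c * b) *s a) d))"
    by (subst sw_swap, rule sw_cong) (simp only: et_def bil_sw2[OF F], rule sw_cong, simp only: bilD(3)[OF F])
  also have "\<dots> = sw 1 (\<lambda>c d. sw h (\<lambda>a b. F (\<epsilon> (es c * b) *s a) d))"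
    by (rule sw_1_es[symmetric]) (simp add: lins2)
  also have "\<dots> = sw 1 (\<lambda>c d. F (es c * h) d)"
    by (rule sw_cong) (simp only: bil_sw1[OF F, symmetric] sw_eps es_in)
  also have "\<dots> = sw 1 (\<lambda>c d. F (c * h) d)"
    by (rule sw_1_es) (simp add: lins2)
  finally show ?thesis .
qed

lemma sw_es_left:
  assumes F: "bil F" shows "sw h (\<lambda>a b. F (es a) b) = sw 1 (\<lambda>a b. F a (h * b))"
proof -
  note [simp] = bilD[OF F]
  have "sw h (\<lambda>a b. F (es a) b) = sw 1 (\<lambda>c d. sw h (\<lambda>a b. F c (\<epsilon> (a * d) *s b)))"
    by (subst sw_swap, rule sw_cong) (simp add: es_def bil_sw1[OF F])
  also have "\<dots> = sw 1 (\<lambda>c d. sw h (\<lambda>a b. F c (\<epsilon> (a * et d) *s b)))"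
    by (rule sw_1_et[symmetric]) (simp add: lins2)
  also have "\<dots> = sw 1 (\<lambda>c d. F c (h * et d))"
    by (rule sw_cong) (simp only: bil_sw2[OF F, symmetric] sw_eps et_in)
  also have "\<dots> = sw 1 (\<lambda>c d. F c (h * d))"
    by (rule sw_1_et) (simp add: lins2)
  finally show ?thesis .
qed

lemma sw_es_right:
  assumes F: "bil F" shows "sw h (\<lambda>a b. F a (es b)) = sw 1 (\<lambda>a b. F (h * a) (S b))"
proof -
  note [simp] = bilD[OF F]
  have "sw h (\<lambda>a b. F a (es b)) = sw 1 (\<lambda>c d. sw h (\<lambda>a b. F (\<epsilon> (b * d) *s a) c))"
    by (subst sw_swap, rule sw_cong) (simp add: es_def bil_sw2[OF F])
  also have "\<dots> = sw 1 (\<lambda>c d. sw h (\<lambda>a b. F (\<epsilon> (b * S c) *s a) (S d)))"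
    by (rule sw_1_S[symmetric, of "\<lambda>c d. sw h (\<lambda>a b. F (\<epsilon> (b * d) *s a) c)"]) (simp add: lins2)
  also have "\<dots> = sw 1 (\<lambda>c d. sw h (\<lambda>a b. F (\<epsilon> (b * S (es c)) *s a) (S d)))"
    by (rule sw_1_es[symmetric]) (simp add: lins2)
  also have "\<dots> = sw 1 (\<lambda>c d. F (h * es c) (S d))"
    by (rule sw_cong) (simp only: bil_sw1[OF F, symmetric] sw_eps es_in \<epsilon>_mult_Hs)
  also have "\<dots> = sw 1 (\<lambda>c d. F (h * c) (S d))"
    by (rule sw_1_es) (simp add: lins2)
  finally show ?thesis .
qed

lemma sw_et_left:
  assumes F: "bil F" shows "sw h (\<lambda>a b. F (et a) b) = sw 1 (\<lambda>a b. F (S a) (b * h))"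
proof -
  note [simp] = bilD[OF F]
  have "sw h (\<lambda>a b. F (et a) b) = sw 1 (\<lambda>c d. sw h (\<lambda>a b. F d (\<epsilon> (c * a) *s b)))"
    by (subst sw_swap, rule sw_cong) (simp add: et_def bil_sw1[OF F])
  also have "\<dots> = sw 1 (\<lambda>c d. sw h (\<lambda>a b. F (S c) (\<epsilon> (S d * a) *s b)))"
    by (rule sw_1_S[symmetric, of "\<lambda>c d. sw h (\<lambda>a b. F d (\<epsilon> (c * a) *s b))"]) (simp add: lins2)
  also have "\<dots> = sw 1 (\<lambda>c d. sw h (\<lambda>a b. F (S c) (\<epsilon> (S (et d) * a) *s b)))"
    by (rule sw_1_et[symmetric]) (simp add: lins2)
  also have "\<dots> = sw 1 (\<lambda>c d. F (S c) (et d * h))"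
    by (rule sw_cong) (simp only: bil_sw2[OF F, symmetric] sw_eps et_in \<epsilon>_Ht_mult)
  also have "\<dots> = sw 1 (\<lambda>c d. F (S c) (d * h))"
    by (rule sw_1_et) (simp add: lins2)
  finally show ?thesis .
qed

text \<open>
  With \<open>sw_1_Ht_left\<close>: base elements can be moved between the legs of \<open>\<Delta>(1)\<close> at the cost of an antipode.
\<close>
lemma sw_1_Hs_right:
  assumes F: "bil F" and y: "y \<in> Hs"
  shows "sw 1 (\<lambda>a b. F (a * y) b) = sw 1 (\<lambda>a b. F a (b * S y))"
proof -
  note [simp] = bilD[OF F]
  have "sw 1 (\<lambda>a b. F (a * y) b) = sw (1 * y) (\<lambda>a b. F a (et b))" using sw_et_right[OF F, of y] by simp
  also have "\<dots> = sw 1 (\<lambda>a b. F a (et (b * y)))" by (rule sw_Hs_right) (simp_all add: y lins2)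
  also have "\<dots> = sw 1 (\<lambda>a b. F a (et (et b * y)))"
    by (rule sw_1_et[symmetric]) (simp add: lins2)
  also have "\<dots> = sw 1 (\<lambda>a b. F a (et b * S y))" by (simp add: et_Ht S_Hs y)
  also have "\<dots> = sw 1 (\<lambda>a b. F a (b * S y))" by (rule sw_1_et) (simp add: lins2)
  finally show ?thesis .
qed

lemma sw_1_Ht_left:
  assumes F: "bil F" and z: "z \<in> Ht"
  shows "sw 1 (\<lambda>a b. F a (z * b)) = sw 1 (\<lambda>a b. F (S z * a) b)"
proof -
  note [simp] = bilD[OF F]
  have "sw 1 (\<lambda>a b. F a (z * b)) = sw (z * 1) (\<lambda>a b. F (es a) b)" using sw_es_left[OF F, of z] by simp
  also have "\<dots> = sw 1 (\<lambda>a b. F (es (z * a)) b)" by (rule sw_Ht_left) (simp_all add: z lins2)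
  also have "\<dots> = sw 1 (\<lambda>a b. F (es (z * es a)) b)"
    by (rule sw_1_es[symmetric]) (simp add: lins2)
  also have "\<dots> = sw 1 (\<lambda>a b. F (S z * es a) b)" by (simp add: es_Hs S_Ht z)
  also have "\<dots> = sw 1 (\<lambda>a b. F (S z * a) b)" by (rule sw_1_es) (simp add: lins2)
  finally show ?thesis .
qed

section \<open>The antipode on coproducts; separability of the base\<close>

text \<open>
  The pattern of \<open>S_mult\<close> for the coproduct: \<open>\<Delta>(S h) = \<Delta>(S h\<^sub>1) \<Delta>(\<epsilon>\<^sub>t(h\<^sub>2))\<close>, and
  \<open>\<Delta>(\<epsilon>\<^sub>t(b)) = b\<^sub>1 S(b\<^sub>4) \<otimes> b\<^sub>2 S(b\<^sub>3)\<close>, so that \<open>\<Delta>(S h\<^sub>1) \<Delta>(h\<^sub>2)\<close> appears and collapses to \<open>\<Delta>(\<epsilon>\<^sub>s(h))\<close>.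
\<close>
lemma sw_S:
  assumes F: "bil F" shows "sw (S h) F = sw h (\<lambda>a b. F (S b) (S a))"
proof -
  note [simp] = bilD[OF F]
  have \<delta>N: "sw (et b) G = sw b (\<lambda>b1 b2. sw b1 (\<lambda>x y. sw b2 (\<lambda>z w. G (x * S w) (y * S z))))"
    if G: "bil G" for b and G :: "'h \<Rightarrow> 'h \<Rightarrow> 'a"
  proof -
    note [simp] = bilD[OF G]
    have "sw b (\<lambda>b1 b2. sw b1 (\<lambda>x y. sw b2 (\<lambda>z w. G (x * S w) (y * S z))))
       = sw b (\<lambda>x c. sw c (\<lambda>y b2. sw b2 (\<lambda>z w. G (x * S w) (y * S z))))"
      by (rule coassoc_sw) (simp add: lins2)
    also have "\<dots> = sw b (\<lambda>x c. sw c (\<lambda>m w. sw m (\<lambda>y z. G (x * S w) (y * S z))))"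
      by (rule sw_cong, rule coassoc_sw[symmetric]) (simp add: lins2)
    also have "\<dots> = sw b (\<lambda>x c. sw c (\<lambda>m w. G (x * S w) (et m)))"
      by (simp only: antipode_right_sw[symmetric] bil_sw2[OF G])
    also have "\<dots> = sw b (\<lambda>e w. sw e (\<lambda>x m. G (x * S w) (et m)))"
      by (rule coassoc_sw[symmetric]) (simp add: lins2)
    also have "\<dots> = sw b (\<lambda>e w. sw 1 (\<lambda>c d. G (c * e * S w) d))"
      by (rule sw_cong, rule sw_et_right) (simp add: lins2)
    also have "\<dots> = sw 1 (\<lambda>c d. G (c * et b) d)"
      by (subst sw_swap, rule sw_cong) (simp only: antipode_right_sw[symmetric] sw_mult_left bil_sw1[OF G] mult.assoc)
    finally show ?thesis using sw_et(2)[OF G] by simp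
  qed
  have "sw (S h) F = sw h (\<lambda>a b. sw (S a * et b) F)"
    by (simp only: S_et[symmetric, of h] sw_sw_arg[OF F])
  also have "\<dots> = sw h (\<lambda>a b. sw (S a) (\<lambda>p q. sw (et b) (\<lambda>u v. F (p * u) (q * v))))"
    by (simp only: mult_sw[OF F])
  also have "\<dots> = sw h (\<lambda>a b. sw b (\<lambda>b1 b2. sw (S a) (\<lambda>p q. sw b1 (\<lambda>x y. sw b2 (\<lambda>z w. F (p * (x * S w)) (q * (y * S z)))))))"
    by (rule sw_cong, subst sw_swap, rule sw_cong, rule \<delta>N) (simp add: lins2)
  also have "\<dots> = sw h (\<lambda>e b2. sw e (\<lambda>a b1. sw (S a) (\<lambda>p q. sw b1 (\<lambda>x y. sw b2 (\<lambda>z w. F (p * (x * S w)) (q * (y * S z)))))))"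
    by (rule coassoc_sw[symmetric]) (simp add: lins2)
  also have "\<dots> = sw h (\<lambda>e b2. sw e (\<lambda>a b1. sw (S a * b1) (\<lambda>p q. sw b2 (\<lambda>z w. F (p * S w) (q * S z)))))"
    by (rule sw_cong, rule sw_cong, subst mult_sw) (simp_all add: lins2)
  also have "\<dots> = sw h (\<lambda>e b2. sw (es e) (\<lambda>p q. sw b2 (\<lambda>z w. F (p * S w) (q * S z))))"
    by (rule sw_cong, simp only: antipode_left_sw[symmetric], rule sw_sw_arg[symmetric]) (simp add: lins2)
  also have "\<dots> = sw h (\<lambda>e b2. sw 1 (\<lambda>p q. sw b2 (\<lambda>z w. F (p * S w) (q * es e * S z))))"
    by (rule sw_cong, rule sw_es(1)) (simp add: lins2)
  also have "\<dots> = sw 1 (\<lambda>p q. sw h (\<lambda>e b2. sw b2 (\<lambda>z w. F (p * S w) (q * (es e * S z)))))"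
    by (subst sw_swap) (simp add: mult.assoc)
  also have "\<dots> = sw 1 (\<lambda>p q. sw h (\<lambda>c w. sw c (\<lambda>e z. F (p * S w) (q * (es e * S z)))))"
    by (rule sw_cong, rule coassoc_sw[symmetric]) (simp add: lins2)
  also have "\<dots> = sw 1 (\<lambda>p q. sw h (\<lambda>c w. F (p * S w) (q * S c)))"
    by (rule sw_cong, rule sw_cong) (simp only: sw_mult_left[symmetric] bil_sw2[OF F, symmetric] S_es)
  also have "\<dots> = sw 1 (\<lambda>p q. sw h (\<lambda>c w. F (S q * S w) (S p * S c)))"
    by (rule sw_1_S[symmetric]) (simp add: lins2)
  also have "\<dots> = sw h (\<lambda>c w. F (S w) (S c))"
    by (subst sw_swap, subst sw_one_mult(2)[of "\<lambda>a b. F (S b) (S a)", symmetric]) (simp_all add: lins2 S_mult)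
  finally show ?thesis .
qed

text \<open>
  The restriction of \<open>\<epsilon>\<close> to \<open>Hs\<close> is a nondegenerate form, and \<open>S\<^sup>2\<close> plays the role of its Nakayama
  automorphism.
\<close>
lemma Hs_form_flip:
  assumes "a \<in> Hs" "b \<in> Hs" shows "\<epsilon> (a * b) = \<epsilon> (S (S b) * a)"
  using assms by (metis S_Hs_in \<epsilon>_Ht_mult \<epsilon>_mult_Hs Ht_Hs_commute)

lemma Hs_nondeg_right:
  assumes y: "y \<in> Hs" and 0: "\<And>a. a \<in> Hs \<Longrightarrow> \<epsilon> (y * a) = 0" shows "y = 0"
proof -
  have "\<epsilon> (y * et b) = 0" for b
    using Ht_S_image[OF et_in[of b]] 0 \<epsilon>_mult_Hs by metis
  then have "\<epsilon> (y * b) = 0" for b by (simp add: \<epsilon>_et)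
  then have "es y = 0" by (simp add: es_def)
  then show ?thesis using y by (simp add: Hs_iff)
qed

lemma Ht_nondeg_left:
  assumes z: "z \<in> Ht" and 0: "\<And>a. a \<in> Ht \<Longrightarrow> \<epsilon> (a * z) = 0" shows "z = 0"
proof -
  have "\<epsilon> (es b * z) = 0" for b
    using Hs_S_image[OF es_in[of b]] 0 \<epsilon>_Ht_mult by metis
  then have "\<epsilon> (b * z) = 0" for b by (simp add: \<epsilon>_es)
  then have "et z = 0" by (simp add: et_def)
  then show ?thesis using z by (simp add: Ht_iff)
qed

text \<open>
  A Nakayama automorphism fixes central elements.
\<close>
lemma SS_central:
  assumes e: "e \<in> Hs" and c: "\<And>y. y \<in> Hs \<Longrightarrow> e * y = y * e"
  shows "S (S e) = e"
proof -
  have "S (S e) - e = 0"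
  proof (rule Hs_nondeg_right)
    show "S (S e) - e \<in> Hs" using e by (simp add: subspace_diff Hs_subspace)
    fix a assume a: "a \<in> Hs"
    show "\<epsilon> ((S (S e) - e) * a) = 0"
      using Hs_form_flip[OF a e] c[OF a] by (simp add: left_diff_distrib \<epsilon>_diff)
  qed
  then show ?thesis by simp
qed

text \<open>
  Applying \<open>S\<close> exchanges the two sides of \<open>e\<close>: if \<open>\<epsilon>\<close> does not see the right factor of \<open>e x e\<close>, it does
  not see the left one either. This upgrades one-sided invariance of an idempotent to two-sided invariance.
\<close>
lemma \<epsilon>_corner:
  assumes e: "e \<in> Hs" "S (S e) = e" and c: "\<And>x. \<epsilon> (e * x * e) = \<epsilon> (e * x)"
  shows "\<epsilon> (e * x * e) = \<epsilon> (x * e)"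
proof -
  have 1: "\<epsilon> (x * S e) = \<epsilon> (x * e)" for x by (rule \<epsilon>_mult_Hs[OF e(1)])
  have 2: "\<epsilon> (S e * x) = \<epsilon> (e * x)" for x using \<epsilon>_Ht_mult[of "S e" x] e by simp
  have "\<epsilon> (e * x * e) = \<epsilon> (S e * (S x * S e))" using \<epsilon>_S[of "e * x * e"] by (simp add: S_mult mult.assoc)
  also have "\<dots> = \<epsilon> (e * S x * S e)" by (simp add: 2 mult.assoc)
  also have "\<dots> = \<epsilon> (e * S x)" by (simp add: 1 c)
  also have "\<dots> = \<epsilon> (S e * S x)" by (simp add: 2)
  also have "\<dots> = \<epsilon> (x * e)" using \<epsilon>_S[of "x * e"] by (simp add: S_mult)
  finally show ?thesis .
qed

end

lemma (in vector_space) subspace_projection: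
  assumes "subspace Z"
  obtains p where "Vector_Spaces.linear scale scale p" "\<And>x. p x \<in> Z" "\<And>x. x \<in> Z \<Longrightarrow> p x = x"
proof -
  interpret vector_space_pair scale scale by unfold_locales
  have "\<exists>g. range g \<subseteq> Z \<and> Vector_Spaces.linear scale scale g \<and> (\<forall>v\<in>Z. g (id v) = v)"
    using linear_exists_left_inverse_on[OF linear_id assms] by auto
  then show ?thesis using that by auto
qed

context weak_hopf_algebra
begin

abbreviation lin :: "('h \<Rightarrow> 'h) \<Rightarrow> bool" where "lin \<equiv> Vector_Spaces.linear scale scale"
abbreviation linf :: "('h \<Rightarrow> 'k) \<Rightarrow> bool" where "linf \<equiv> Vector_Spaces.linear scale (*)"

lemma vs_field: "vector_space ((*) :: 'k \<Rightarrow> 'k \<Rightarrow> 'k)"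
  by unfold_locales (simp_all add: algebra_simps)

lemma linI: "(\<And>x y. f (x + y) = f x + f y) \<Longrightarrow> (\<And>r x. f (r *s x) = r *s f x) \<Longrightarrow> lin f"
  by (simp add: Vector_Spaces.linear_iff vector_space_axioms)
lemma linfI: "(\<And>x y. f (x + y) = f x + f y) \<Longrightarrow> (\<And>r x. f (r *s x) = r * f x) \<Longrightarrow> linf f"
  by (simp add: Vector_Spaces.linear_iff vector_space_axioms vs_field)
lemma linD: assumes "lin f" shows "f (x + y) = f x + f y" "f (r *s x) = r *s f x" "f 0 = 0" "f (x - y) = f x - f y"
proof -
  show 1: "f (x + y) = f x + f y" "f (r *s x) = r *s f x" for x y r using assms by (simp_all add: Vector_Spaces.linear_iff)
  show "f 0 = 0" using 1(2)[of 0 0] by simp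
  show "f (x - y) = f x - f y" using 1(1)[of "x - y" y] by simp
qed
lemma linfD: assumes "linf f" shows "f (x + y) = f x + f y" "f (r *s x) = r * f x" "f 0 = 0" "f (x - y) = f x - f y"
proof -
  show 1: "f (x + y) = f x + f y" "f (r *s x) = r * f x" for x y r using assms by (simp_all add: Vector_Spaces.linear_iff)
  show "f 0 = 0" using 1(2)[of 0 0] by simp
  show "f (x - y) = f x - f y" using 1(1)[of "x - y" y] by simp
qed
lemma lin_sw: "lin f \<Longrightarrow> f (sw h F) = sw h (\<lambda>a b. f (F a b))" by (rule sw_hom) (rule linD)
lemma linf_sw: "linf f \<Longrightarrow> f (sw h F) = sw h (\<lambda>a b. f (F a b))" by (rule sw_hom) (rule linfD)

lemma sw_in_subspace:
  assumes "subspace Z" "\<And>a b. F a b \<in> Z" shows "sw h F \<in> Z"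
proof -
  have "sum_list (map (\<lambda>(a, b). F a b) xs) \<in> Z" for xs
    by (induction xs) (auto simp: assms subspace_0 subspace_add)
  then show ?thesis by (simp add: sw_def)
qed

text \<open>
  Separability of \<open>Hs\<close>: averaging any linear projection \<open>p\<close> with the separability element
  \<open>1\<^sub>1 \<otimes> S(1\<^sub>2)\<close> gives the \<open>Hs\<close>-linear projection \<open>x \<mapsto> p(x 1\<^sub>1) S(1\<^sub>2)\<close>.
\<close>
lemma Hs_split_right:
  assumes Z: "subspace Z" and ZHs: "\<And>x y. x \<in> Z \<Longrightarrow> y \<in> Hs \<Longrightarrow> x * y \<in> Z"
  obtains P where "lin P" "\<And>x. P x \<in> Z" "\<And>x. x \<in> Z \<Longrightarrow> P x = x" "\<And>x y. y \<in> Hs \<Longrightarrow> P (x * y) = P x * y"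
proof -
  obtain p where lp: "lin p" and p: "\<And>x. p x \<in> Z" "\<And>x. x \<in> Z \<Longrightarrow> p x = x"
    by (rule subspace_projection[OF Z]) blast
  note [simp] = linD[OF lp]
  (* The counital maps make it visible that the legs are base elements; they
     can be dropped afterwards. *)
  define P where "P x = sw 1 (\<lambda>a b. p (x * es a) * S (et b))" for x
  have P: "P x = sw 1 (\<lambda>a b. p (x * a) * S b)" for x
    unfolding P_def by (rule sw_1_et_es) (simp add: lins2)
  show thesis
  proof (rule that[of P])
    show "lin P" by (rule linI) (simp_all add: P lins2 sws)
    show "P x \<in> Z" for x unfolding P_def by (rule sw_in_subspace[OF Z]) (simp add: p ZHs)
    show "P x = x" if "x \<in> Z" for x
    proof -
      have "P x = sw 1 (\<lambda>a b. x * es a * S (et b))" unfolding P_def by (simp add: p ZHs that)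
      also have "\<dots> = sw 1 (\<lambda>a b. x * a * S b)" by (rule sw_1_et_es) (simp add: lins2)
      also have "\<dots> = x * et 1" by (simp add: antipode_right_sw[symmetric] sw_mult_left mult.assoc)
      finally show ?thesis using one_in_Ht by (simp add: Ht_iff)
    qed
    fix x y assume "y \<in> Hs"
    then obtain z where z: "z \<in> Ht" "S z = y" by (rule Hs_S_image)
    have "P (x * y) = sw 1 (\<lambda>a b. p (x * (S z * a)) * S b)" by (simp add: P z mult.assoc)
    also have "\<dots> = sw 1 (\<lambda>a b. p (x * a) * S (z * b))"
      by (rule sw_1_Ht_left[symmetric]) (simp_all add: lins2 z)
    finally show "P (x * y) = P x * y" by (simp add: P z sw_mult_right S_mult mult.assoc)
  qed
qed

lemma Hs_split_left:
  assumes Z: "subspace Z" and ZHs: "\<And>x y. x \<in> Z \<Longrightarrow> y \<in> Hs \<Longrightarrow> y * x \<in> Z"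
  obtains P where "lin P" "\<And>x. P x \<in> Z" "\<And>x. x \<in> Z \<Longrightarrow> P x = x" "\<And>x y. y \<in> Hs \<Longrightarrow> P (y * x) = y * P x"
proof -
  obtain p where lp: "lin p" and p: "\<And>x. p x \<in> Z" "\<And>x. x \<in> Z \<Longrightarrow> p x = x"
    by (rule subspace_projection[OF Z]) blast
  note [simp] = linD[OF lp]
  define P where "P x = sw 1 (\<lambda>a b. es a * p (S (et b) * x))" for x
  have P: "P x = sw 1 (\<lambda>a b. a * p (S b * x))" for x
    unfolding P_def by (rule sw_1_et_es) (simp add: lins2)
  show thesis
  proof (rule that[of P])
    show "lin P" by (rule linI) (simp_all add: P lins2 sws)
    show "P x \<in> Z" for x unfolding P_def by (rule sw_in_subspace[OF Z]) (simp add: p ZHs)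
    show "P x = x" if "x \<in> Z" for x
    proof -
      have "P x = sw 1 (\<lambda>a b. es a * (S (et b) * x))" unfolding P_def by (simp add: p ZHs that)
      also have "\<dots> = sw 1 (\<lambda>a b. a * (S b * x))" by (rule sw_1_et_es) (simp add: lins2)
      also have "\<dots> = et 1 * x" by (simp add: antipode_right_sw[symmetric] sw_mult_right mult.assoc)
      finally show ?thesis using one_in_Ht by (simp add: Ht_iff)
    qed
    fix x y assume "y \<in> Hs"
    then obtain z where z: "z \<in> Ht" "S z = y" by (rule Hs_S_image)
    have "P (y * x) = sw 1 (\<lambda>a b. a * p (S (z * b) * x))" by (simp add: P z S_mult mult.assoc)
    also have "\<dots> = sw 1 (\<lambda>a b. (S z * a) * p (S b * x))"
      by (rule sw_1_Ht_left) (simp_all add: lins2 z)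
    finally show "P (y * x) = y * P x" by (simp add: P z sw_mult_left mult.assoc)
  qed
qed

text \<open>
  The image of \<open>1\<close> under an \<open>Hs\<close>-linear projection onto the ideal is a left unit of it.
\<close>
lemma Hs_right_ideal:
  assumes J: "subspace J" "J \<subseteq> Hs" and JHs: "\<And>x y. x \<in> J \<Longrightarrow> y \<in> Hs \<Longrightarrow> x * y \<in> J"
  obtains e where "e \<in> J" "\<And>x. x \<in> J \<Longrightarrow> e * x = x"
proof (rule Hs_split_right[OF J(1) JHs])
  fix P assume P: "\<And>x. P x \<in> J" "\<And>x. x \<in> J \<Longrightarrow> P x = x" "\<And>x y. y \<in> Hs \<Longrightarrow> P (x * y) = P x * y"
  show thesis
  proof (rule that[of "P 1"])
    show "P 1 * x = x" if "x \<in> J" for x using P(3)[of x 1] P(2)[OF that] that J(2) by auto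
  qed (rule P)
qed

lemma Hs_ideal:
  assumes J: "subspace J" "J \<subseteq> Hs" and r: "\<And>x y. x \<in> J \<Longrightarrow> y \<in> Hs \<Longrightarrow> x * y \<in> J"
    and l: "\<And>x y. x \<in> J \<Longrightarrow> y \<in> Hs \<Longrightarrow> y * x \<in> J"
  obtains e where "e \<in> J" "e \<in> Hs" "\<And>x. x \<in> J \<Longrightarrow> e * x = x" "\<And>x. x \<in> J \<Longrightarrow> x * e = x"
    "\<And>y. y \<in> Hs \<Longrightarrow> e * y = y * e" "e * e = e" "S (S e) = e"
proof -
  obtain f where f: "f \<in> J" "\<And>x. x \<in> J \<Longrightarrow> f * x = x"
    by (rule Hs_right_ideal[OF J r]) blast+
  obtain e where e: "e \<in> J" "\<And>x. x \<in> J \<Longrightarrow> x * e = x"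
  proof (rule Hs_split_left[OF J(1) l])
    fix P assume P: "\<And>x. P x \<in> J" "\<And>x. x \<in> J \<Longrightarrow> P x = x" "\<And>x y. y \<in> Hs \<Longrightarrow> P (y * x) = y * P x"
    show thesis
    proof (rule that[of "P 1"])
      show "x * P 1 = x" if "x \<in> J" for x using P(3)[of x 1] P(2)[OF that] that J(2) by auto
    qed (rule P)
  qed
  have ef: "e = f" using e f by metis
  have eHs: "e \<in> Hs" using e J by auto
  have c: "e * y = y * e" if y: "y \<in> Hs" for y
    using e(2)[OF r[OF e(1) y]] f(2)[OF l[OF e(1) y]] ef by (simp add: mult.assoc)
  show thesis using that[OF e(1) eHs _ e(2) c e(2)[OF e(1)] SS_central[OF eHs c]] f(2) ef by simp
qed

end

section \<open>Integrals and a trace formula\<close>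

locale fd_weak_hopf_algebra = weak_hopf_algebra scale \<Delta> \<epsilon> S
  for scale :: "'k::field \<Rightarrow> 'h::{ring, monoid_mult} \<Rightarrow> 'h" (infixr \<open>*s\<close> 75)
    and \<Delta> :: "'h \<Rightarrow> ('h \<times> 'h) list" and \<epsilon> :: "'h \<Rightarrow> 'k" and S :: "'h \<Rightarrow> 'h" +
  assumes fin: finite_dim
begin

definition bas :: "'h set" where "bas = (SOME B. finite B \<and> independent B \<and> span B = UNIV)"

lemma bas: "finite bas" "independent bas" "span bas = UNIV"
proof -
  obtain B where B: "finite B" "span B = UNIV" using fin by (auto simp: finite_dim_def)
  obtain C where C: "C \<subseteq> B" "independent C" "B \<subseteq> span C"
    by (rule maximal_independent_subset)
  have "finite C \<and> independent C \<and> span C = UNIV"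
    using B C finite_subset span_mono[OF C(3)] by (auto simp: span_span)
  from someI[of "\<lambda>B. finite B \<and> independent B \<and> span B = UNIV", OF this]
  show "finite bas" "independent bas" "span bas = UNIV" unfolding bas_def by auto
qed

sublocale finite_dimensional_vector_space scale bas
  by unfold_locales (rule bas)+

text \<open>
  Coordinates with respect to the chosen basis, that is, the dual basis.
\<close>
definition cf :: "'h \<Rightarrow> 'h \<Rightarrow> 'k" where "cf b x = representation bas x b"

lemma cf_add: "cf b (x + y) = cf b x + cf b y"
  unfolding cf_def by (subst representation_add) (simp_all add: bas)
lemma cf_scale: "cf b (r *s x) = r * cf b x"
  unfolding cf_def by (subst representation_scale) (simp_all add: bas)
lemma cf_linf: "linf (cf b)" by (rule linfI) (rule cf_add cf_scale)+
lemma cf_expand: "(\<Sum>b\<in>bas. cf b x *s b) = x"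
  unfolding cf_def by (rule sum_representation_eq) (simp_all add: bas)

lemma sum_lin: "lin f \<Longrightarrow> f (\<Sum>b\<in>A. g b) = (\<Sum>b\<in>A. f (g b))"
  by (induction A rule: infinite_finite_induct) (simp_all only: sum.infinite sum.empty sum.insert linD(1,3) not_False_eq_True)
lemma sum_linf: "linf f \<Longrightarrow> f (\<Sum>b\<in>A. g b) = (\<Sum>b\<in>A. f (g b))"
  by (induction A rule: infinite_finite_induct) (simp_all only: sum.infinite sum.empty sum.insert linfD(1,3) not_False_eq_True)

lemma cf_expand_linf: "linf f \<Longrightarrow> (\<Sum>b\<in>bas. cf b x * f b) = f x"
  using sum_linf[of f "\<lambda>b. cf b x *s b" bas] by (simp only: cf_expand linfD(2))
lemma cf_expand_lin: "lin f \<Longrightarrow> (\<Sum>b\<in>bas. cf b x *s f b) = f x"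
  using sum_lin[of f "\<lambda>b. cf b x *s b" bas] by (simp only: cf_expand linD(2))

lemma linf_eqI: "(\<And>f. linf f \<Longrightarrow> f x = f y) \<Longrightarrow> x = y"
proof -
  assume "\<And>f. linf f \<Longrightarrow> f x = f y"
  then have "cf b x = cf b y" for b using cf_linf by blast
  then show "x = y" by (subst (1 2) cf_expand[symmetric]) simp
qed

lemma sw_sum: "sw h (\<lambda>a b. \<Sum>i\<in>A. F i a b) = (\<Sum>i\<in>A. sw h (F i))"
  by (induction A rule: infinite_finite_induct) (simp_all add: sw_plus)

text \<open>
  For \<open>X\<close> bilinear in a vector and a functional, the sum \<open>\<Sum>b\<in>bas. X b (cf b)\<close> is a vector-valued trace.
  Bilinearity is required on linear functionals only.
\<close>
definition trace_bilinear :: "('h \<Rightarrow> ('h \<Rightarrow> 'k) \<Rightarrow> 'h) \<Rightarrow> bool" where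
  "trace_bilinear X \<longleftrightarrow> (\<forall>\<phi>. linf \<phi> \<longrightarrow> lin (\<lambda>u. X u \<phi>)) \<and> 
    (\<forall>u \<phi> r. linf \<phi> \<longrightarrow> X u (\<lambda>x. r * \<phi> x) = r *s X u \<phi>) \<and>
    (\<forall>u \<phi> \<psi>. linf \<phi> \<longrightarrow> linf \<psi> \<longrightarrow> X u (\<lambda>x. \<phi> x + \<psi> x) = X u \<phi> + X u \<psi>)"

lemma linf_scale: "linf \<phi> \<Longrightarrow> linf (\<lambda>x. r * \<phi> x)"
  by (rule linfI) (simp_all only: linfD(1,2) distrib_left mult.left_commute)
lemma linf_plus: "linf \<phi> \<Longrightarrow> linf \<psi> \<Longrightarrow> linf (\<lambda>x. \<phi> x + \<psi> x)"
  by (rule linfI) (simp_all only: linfD(1,2) distrib_left ac_simps)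
lemma linf_zero: "linf (\<lambda>x. 0)" by (rule linfI) simp_all
lemma linf_sum: "(\<And>i. i \<in> A \<Longrightarrow> linf (\<phi> i)) \<Longrightarrow> linf (\<lambda>x. \<Sum>i\<in>A. \<phi> i x)"
  by (induction A rule: infinite_finite_induct) (auto intro: linf_plus linf_zero)
lemma linf_comp: "linf \<phi> \<Longrightarrow> lin f \<Longrightarrow> linf (\<lambda>x. \<phi> (f x))"
  by (rule linfI) (simp_all only: linfD(1,2) linD(1,2))
lemma lin_comp: "lin g \<Longrightarrow> lin f \<Longrightarrow> lin (\<lambda>x. g (f x))"
  by (rule linI) (simp_all only: linD(1,2))
lemma lin_mult_left: "lin (\<lambda>x. a * x)" and lin_mult_right: "lin (\<lambda>x. x * a)"
  by (rule linI; simp add: lins)+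

lemma trace_bilinear_sum:
  assumes X: "trace_bilinear X" and \<phi>: "\<And>i. i \<in> A \<Longrightarrow> linf (\<phi> i)" and A: "finite A" "A \<noteq> {}"
  shows "X u (\<lambda>x. \<Sum>i\<in>A. r i * \<phi> i x) = (\<Sum>i\<in>A. r i *s X u (\<phi> i))"
  using A \<phi>
proof (induction rule: finite_ne_induct)
  case (singleton x) then show ?case using X by (simp add: trace_bilinear_def)
next
  case (insert x F)
  have "linf (\<lambda>y. r x * \<phi> x y)" "linf (\<lambda>y. \<Sum>i\<in>F. r i * \<phi> i y)"
    using insert.prems by (auto intro!: linf_sum linf_scale)
  then show ?case using X insert by (simp add: trace_bilinear_def)
qed

lemma trace_cyclic:
  assumes X: "trace_bilinear X" and A: "lin A" and B: "lin B"
  shows "(\<Sum>b\<in>bas. X (A b) (\<lambda>x. cf b (B x))) = (\<Sum>b\<in>bas. X (A (B b)) (cf b))"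
proof (cases "bas = {}")
  case False
  have *: "cf b (B x) = (\<Sum>c\<in>bas. cf b (B c) * cf c x)" for b x
  proof -
    have "linf (\<lambda>x. cf b (B x))" by (rule linf_comp[OF cf_linf B])
    from cf_expand_linf[OF this, of x] show ?thesis by (simp add: mult.commute)
  qed
  have "(\<Sum>b\<in>bas. X (A b) (\<lambda>x. cf b (B x))) = (\<Sum>b\<in>bas. \<Sum>c\<in>bas. cf b (B c) *s X (A b) (cf c))"
    by (subst *) (simp add: trace_bilinear_sum[OF X cf_linf _ False] bas)
  also have "\<dots> = (\<Sum>c\<in>bas. \<Sum>b\<in>bas. cf b (B c) *s X (A b) (cf c))" by (rule sum.swap)
  also have "\<dots> = (\<Sum>c\<in>bas. X (A (B c)) (cf c))"
  proof (rule sum.cong[OF HOL.refl])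
    fix c
    have "lin (\<lambda>u. X (A u) (cf c))" using X cf_linf by (intro lin_comp[OF _ A]) (simp add: trace_bilinear_def)
    from cf_expand_lin[OF this] show "(\<Sum>b\<in>bas. cf b (B c) *s X (A b) (cf c)) = X (A (B c)) (cf c)" .
  qed
  finally show ?thesis .
qed simp

text \<open>
  The left integrals.
\<close>
definition L :: "'h set" where "L = {l. \<forall>h. h * l = et h * l}"

lemma L_subspace: "subspace L"
  by (auto simp: subspace_def L_def distrib_left scale_mult_right)

lemma L_right_ideal: "l \<in> L \<Longrightarrow> l * x \<in> L"
  unfolding L_def by (auto simp: mult.assoc[symmetric])

text \<open>
  The element \<open>(b m)\<^sub>1 e\<^sup>b(S\<^sup>2((b m)\<^sub>2))\<close>, summed over dual bases \<open>b\<close>, \<open>e\<^sup>b\<close>: a trace in the second leg, which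
  replaces the projection onto coinvariants in the fundamental theorem of Hopf modules.
\<close>
definition E :: "'h \<Rightarrow> 'h" where
  "E m = (\<Sum>b\<in>bas. sw (b * m) (\<lambda>x y. cf b (S (S y)) *s x))"

lemma E_lin: "lin E"
  unfolding E_def
  by (rule linI) (simp_all add: lins2 cf_add cf_scale sum.distrib sws scale_sum_right)

text \<open>
  Multiplying by \<open>h\<close> in front of the trace is the same as inserting \<open>h\<^sub>1\<close> and \<open>S(h\<^sub>2)\<close> at the two sides
  of the traced endomorphism; cyclicity of the trace brings them together to \<open>h\<^sub>1 S(h\<^sub>2) = \<epsilon>\<^sub>t(h)\<close>.
\<close>
lemma E_in_L: "E m \<in> L"
proof -
  define X where "X u \<phi> = sw (u * m) (\<lambda>x y. \<phi> (S (S y)) *s x)" for u and \<phi> :: "'h \<Rightarrow> 'k"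
  have X: "trace_bilinear X"
    unfolding trace_bilinear_def
  proof (intro conjI allI impI)
    fix \<phi> \<psi> :: "'h \<Rightarrow> 'k" and u r assume \<phi>: "linf \<phi>"
    note [simp] = linfD[OF \<phi>]
    show "lin (\<lambda>u. X u \<phi>)" by (rule linI) (simp_all add: X_def lins2 sws)
    show "X u (\<lambda>x. r * \<phi> x) = r *s X u \<phi>" "X u (\<lambda>x. \<phi> x + \<psi> x) = X u \<phi> + X u \<psi>"
      by (simp_all add: X_def lins2 sws)
  qed
  have EX: "E m = (\<Sum>b\<in>bas. X b (cf b))" by (simp add: E_def X_def)
  have claim: "h * X u \<phi> = sw h (\<lambda>h1 h2. X (h1 * u) (\<lambda>w. \<phi> (S h2 * w)))" if \<phi>: "linf \<phi>" for h u \<phi>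
  proof -
    note [simp] = linfD[OF \<phi>]
    define n where "n = u * m"
    have "sw h (\<lambda>h1 h2. X (h1 * u) (\<lambda>w. \<phi> (S h2 * w)))
        = sw h (\<lambda>h1 h2. sw h1 (\<lambda>p q. sw n (\<lambda>x y. \<phi> (S h2 * S (S (q * y))) *s (p * x))))"
      unfolding X_def mult.assoc n_def[symmetric]
      by (rule sw_cong, rule mult_sw) (simp add: lins2)
    also have "\<dots> = sw h (\<lambda>p r. sw r (\<lambda>q h2. sw n (\<lambda>x y. \<phi> (S (S q * h2) * S (S y)) *s (p * x))))"
      by (subst coassoc_sw) (simp_all add: lins2 S_mult)
    also have "\<dots> = sw h (\<lambda>p r. sw n (\<lambda>x y. \<phi> (S (es r) * S (S y)) *s (p * x)))"
      by (rule sw_cong, subst sw_swap, rule sw_cong)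
        (simp only: antipode_left_sw[symmetric] sws sw_mult_right linf_sw[OF \<phi>])
    also have "\<dots> = sw 1 (\<lambda>a b. sw n (\<lambda>x y. \<phi> (S (S b) * S (S y)) *s (h * a * x)))"
      by (rule sw_es_right) (simp add: lins2)
    also have "\<dots> = sw 1 (\<lambda>a b. sw n (\<lambda>x y. \<phi> (S (S (b * y))) *s (h * (a * x))))"
      by (simp add: S_mult mult.assoc)
    also have "\<dots> = sw n (\<lambda>x y. \<phi> (S (S y)) *s (h * x))"
      by (rule sw_one_mult(1)) (simp add: lins2)
    also have "\<dots> = h * X u \<phi>" by (simp add: X_def n_def sw_mult_left scale_mult_right)
    finally show ?thesis ..
  qed
  have trace_moved: "h * E m = (\<Sum>b\<in>bas. X (et h * b) (cf b))" for h
  proof -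
    have "h * E m = sw h (\<lambda>h1 h2. \<Sum>b\<in>bas. X (h1 * b) (\<lambda>w. cf b (S h2 * w)))"
      unfolding EX by (simp add: sum_distrib_left claim cf_linf sw_sum)
    also have "\<dots> = sw h (\<lambda>h1 h2. \<Sum>b\<in>bas. X (h1 * (S h2 * b)) (cf b))"
      by (rule sw_cong, rule trace_cyclic[OF X]; rule linI) (simp_all add: lins)
    also have "\<dots> = (\<Sum>b\<in>bas. sw h (\<lambda>h1 h2. X (h1 * S h2 * b) (cf b)))"
      by (simp add: sw_sum mult.assoc)
    also have "\<dots> = (\<Sum>b\<in>bas. X (sw h (\<lambda>h1 h2. h1 * S h2 * b)) (cf b))"
      using X cf_linf by (intro sum.cong HOL.refl lin_sw[symmetric, of "\<lambda>u. X u (cf _)"]) (auto simp: trace_bilinear_def)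
    finally show ?thesis by (simp add: antipode_right_sw[symmetric] sw_mult_right)
  qed
  have "X (et h * b) (cf b) = et h * X b (cf b)" for h b
  proof -
    have "X (et h * b) (cf b) = sw (et h * (b * m)) (\<lambda>x y. cf b (S (S y)) *s x)" by (simp add: X_def mult.assoc)
    also have "\<dots> = sw (b * m) (\<lambda>x y. cf b (S (S y)) *s (et h * x))"
      by (rule sw_Ht_left) (simp_all add: lins2 cf_add cf_scale)
    finally show ?thesis by (simp add: X_def sw_mult_left scale_mult_right)
  qed
  then have "h * E m = et h * E m" for h unfolding trace_moved by (simp add: EX sum_distrib_left)
  then show ?thesis by (simp add: L_def)
qed

text \<open>
  Expanding a product \<open>j i\<close> of basis vectors in the basis merges two traces into one.
\<close>
lemma double_trace:
  assumes Y: "\<And>\<phi> \<psi>. linf \<phi> \<Longrightarrow> linf \<psi> \<Longrightarrow> lin (\<lambda>u. sw (u * m) (\<lambda>x y. sw x (\<lambda>p q. (\<psi> (f y) * \<phi> (g q)) *s p)))"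
  shows "(\<Sum>i\<in>bas. \<Sum>j\<in>bas. sw (j * i * m) (\<lambda>x y. sw x (\<lambda>p q. (cf j (f y) * cf i (g q)) *s p)))
     = (\<Sum>k\<in>bas. sw (k * m) (\<lambda>x y. sw x (\<lambda>p q. cf k (f y * g q) *s p)))"
proof -
  have "sw (j * i * m) (\<lambda>x y. sw x (\<lambda>p q. (cf j (f y) * cf i (g q)) *s p))
     = (\<Sum>k\<in>bas. sw (k * m) (\<lambda>x y. sw x (\<lambda>p q. (cf k (j * i) * cf j (f y) * cf i (g q)) *s p)))" for i j
    by (subst cf_expand_lin[OF Y[OF cf_linf cf_linf], symmetric, where x="j * i"])
       (simp add: sw_scale_out mult.assoc)
  then have "(\<Sum>i\<in>bas. \<Sum>j\<in>bas. sw (j * i * m) (\<lambda>x y. sw x (\<lambda>p q. (cf j (f y) * cf i (g q)) *s p)))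
    = (\<Sum>i\<in>bas. \<Sum>j\<in>bas. \<Sum>k\<in>bas. sw (k * m) (\<lambda>x y. sw x (\<lambda>p q. (cf k (j * i) * cf j (f y) * cf i (g q)) *s p)))"
    by simp
  also have "\<dots> = (\<Sum>i\<in>bas. \<Sum>k\<in>bas. \<Sum>j\<in>bas. sw (k * m) (\<lambda>x y. sw x (\<lambda>p q. (cf k (j * i) * cf j (f y) * cf i (g q)) *s p)))"
    by (intro sum.cong HOL.refl sum.swap)
  also have "\<dots> = (\<Sum>k\<in>bas. \<Sum>i\<in>bas. \<Sum>j\<in>bas. sw (k * m) (\<lambda>x y. sw x (\<lambda>p q. (cf k (j * i) * cf j (f y) * cf i (g q)) *s p)))"
    by (rule sum.swap)
  also have "\<dots> = (\<Sum>k\<in>bas. sw (k * m) (\<lambda>x y. sw x (\<lambda>p q. (\<Sum>i\<in>bas. \<Sum>j\<in>bas. cf k (j * i) * cf j (f y) * cf i (g q)) *s p)))"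
    by (simp add: sw_sum[symmetric] scale_sum_left)
  also have "(\<lambda>k y q. (\<Sum>i\<in>bas. \<Sum>j\<in>bas. cf k (j * i) * cf j (f y) * cf i (g q))) = (\<lambda>k y q. cf k (f y * g q))"
  proof (intro ext)
    fix k y q
    have l: "linf (\<lambda>u. cf k (u * v))" "linf (\<lambda>v. cf k (u * v))" for u v
      by (rule linfI; simp add: lins cf_add cf_scale)+
    have "(\<Sum>i\<in>bas. \<Sum>j\<in>bas. cf k (j * i) * cf j (f y) * cf i (g q))
       = (\<Sum>i\<in>bas. cf i (g q) * (\<Sum>j\<in>bas. cf j (f y) * cf k (j * i)))"
      by (simp add: sum_distrib_left mult.commute mult.left_commute)
    then show "(\<Sum>i\<in>bas. \<Sum>j\<in>bas. cf k (j * i) * cf j (f y) * cf i (g q)) = cf k (f y * g q)"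
      by (simp add: cf_expand_linf[OF l(1)] cf_expand_linf[OF l(2)])
  qed
  finally show ?thesis .
qed

text \<open>
  The fundamental theorem of Hopf modules in coordinates. It exhibits every \<open>m\<close> as a combination of
  left legs of integrals: the two traces merge, \<open>S\<^sup>2(y\<^sub>2) S(y\<^sub>1)\<close> becomes \<open>S(\<epsilon>\<^sub>t(y))\<close>, and the remaining
  trace is the expansion of \<open>1\<^sub>1 S(1\<^sub>2) m = m\<close>.
\<close>
lemma E_reconstruct: "(\<Sum>i\<in>bas. sw (E (i * m)) (\<lambda>p q. cf i (S q) *s p)) = m"
proof -
  have "(\<Sum>i\<in>bas. sw (E (i * m)) (\<lambda>p q. cf i (S q) *s p))
    = (\<Sum>i\<in>bas. \<Sum>j\<in>bas. sw (j * i * m) (\<lambda>x y. sw x (\<lambda>p q. (cf j (S (S y)) * cf i (S q)) *s p)))"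
  proof (rule sum.cong[OF HOL.refl])
    fix i
    have b: "bil (\<lambda>p q. cf i (S q) *s p)" by (simp add: lins2 cf_add cf_scale)
    have l: "lin (\<lambda>x. sw x (\<lambda>p q. cf i (S q) *s p))"
      using b by (intro linI) (simp_all add: sw_add sw_scale sw_scale_out lins2)
    show "sw (E (i * m)) (\<lambda>p q. cf i (S q) *s p) = 
       (\<Sum>j\<in>bas. sw (j * i * m) (\<lambda>x y. sw x (\<lambda>p q. (cf j (S (S y)) * cf i (S q)) *s p)))"
      unfolding E_def sum_lin[OF l] sw_sw_arg[OF b] linD(2)[OF l] sw_scale_out scale_scale mult.assoc[symmetric] ..
  qed
  also have "\<dots> = (\<Sum>k\<in>bas. sw (k * m) (\<lambda>x y. sw x (\<lambda>p q. cf k (S (S y) * S q) *s p)))"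
  proof (rule double_trace)
    fix \<phi> \<psi> :: "'h \<Rightarrow> 'k" assume "linf \<phi>" "linf \<psi>"
    note [simp] = linfD[OF \<open>linf \<phi>\<close>] linfD[OF \<open>linf \<psi>\<close>]
    show "lin (\<lambda>u. sw (u * m) (\<lambda>x y. sw x (\<lambda>p q. (\<psi> (S (S y)) * \<phi> (S q)) *s p)))"
      by (rule linI) (simp_all add: lins2 sws)
  qed
  also have "\<dots> = (\<Sum>k\<in>bas. sw (k * m) (\<lambda>p r. cf k (S (et r)) *s p))"
  proof -
    have "sw (k * m) (\<lambda>x y. sw x (\<lambda>p q. cf k (S (S y) * S q) *s p)) = sw (k * m) (\<lambda>p r. cf k (S (et r)) *s p)" for k
    proof -
      have "sw (k * m) (\<lambda>x y. sw x (\<lambda>p q. cf k (S (S y) * S q) *s p))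
        = sw (k * m) (\<lambda>p r. sw r (\<lambda>q y. cf k (S (S y) * S q) *s p))"
        by (rule coassoc_sw) (simp add: lins2 cf_add cf_scale)
      also have "\<dots> = sw (k * m) (\<lambda>p r. cf k (S (et r)) *s p)"
        by (simp only: antipode_right_sw[symmetric] S_mult[symmetric] sws linf_sw[OF cf_linf])
      finally show ?thesis .
    qed
    then show ?thesis by simp
  qed
  also have "\<dots> = (\<Sum>k\<in>bas. sw 1 (\<lambda>a b. cf k (S b) *s (a * (k * m))))"
    by (intro sum.cong HOL.refl sw_et_right) (simp add: lins2 cf_add cf_scale)
  also have "\<dots> = sw 1 (\<lambda>a b. \<Sum>k\<in>bas. cf k (S b) *s (a * (k * m)))" by (simp add: sw_sum)
  also have "\<dots> = sw 1 (\<lambda>a b. a * (S b * m))"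
    by (rule sw_cong, rule cf_expand_lin) (rule linI; simp add: lins)
  also have "\<dots> = et 1 * m" by (simp add: antipode_right_sw[symmetric] sw_mult_right mult.assoc)
  finally show ?thesis using one_in_Ht by (simp add: Ht_iff)
qed

text \<open>
  \<open>l\<^sub>1 \<otimes> h l\<^sub>2 = S(h) l\<^sub>1 \<otimes> l\<^sub>2\<close>, because \<open>S(h) l\<^sub>1 \<otimes> l\<^sub>2 = S(h\<^sub>1) (h\<^sub>2 l)\<^sub>1 \<otimes> (h\<^sub>2 l)\<^sub>2 = S(h\<^sub>1) h\<^sub>2 l\<^sub>1 \<otimes> h\<^sub>3 l\<^sub>2\<close>.
\<close>
lemma L_mult_right_leg:
  assumes l: "l \<in> L" and F: "bil F"
  shows "sw l (\<lambda>a b. F a (h * b)) = sw l (\<lambda>a b. F (S h * a) b)"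
proof -
  note [simp] = bilD[OF F]
  have "sw l (\<lambda>a b. F (S h * a) b) = sw h (\<lambda>h1 h2. sw (et h2 * l) (\<lambda>a b. F (S h1 * a) b))"
  proof -
    have "sw h (\<lambda>h1 h2. sw (et h2 * l) (\<lambda>a b. F (S h1 * a) b)) = sw h (\<lambda>h1 h2. sw l (\<lambda>a b. F (S h1 * (et h2 * a)) b))"
      by (rule sw_cong, rule sw_Ht_left) (simp_all add: lins2)
    also have "\<dots> = sw l (\<lambda>a b. F (S h * a) b)"
      by (subst sw_swap, rule sw_cong) (simp only: S_et[symmetric, of h] sw_mult_right bil_sw1[OF F] mult.assoc)
    finally show ?thesis ..
  qed
  also have "\<dots> = sw h (\<lambda>h1 h2. sw (h2 * l) (\<lambda>a b. F (S h1 * a) b))"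
    using l by (simp add: L_def)
  also have "\<dots> = sw h (\<lambda>h1 h2. sw h2 (\<lambda>p q. sw l (\<lambda>a b. F (S h1 * (p * a)) (q * b))))"
    by (rule sw_cong, rule mult_sw) (simp add: lins2)
  also have "\<dots> = sw h (\<lambda>c q. sw c (\<lambda>h1 p. sw l (\<lambda>a b. F (S h1 * (p * a)) (q * b))))"
    by (rule coassoc_sw[symmetric]) (simp add: lins2)
  also have "\<dots> = sw h (\<lambda>c q. sw l (\<lambda>a b. F (es c * a) (q * b)))"
    by (rule sw_cong, subst sw_swap, rule sw_cong)
      (simp only: antipode_left_sw[symmetric] sw_mult_right bil_sw1[OF F] mult.assoc)
  also have "\<dots> = sw 1 (\<lambda>c d. sw l (\<lambda>a b. F (c * a) (h * d * b)))"
    by (rule sw_es_left) (simp add: lins2)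
  also have "\<dots> = sw l (\<lambda>a b. F a (h * b))"
    by (subst (2) sw_one_mult(1)[symmetric]) (simp_all add: lins2)
  finally show ?thesis ..
qed

section \<open>Bijectivity of the antipode\<close>

lemma bil_linf_left: "linf \<phi> \<Longrightarrow> bil (\<lambda>a b. \<phi> a *s b)"
  by (simp add: balanced2_def linfD(1,2) scale_left_distrib scale_right_distrib mult.commute)
lemma bil_linf_right: "linf \<phi> \<Longrightarrow> bil (\<lambda>a b. \<phi> b *s a)"
  by (simp add: balanced2_def linfD(1,2) scale_left_distrib scale_right_distrib mult.commute)

lemma sw_1_in_Hs: assumes \<phi>: "linf \<phi>" shows "sw 1 (\<lambda>p q. \<phi> q *s p) \<in> Hs"
proof -
  have "sw 1 (\<lambda>p q. \<phi> q *s p) = sw 1 (\<lambda>p q. \<phi> q *s es p)"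
    by (rule sw_1_es[OF bil_linf_right[OF \<phi>], symmetric])
  also have "\<dots> \<in> Hs" by (rule sw_in_subspace[OF Hs_subspace]) (simp add: Hs_scale)
  finally show ?thesis .
qed

lemma sw_1_in_Ht: assumes \<phi>: "linf \<phi>" shows "sw 1 (\<lambda>p q. \<phi> p *s q) \<in> Ht"
proof -
  have "sw 1 (\<lambda>p q. \<phi> p *s q) = sw 1 (\<lambda>p q. \<phi> p *s et q)"
    by (rule sw_1_et[OF bil_linf_left[OF \<phi>], symmetric])
  also have "\<dots> \<in> Ht" by (rule sw_in_subspace[OF Ht_subspace]) (simp add: Ht_scale)
  finally show ?thesis .
qed

lemma sw_lin: assumes "bil F" "\<And>r a b. F (r *s a) b = r *s F a b" shows "lin (\<lambda>h. sw h F)"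
  by (rule linI) (simp_all add: sw_add sw_scale assms sw_scale_out)
lemma sw_linf: assumes "bil F" "\<And>r a b. F (r *s a) b = r * F a b" shows "linf (\<lambda>h. sw h F)"
  by (rule linfI) (simp_all add: sw_add sw_scale assms sw_mult_left)

lemma left_leg_expand:
  assumes "lin f" shows "f m = (\<Sum>i\<in>bas. sw (E (i * m)) (\<lambda>p q. cf i (S q) *s f p))"
  by (subst E_reconstruct[symmetric, of m]) (simp only: sum_lin[OF assms] lin_sw[OF assms] linD(2)[OF assms])

lemma L_faithful_Ht_left:
  assumes z: "z \<in> Ht" and 0: "\<And>l. l \<in> L \<Longrightarrow> z * l = 0" shows "z = 0"
proof -
  have "sw (E m) (\<lambda>p q. cf i (S q) *s (z * p)) = sw (z * E m) (\<lambda>p q. cf i (S q) *s p)" for m i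
    by (rule sw_Ht_left[symmetric]) (simp_all add: z lins2 cf_add cf_scale)
  then have "sw (E m) (\<lambda>p q. cf i (S q) *s (z * p)) = 0" for m i
    by (simp add: 0 E_in_L sw_0 lins2 cf_add cf_scale)
  then show ?thesis using left_leg_expand[OF lin_mult_left[of z], of 1] by simp
qed

lemma span_lin:
  assumes f: "lin f" and G: "\<And>g. g \<in> G \<Longrightarrow> f g \<in> Z" and Z: "subspace Z" and x: "x \<in> span G"
  shows "f x \<in> Z"
  using x
proof (induction rule: span_induct_alt)
  case base then show ?case by (simp add: linD[OF f] subspace_0[OF Z])
next
  case (step c x y) then show ?case by (simp add: linD[OF f] subspace_add[OF Z] subspace_scale[OF Z] G)
qed

definition slice :: "('h \<Rightarrow> 'k) \<Rightarrow> 'h \<Rightarrow> 'h" where "slice \<phi> l = sw l (\<lambda>a b. \<phi> a *s b)"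
text \<open>
  The right ideal generated by the right legs \<open>\<phi>(l\<^sub>1) l\<^sub>2\<close> of integrals. It is a left ideal by
  \<open>L_mult_right_leg\<close>, and the kernel of \<open>S\<close> annihilates it; hence \<open>S\<close> is injective once it contains \<open>1\<close>.
\<close>
definition leg_ideal :: "'h set" where "leg_ideal = span {slice \<phi> l * x | \<phi> l x. linf \<phi> \<and> l \<in> L}"

lemma slice_lin: "linf \<phi> \<Longrightarrow> lin (slice \<phi>)"
  unfolding slice_def by (rule sw_lin) (simp_all add: bil_linf_left linfD(2))

lemma leg_ideal_subspace: "subspace leg_ideal" by (simp add: leg_ideal_def subspace_span)
lemma leg_ideal_base: "linf \<phi> \<Longrightarrow> l \<in> L \<Longrightarrow> slice \<phi> l * x \<in> leg_ideal"
  unfolding leg_ideal_def by (rule span_base) blast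

lemma slice_mult_left: "linf \<phi> \<Longrightarrow> l \<in> L \<Longrightarrow> h * slice \<phi> l = slice (\<lambda>a. \<phi> (S h * a)) l"
proof -
  assume \<phi>: "linf \<phi>" and l: "l \<in> L"
  have "h * slice \<phi> l = sw l (\<lambda>a b. \<phi> a *s (h * b))" by (simp add: slice_def sw_mult_left scale_mult_right)
  also have "\<dots> = sw l (\<lambda>a b. \<phi> (S h * a) *s b)" by (rule L_mult_right_leg[OF l bil_linf_left[OF \<phi>]])
  finally show ?thesis by (simp add: slice_def)
qed

lemma leg_ideal_left: assumes x: "x \<in> leg_ideal" shows "h * x \<in> leg_ideal"
proof (rule span_lin[OF lin_mult_left _ leg_ideal_subspace x[unfolded leg_ideal_def]])
  fix g assume "g \<in> {slice \<phi> l * x | \<phi> l x. linf \<phi> \<and> l \<in> L}"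
  then show "h * g \<in> leg_ideal"
    by (auto simp: mult.assoc[symmetric] slice_mult_left intro!: leg_ideal_base linf_comp[OF _ lin_mult_left])
qed

lemma leg_ideal_right: assumes x: "x \<in> leg_ideal" shows "x * h \<in> leg_ideal"
proof (rule span_lin[OF lin_mult_right _ leg_ideal_subspace x[unfolded leg_ideal_def]])
  fix g assume "g \<in> {slice \<phi> l * x | \<phi> l x. linf \<phi> \<and> l \<in> L}"
  then show "g * h \<in> leg_ideal" by (auto simp: mult.assoc intro!: leg_ideal_base)
qed

lemma L_leg_ideal: "l \<in> L \<Longrightarrow> l \<in> leg_ideal"
  using leg_ideal_base[OF counit_linear, of l 1] by (simp add: slice_def counit_left_sw)

text \<open>
  The leg ideal is a left coideal: by coassociativity a right leg of a right leg of \<open>l\<close> is again a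
  right leg of \<open>l\<close>, and right multiples cause no difficulty because \<open>\<Delta>\<close> is multiplicative.
\<close>
lemma leg_ideal_slice: assumes \<psi>: "linf \<psi>" and x: "x \<in> leg_ideal" shows "slice \<psi> x \<in> leg_ideal"
proof (rule span_lin[OF slice_lin[OF \<psi>] _ leg_ideal_subspace x[unfolded leg_ideal_def]])
  fix g assume "g \<in> {slice \<phi> l * x | \<phi> l x. linf \<phi> \<and> l \<in> L}"
  then obtain \<phi> l x where g: "g = slice \<phi> l * x" and \<phi>: "linf \<phi>" and l: "l \<in> L" by auto
  note [simp] = linfD[OF \<phi>] linfD[OF \<psi>]
  have "slice \<psi> g = sw l (\<lambda>a b. \<phi> a *s slice \<psi> (b * x))"
    by (simp add: g slice_def[of \<phi>] sw_mult_right lin_sw[OF slice_lin[OF \<psi>]] scale_mult_left linD(2)[OF slice_lin[OF \<psi>]])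
  also have "\<dots> = sw l (\<lambda>a b. sw b (\<lambda>b1 b2. sw x (\<lambda>x1 x2. (\<phi> a * \<psi> (b1 * x1)) *s (b2 * x2))))"
    unfolding slice_def by (rule sw_cong, subst mult_sw) (simp_all add: lins2 sws)
  also have "\<dots> = sw l (\<lambda>c b2. sw c (\<lambda>a b1. sw x (\<lambda>x1 x2. (\<phi> a * \<psi> (b1 * x1)) *s (b2 * x2))))"
    by (rule coassoc_sw[symmetric]) (simp add: lins2)
  also have "\<dots> = sw l (\<lambda>c b2. sw x (\<lambda>x1 x2. sw c (\<lambda>a b1. \<phi> a * \<psi> (b1 * x1)) *s (b2 * x2)))"
    by (rule sw_cong, subst sw_swap) (simp add: sw_scale_left)
  also have "\<dots> = sw x (\<lambda>x1 x2. slice (\<lambda>c. sw c (\<lambda>a b1. \<phi> a * \<psi> (b1 * x1))) l * x2)"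
    by (subst sw_swap, rule sw_cong) (simp add: slice_def sw_mult_right scale_mult_left)
  also have "\<dots> \<in> leg_ideal"
    by (rule sw_in_subspace[OF leg_ideal_subspace], rule leg_ideal_base[OF _ l], rule sw_linf) (simp_all add: lins2)
  finally show "slice \<psi> g \<in> leg_ideal" .
qed

text \<open>
  A consequence of the coideal property: in \<open>\<Delta>(x)\<close> with \<open>x\<close> in the leg ideal, the second leg may be
  assumed to lie in the leg ideal.
\<close>
lemma leg_ideal_leg:
  assumes F: "\<And>b. lin (\<lambda>a. F a b)" and x: "x \<in> leg_ideal" and Z: "subspace Z"
    and Fk: "\<And>k v. v \<in> leg_ideal \<Longrightarrow> F k v \<in> Z" and F2: "\<And>a. lin (\<lambda>b. F a b)"
  shows "sw x F \<in> Z"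
proof -
  have "sw x F = sw x (\<lambda>a b. \<Sum>k\<in>bas. cf k a *s F k b)"
    by (rule sw_cong) (rule cf_expand_lin[OF F, symmetric])
  also have "\<dots> = (\<Sum>k\<in>bas. F k (slice (cf k) x))"
    unfolding sw_sum slice_def lin_sw[OF F2] linD(2)[OF F2] ..
  also have "\<dots> \<in> Z" by (intro subspace_sum[OF Z] Fk leg_ideal_slice[OF cf_linf] x)
  finally show ?thesis .
qed

lemma lin_S_mult: "lin (\<lambda>a. S a * b)" by (rule linI) (simp_all add: lins)

text \<open>
  The intersection of the leg ideal with \<open>Hs\<close> is generated by a central idempotent \<open>e\<close> of \<open>Hs\<close>, and this \<open>e\<close>
  is a right unit of the whole leg ideal. It turns out to be central in \<open>H\<close>; then \<open>S(1 - e)\<close> kills all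
  integrals, which is only possible for \<open>e = 1\<close>.
\<close>
lemma one_in_leg_ideal: "1 \<in> leg_ideal"
proof -
  have es_leg_ideal: "es x \<in> leg_ideal" if "x \<in> leg_ideal" for x
    unfolding antipode_left_sw[symmetric, of x]
    by (rule leg_ideal_leg[OF _ that leg_ideal_subspace leg_ideal_left]) (simp_all add: lin_mult_left lin_S_mult)
  let ?J = "leg_ideal \<inter> Hs"
  have "subspace ?J" "?J \<subseteq> Hs" using subspace_inter[OF leg_ideal_subspace Hs_subspace] by auto
  then obtain e where e: "e \<in> ?J" "\<And>x. x \<in> ?J \<Longrightarrow> x * e = x" "S (S e) = e"
    by (rule Hs_ideal) (auto intro: leg_ideal_left leg_ideal_right Hs_mult)
  have eHs: "e \<in> Hs" using e by simp
  (* x = x1 es(x2), where x2 may be taken in the leg ideal, so es(x2) lies in J and absorbs e. *)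
  have xe: "x * e = x" if x: "x \<in> leg_ideal" for x
  proof -
    have "sw x (\<lambda>a b. a * es b) = x" (is "?l = _")
    proof -
      have "?l = sw 1 (\<lambda>a b. x * a * S b)" by (rule sw_es_right) (simp add: lins2)
      also have "\<dots> = x * et 1" by (simp add: antipode_right_sw[symmetric] sw_mult_left mult.assoc)
      finally show ?thesis using one_in_Ht by (simp add: Ht_iff)
    qed
    moreover have "sw x (\<lambda>a b. a * (es b - es b * e)) \<in> {0}"
    proof (rule leg_ideal_leg[OF _ x])
      show "subspace {0::'h}" by simp
      show "k * (es v - es v * e) \<in> {0}" if "v \<in> leg_ideal" for k v using e(2)[of "es v"] es_leg_ideal[OF that] by simp
    qed (rule linI; simp add: lins2 right_diff_distrib left_diff_distrib algebra_simps scale_right_diff_distrib)+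
    moreover have "sw x (\<lambda>a b. a * (es b - es b * e)) = sw x (\<lambda>a b. a * es b) - sw x (\<lambda>a b. a * es b) * e"
      by (simp add: right_diff_distrib sw_minus sw_mult_right mult.assoc)
    ultimately show ?thesis by simp
  qed
  (* e h lies in the leg ideal; together with the corner lemma this makes e central in H. *)
  have ehe: "e * h * e = e * h" for h using xe[OF leg_ideal_right] e by auto
  have \<epsilon>e: "\<epsilon> (e * h * e) = \<epsilon> (h * e)" for h
    by (rule \<epsilon>_corner[OF eHs e(3)]) (simp add: ehe)
  have comm: "e * h = h * e" for h
  proof -
    have "e * h = sw h (\<lambda>a b. \<epsilon> (e * b) *s a)" by (simp add: sw_eps eHs)
    also have "\<dots> = sw h (\<lambda>a b. \<epsilon> (b * e) *s a)" by (simp only: \<epsilon>e[symmetric] ehe)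
    finally show ?thesis by (simp add: sw_eps eHs)
  qed
  have "S (1 - e) = 0"
  proof (rule L_faithful_Ht_left)
    have 1: "1 - e \<in> Hs" using eHs by (simp add: subspace_diff Hs_subspace)
    then show "S (1 - e) \<in> Ht" by simp
    fix l assume l: "l \<in> L"
    have "S (1 - e) * l = (1 - e) * l" using l 1 by (simp add: S_Hs L_def)
    also have "\<dots> = l - l * e" by (simp add: left_diff_distrib comm)
    finally show "S (1 - e) * l = 0" using xe[OF L_leg_ideal[OF l]] by simp
  qed
  then have "S (S (1 - e)) = 0" by simp
  then have "1 - e = 0" by (simp add: S_diff e(3))
  then show ?thesis using e by simp
qed

lemma S_inj0: assumes "S k = 0" shows "k = 0"
proof -
  have "k * x \<in> {0}" if "x \<in> leg_ideal" for x
  proof (rule span_lin[OF lin_mult_left _ _ that[unfolded leg_ideal_def]])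
    fix g assume "g \<in> {slice \<phi> l * x | \<phi> l x. linf \<phi> \<and> l \<in> L}"
    then show "k * g \<in> {0}"
      using assms by (auto simp: mult.assoc[symmetric] slice_mult_left) (simp add: slice_def linfD(3))
  qed simp
  from this[OF one_in_leg_ideal] show ?thesis by simp
qed

lemma S_lin: "lin S" by (rule antipode_linear)

lemma S_inj: "inj S" using S_inj0 by (auto simp: inj_def) (metis S_diff right_minus_eq)
lemma S_bij: "bij S" using linear_inj_imp_surj[OF S_lin S_inj] S_inj by (simp add: bij_def)

section \<open>Base-linear endomorphisms of the integrals\<close>

definition Si :: "'h \<Rightarrow> 'h" where "Si = inv S"
lemma S_Si[simp]: "S (Si x) = x" using S_bij by (simp add: Si_def bij_is_surj surj_f_inv_f)
lemma Si_S[simp]: "Si (S x) = x" using S_bij by (simp add: Si_def bij_is_inj)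
lemma S_eq_iff: "S x = S y \<longleftrightarrow> x = y" using S_inj by (simp add: inj_eq)
lemma Si_eqI: "S x = y \<Longrightarrow> Si y = x" by auto
lemma Si_add: "Si (x + y) = Si x + Si y" by (rule Si_eqI) (simp add: S_add)
lemma Si_scale: "Si (r *s x) = r *s Si x" by (rule Si_eqI) (simp add: S_scale)
lemma Si_mult: "Si (x * y) = Si y * Si x" by (rule Si_eqI) (simp add: S_mult)
lemma Si_1[simp]: "Si 1 = 1" by (rule Si_eqI) simp
lemma Si_lin: "lin Si" by (rule linI) (rule Si_add Si_scale)+
lemma Si_Hs[simp]: "y \<in> Hs \<Longrightarrow> Si y \<in> Ht" by (metis Hs_S_image Si_S)
lemma Si_Ht[simp]: "z \<in> Ht \<Longrightarrow> Si z \<in> Hs" by (metis Ht_S_image Si_S)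
lemma sw_Si: assumes F: "bil F" shows "sw (Si h) F = sw h (\<lambda>a b. F (Si b) (Si a))"
  using sw_S[of "\<lambda>a b. F (Si b) (Si a)" "Si h"] bilD[OF F] by (simp add: balanced2_def Si_add Si_scale)

lemmas lins3 = lins2 Si_add Si_scale cf_add cf_scale

lemma S_in_Ht: "S y \<in> Ht \<longleftrightarrow> y \<in> Hs" by (metis S_Hs_in Si_Ht Si_S)

lemma L_mult_left_leg:
  assumes l: "l \<in> L" and F: "bil F"
  shows "sw l (\<lambda>a b. F (h * a) b) = sw l (\<lambda>a b. F a (Si h * b))"
  using L_mult_right_leg[OF l F, of "Si h"] by simp

lemma bil_expand_right:
  assumes F: "bil F" shows "F a b = (\<Sum>k\<in>bas. F (cf k b *s a) k)"
proof -
  have hom: "F a (\<Sum>k\<in>A. g k) = (\<Sum>k\<in>A. F a (g k))" for A and g :: "'h \<Rightarrow> 'h"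
  proof (induction A rule: infinite_finite_induct)
    case (infinite A) then show ?case using bilD(2)[OF F, of a 0 0] by simp
  next
    case empty then show ?case using bilD(2)[OF F, of a 0 0] by simp
  qed (simp add: bilD(2)[OF F])
  have "F a b = F a (\<Sum>k\<in>bas. cf k b *s k)" by (simp add: cf_expand)
  then show ?thesis by (simp add: hom bilD(3)[OF F])
qed

lemma lin_sum: "(\<And>i. lin (f i)) \<Longrightarrow> lin (\<lambda>x. \<Sum>i\<in>A. f i x)"
proof (rule linI)
  assume l: "\<And>i. lin (f i)"
  show "(\<Sum>i\<in>A. f i (x + y)) = (\<Sum>i\<in>A. f i x) + (\<Sum>i\<in>A. f i y)" for x y
    by (simp add: linD(1)[OF l] sum.distrib)
  show "(\<Sum>i\<in>A. f i (r *s x)) = r *s (\<Sum>i\<in>A. f i x)" for r x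
    by (simp add: linD(2)[OF l] scale_sum_right)
qed

lemma bil_sum_left: "bil F \<Longrightarrow> F (\<Sum>k\<in>A. g k) b = (\<Sum>k\<in>A. F (g k) b)"
proof (induction A rule: infinite_finite_induct)
  case (infinite A) then show ?case by (simp add: balanced2_zero)
next
  case empty then show ?case by (simp add: balanced2_zero)
qed (simp add: bilD(1))

text \<open>
  Left legs \<open>l\<^sub>1 \<psi>(l\<^sub>2)\<close>, as opposed to the right legs \<open>slice\<close>.
\<close>
definition rslice :: "('h \<Rightarrow> 'k) \<Rightarrow> 'h \<Rightarrow> 'h" where "rslice \<psi> l = sw l (\<lambda>a b. \<psi> b *s a)"

lemma rslice_lin: "linf \<phi> \<Longrightarrow> lin (rslice \<phi>)"
  unfolding rslice_def by (rule sw_lin) (simp_all add: bil_linf_right scale_mult_right mult.commute)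

text \<open>
  Expand the second leg in the basis: a tensor is determined by its contractions with functionals.
\<close>
lemma sw_rslice_determined:
  assumes G: "lin G" and eq: "\<And>\<psi>. linf \<psi> \<Longrightarrow> rslice \<psi> x = sw l (\<lambda>a b. \<psi> b *s G a)" and F: "bil F"
  shows "sw x F = sw l (\<lambda>a b. F (G a) b)"
proof -
  have "sw x F = (\<Sum>k\<in>bas. F (rslice (cf k) x) k)"
    unfolding rslice_def bil_sw1[OF F] sw_sum[symmetric] by (rule sw_cong) (rule bil_expand_right[OF F])
  also have "\<dots> = sw l (\<lambda>a b. F (G a) b)"
    unfolding eq[OF cf_linf] bil_sw1[OF F] sw_sum[symmetric]
    by (rule sw_cong) (rule bil_expand_right[OF F, symmetric])
  finally show ?thesis .
qed

text \<open>
  \<open>E(h l\<^sub>1) \<otimes> l\<^sub>2 = l 1\<^sub>1 \<otimes> S\<^sup>-\<^sup>1(h) S(1\<^sub>2)\<close>. In \<open>E(l\<^sub>1) \<otimes> l\<^sub>2\<close> the basis vector of the trace can be moved to the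
  second leg, where the trace becomes an ordinary basis expansion.
\<close>
lemma E_left_leg:
  assumes l: "l \<in> L" and F: "bil F"
  shows "sw l (\<lambda>a b. F (E (h * a)) b) = sw 1 (\<lambda>a b. F (l * a) (Si h * S b))"
proof -
  note [simp] = bilD[OF F]
  have 1: "sw l (\<lambda>a b. G (E a) b) = sw 1 (\<lambda>a b. G (l * a) (S b))" if G: "bil G" for G :: "'h \<Rightarrow> 'h \<Rightarrow> 'a"
  proof -
    note [simp] = bilD[OF G]
    have "sw l (\<lambda>a b. G (E a) b) = (\<Sum>j\<in>bas. sw l (\<lambda>a b. sw (j * a) (\<lambda>x y. G (cf j (S (S y)) *s x) b)))"
      unfolding E_def sw_sum[symmetric] by (rule sw_cong) (simp only: bil_sum_left[OF G] bil_sw1[OF G])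
    also have "\<dots> = (\<Sum>j\<in>bas. sw l (\<lambda>a b. sw a (\<lambda>x y. G (cf j (S (S y)) *s x) (Si j * b))))"
      by (rule sum.cong[OF HOL.refl], rule L_mult_left_leg[OF l]) (simp add: lins3)
    also have "\<dots> = sw l (\<lambda>a b. sw a (\<lambda>x y. \<Sum>j\<in>bas. G (cf j (S (S y)) *s x) (Si j * b)))"
      by (simp only: sw_sum)
    also have "\<dots> = sw l (\<lambda>a b. sw a (\<lambda>x y. G x (S y * b)))"
    proof (rule sw_cong, rule sw_cong)
      fix a b x y
      have "bil (\<lambda>p q. G p (Si q * b))" by (simp add: lins3)
      from bil_expand_right[OF this, of x "S (S y)"]
      show "(\<Sum>j\<in>bas. G (cf j (S (S y)) *s x) (Si j * b)) = G x (S y * b)" by simp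
    qed
    also have "\<dots> = sw l (\<lambda>x c. sw c (\<lambda>y b. G x (S y * b)))"
      by (rule coassoc_sw) (simp add: lins3)
    also have "\<dots> = sw l (\<lambda>x c. G x (es c))"
      by (rule sw_cong) (simp only: antipode_left_sw[symmetric] bil_sw2[OF G])
    also have "\<dots> = sw 1 (\<lambda>a b. G (l * a) (S b))" by (rule sw_es_right[OF G])
    finally show ?thesis .
  qed
  have "sw l (\<lambda>a b. F (E (h * a)) b) = sw l (\<lambda>a b. F (E a) (Si h * b))"
    by (rule L_mult_left_leg[OF l]) (simp add: lins3 linD[OF E_lin])
  also have "\<dots> = sw 1 (\<lambda>a b. F (l * a) (Si h * S b))"
    by (rule 1) (simp add: lins3)
  finally show ?thesis .
qed

text \<open>
  The idea is to extend \<open>T\<close> from integrals to their left legs by \<open>\<Phi>(l\<^sub>1 \<psi>(l\<^sub>2)) = T(l)\<^sub>1 \<psi>(T(l)\<^sub>2)\<close>. The trace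
  formula provides a well-defined \<open>\<Phi>\<close>. It is left \<open>H\<close>-linear, hence right multiplication by \<open>c = \<Phi>(1)\<close>, and
  \<open>\<Delta>(T l) = l\<^sub>1 c \<otimes> l\<^sub>2\<close> yields both \<open>T l = l c\<close> and \<open>c \<in> Ht\<close>.
\<close>
lemma L_endomorphism:
  assumes T: "lin T" and TL: "\<And>l. l \<in> L \<Longrightarrow> T l \<in> L" and TH: "\<And>l y. l \<in> L \<Longrightarrow> y \<in> Hs \<Longrightarrow> T (l * y) = T l * y"
  obtains c where "c \<in> Ht" "\<And>l. l \<in> L \<Longrightarrow> T l = l * c"
proof -
  (* Apply T inside the reconstruction formula for m. *)
  define \<Phi> where "\<Phi> m = (\<Sum>i\<in>bas. sw (T (E (i * m))) (\<lambda>p q. cf i (S q) *s p))" for m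
  have \<Phi>_lin: "lin \<Phi>"
  proof -
    have "lin (\<lambda>m. sw (T (E (i * m))) (\<lambda>p q. cf i (S q) *s p))" for i
      by (rule lin_comp[OF sw_lin lin_comp[OF T lin_comp[OF E_lin lin_mult_left]]]) (simp_all add: lins3)
    then show ?thesis unfolding \<Phi>_def by (rule lin_sum)
  qed
  have \<Phi>_slice: "\<Phi> (rslice \<psi> l) = rslice \<psi> (T l)" if l: "l \<in> L" and \<psi>: "linf \<psi>" for \<psi> l
  proof -
    note [simp] = linfD[OF \<psi>] linD[OF T] linD[OF E_lin]
    have "sw (T (E (i * rslice \<psi> l))) (\<lambda>p q. cf i (S q) *s p)
        = sw 1 (\<lambda>a b. sw (T l) (\<lambda>p q. (cf i (S (q * a)) * \<psi> (Si i * S b)) *s p))" for i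
    proof -
      have b: "bil (\<lambda>p q. cf i (S q) *s p)" by (simp add: lins3)
      have "sw (T (E (i * rslice \<psi> l))) (\<lambda>p q. cf i (S q) *s p)
          = sw l (\<lambda>a b. \<psi> b *s sw (T (E (i * a))) (\<lambda>p q. cf i (S q) *s p))"
        unfolding rslice_def sw_mult_left scale_mult_right lin_sw[OF E_lin] lin_sw[OF T] sw_sw_arg[OF b]
        by (simp add: linD sw_scale[OF b] sw_scale_out lins3)
      also have "\<dots> = sw 1 (\<lambda>a b. \<psi> (Si i * S b) *s sw (T (l * a)) (\<lambda>p q. cf i (S q) *s p))"
        by (rule E_left_leg[OF l]) (simp add: lins3 sws)
      also have "\<dots> = sw 1 (\<lambda>a b. \<psi> (Si i * S b) *s sw (T (l * es a)) (\<lambda>p q. cf i (S q) *s p))"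
        by (rule sw_1_es[symmetric]) (simp add: lins3 sws)
      also have "\<dots> = sw 1 (\<lambda>a b. \<psi> (Si i * S b) *s sw (T l) (\<lambda>p q. cf i (S (q * es a)) *s p))"
        by (simp add: TH l sw_Hs_right[OF b])
      also have "\<dots> = sw 1 (\<lambda>a b. \<psi> (Si i * S b) *s sw (T l) (\<lambda>p q. cf i (S (q * a)) *s p))"
        by (rule sw_1_es) (simp add: lins3 sws)
      finally show ?thesis by (simp add: sw_scale_out mult.commute)
    qed
    then have "\<Phi> (rslice \<psi> l) = sw 1 (\<lambda>a b. sw (T l) (\<lambda>p q. (\<Sum>i\<in>bas. cf i (S (q * a)) * \<psi> (Si i * S b)) *s p))"
      by (simp add: \<Phi>_def sw_sum[symmetric] scale_sum_left)
    also have "\<dots> = sw 1 (\<lambda>a b. sw (T l) (\<lambda>p q. \<psi> (q * (a * S b)) *s p))"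
    proof (intro sw_cong)
      fix a b p q
      have "linf (\<lambda>i. \<psi> (Si i * S b))" by (rule linfI) (simp_all add: lins3)
      from cf_expand_linf[OF this, of "S (q * a)"]
      show "(\<Sum>i\<in>bas. cf i (S (q * a)) * \<psi> (Si i * S b)) *s p = \<psi> (q * (a * S b)) *s p" by (simp add: mult.assoc)
    qed
    also have "\<dots> = sw (T l) (\<lambda>p q. \<psi> (q * et 1) *s p)"
      by (subst sw_swap) (simp only: antipode_right_sw[symmetric] sw_mult_left linf_sw[OF \<psi>] sw_scale_left)
    finally show ?thesis using one_in_Ht by (simp add: Ht_iff rslice_def)
  qed
  have linfS: "linf (\<lambda>x. cf i (S x))" for i by (rule linf_comp[OF cf_linf S_lin])
  have expand: "x = (\<Sum>i\<in>bas. rslice (\<lambda>q. cf i (S q)) (E (i * x)))" for x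
    using E_reconstruct[of x] by (simp add: rslice_def)
  have mult_rslice: "h * rslice \<psi> l = rslice (\<lambda>b. \<psi> (Si h * b)) l" if "l \<in> L" "linf \<psi>" for h \<psi> l
    unfolding rslice_def sw_mult_left scale_mult_right
    by (rule L_mult_left_leg[OF that(1) bil_linf_right[OF that(2)]])
  have \<Phi>_mult: "\<Phi> (h * x) = h * \<Phi> x" for h x
  proof -
    have "\<Phi> (h * rslice \<psi> l) = h * \<Phi> (rslice \<psi> l)" if "l \<in> L" "linf \<psi>" for \<psi> l
      using that by (simp add: mult_rslice \<Phi>_slice TL linf_comp[OF _ lin_mult_left])
    then show ?thesis
      by (subst (1 2) expand) (simp only: sum_distrib_left sum_lin[OF \<Phi>_lin] E_in_L linfS)
  qed
  define c where "c = \<Phi> 1"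
  have \<Phi>c: "\<Phi> x = x * c" for x using \<Phi>_mult[of x 1] by (simp add: c_def)
  have Tslice: "rslice \<psi> (T l) = sw l (\<lambda>a b. \<psi> b *s (a * c))" if "l \<in> L" "linf \<psi>" for \<psi> l
    using \<Phi>_slice[OF that] unfolding \<Phi>c by (simp add: rslice_def sw_mult_right scale_mult_left)
  have swT: "sw (T l) F = sw l (\<lambda>a b. F (a * c) b)" if "l \<in> L" "bil F" for l and F :: "'h \<Rightarrow> 'h \<Rightarrow> 'h"
    by (rule sw_rslice_determined[OF lin_mult_right Tslice[OF that(1)] that(2)])
  (* The same relation for all elements x, since they are sums of left legs of integrals. *)
  have swc: "sw (x * c) F = sw x (\<lambda>a b. F (a * c) b)" if F: "bil F" for x and F :: "'h \<Rightarrow> 'h \<Rightarrow> 'h"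
  proof -
    note [simp] = bilD[OF F]
    have *: "sw (rslice \<psi> l * c) F = sw (rslice \<psi> l) (\<lambda>a b. F (a * c) b)" if l: "l \<in> L" and \<psi>: "linf \<psi>" for \<psi> l
    proof -
      note [simp] = linfD[OF \<psi>]
      have b: "bil (\<lambda>a b. F (a * c) b)" by (simp add: lins3)
      have "sw (rslice \<psi> l * c) F = sw (T l) (\<lambda>a b. sw a (\<lambda>p q. F (\<psi> b *s p) q))"
        using \<Phi>_slice[OF l \<psi>] unfolding \<Phi>c by (simp add: rslice_def sw_sw_arg[OF F] sw_scale[OF F])
      also have "\<dots> = sw (T l) (\<lambda>p d. sw d (\<lambda>q b. F (\<psi> b *s p) q))"
        by (rule coassoc_sw) (simp add: lins3)
      also have "\<dots> = sw l (\<lambda>p d. sw d (\<lambda>q b. F (\<psi> b *s (p * c)) q))"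
        by (rule swT[OF l]) (simp add: lins3)
      also have "\<dots> = sw l (\<lambda>a b. sw a (\<lambda>p q. F (\<psi> b *s (p * c)) q))"
        by (rule coassoc_sw[symmetric]) (simp add: lins3)
      also have "\<dots> = sw (rslice \<psi> l) (\<lambda>a b. F (a * c) b)"
        unfolding rslice_def sw_sw_arg[OF b] sw_scale[OF b] by (simp only: scale_mult_left)
      finally show ?thesis .
    qed
    have hom: "sw (\<Sum>i\<in>A. g i) G = (\<Sum>i\<in>A. sw (g i) G)" if G: "bil G" for A and g :: "'h \<Rightarrow> 'h" and G :: "'h \<Rightarrow> 'h \<Rightarrow> 'h"
      by (induction A rule: infinite_finite_induct) (simp_all add: sw_0[OF G] sw_add[OF G])
    have b: "bil (\<lambda>a b. F (a * c) b)" by (simp add: lins3)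
    show ?thesis
      by (subst (1 2) expand[of x]) (simp only: sum_distrib_right hom[OF F] hom[OF b] * E_in_L linfS)
  qed
  have "c = et c"
  proof -
    have b: "bil (\<lambda>a b. \<epsilon> a *s b)" by (simp add: lins)
    show ?thesis using swc[OF b, of 1] by (simp add: counit_left_sw et_def)
  qed
  moreover have "T l = l * c" if "l \<in> L" for l
    using swT[OF that, of "\<lambda>a b. \<epsilon> b *s a"] counit_right_sw[of "T l"] counit_right_sw[of l]
    by (simp add: lins sw_mult_right[of l "\<lambda>a b. \<epsilon> b *s a", symmetric] scale_mult_left[symmetric] del: scale_mult_left)
  ultimately show thesis using that by (metis et_in)
qed

section \<open>A nondegenerate integral from a Frobenius form\<close>

lemma left_inverse_imp: fixes x c :: 'h assumes "x * c = 1" shows "c * x = 1"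
proof -
  have "inj (\<lambda>y. y * x)"
    by (rule injI) (metis assms mult.assoc mult_1_right)
  then have "surj (\<lambda>y. y * x)" by (rule linear_inj_imp_surj[OF lin_mult_right])
  then obtain y where "y * x = 1" by (metis surjD)
  then have "y = c" by (metis assms mult.assoc mult_1_left mult_1_right)
  with \<open>y * x = 1\<close> show ?thesis by simp
qed

lemma dim_image_inj:
  assumes g: "lin g" and V: "subspace V" and inj: "\<And>x. x \<in> V \<Longrightarrow> g x = 0 \<Longrightarrow> x = 0"
  shows "dim (g ` V) = dim V" "subspace (g ` V)"
proof -
  interpret pp: finite_dimensional_vector_space_pair scale bas scale bas by unfold_locales
  have "inj_on g V"
  proof (rule inj_onI)
    fix x y assume "x \<in> V" "y \<in> V" "g x = g y"
    then show "x = y" using inj[OF subspace_diff[OF V], of x y] by (simp add: linD(4)[OF g])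
  qed
  then show "dim (g ` V) = dim V"
    using pp.dim_image_eq[OF g, of V, unfolded span_eq_iff[THEN iffD2, OF V]] by simp
  show "subspace (g ` V)" by (rule pp.linear_subspace_image[OF g V])
qed

lemma lin_inj_on_image_eq:
  assumes g: "lin g" and V: "subspace V" and gV: "g ` V \<subseteq> V" and inj: "\<And>x. x \<in> V \<Longrightarrow> g x = 0 \<Longrightarrow> x = 0"
  shows "g ` V = V"
  by (rule subspace_dim_equal[OF dim_image_inj(2)[OF g V inj] V gV]) (simp_all add: dim_image_inj(1)[OF g V inj])

lemma dim_direct_sum:
  assumes U: "subspace U" and W: "subspace W" and 0: "U \<inter> W \<subseteq> {0}" and V: "V = {x + y | x y. x \<in> U \<and> y \<in> W}"
  shows "dim V = dim U + dim W"
proof -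
  have "U \<inter> W = {0}" using 0 subspace_0[OF U] subspace_0[OF W] by auto
  then show ?thesis using dim_sums_Int[OF U W] V by simp
qed

text \<open>
  A Frobenius form on \<open>H\<close>.
\<close>
definition nondeg :: "('h \<Rightarrow> 'k) \<Rightarrow> bool" where
  "nondeg \<theta> \<longleftrightarrow> linf \<theta> \<and> (\<forall>a. (\<forall>b. \<theta> (a * b) = 0) \<longrightarrow> a = 0) \<and> (\<forall>b. (\<forall>a. \<theta> (a * b) = 0) \<longrightarrow> b = 0)"

lemma linf_eq_on_bas:
  assumes "linf f" "linf g" "\<And>b. b \<in> bas \<Longrightarrow> f b = g b" shows "f x = g x"
  using cf_expand_linf[OF assms(1), of x] cf_expand_linf[OF assms(2), of x] assms(3) by simp

text \<open>
  By finite dimension, a pairing without kernel on one side represents every functional.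
\<close>
lemma nondegenerate_pairing_represents:
  assumes l1: "\<And>b. linf (\<lambda>w. B w b)" and l2: "\<And>w. linf (B w)" and inj: "\<And>w. (\<And>b. B w b = 0) \<Longrightarrow> w = 0"
    and f: "linf f"
  shows "\<exists>w. \<forall>x. f x = B w x"
proof -
  define g where "g w = (\<Sum>b\<in>bas. B w b *s b)" for w
  have coeff: "(\<Sum>b\<in>bas. r b *s b) = (\<Sum>b\<in>bas. s b *s b) \<Longrightarrow> b \<in> bas \<Longrightarrow> r b = s b" for r s b
  proof -
    assume "(\<Sum>b\<in>bas. r b *s b) = (\<Sum>b\<in>bas. s b *s b)" and b: "b \<in> bas"
    then have "(\<Sum>b\<in>bas. (r b - s b) *s b) = 0" by (simp add: scale_left_diff_distrib sum_subtractf)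
    then show "r b = s b" using bas(1,2) b independentD[of bas bas "\<lambda>b. r b - s b" b] by simp
  qed
  have g: "lin g"
    unfolding g_def by (rule lin_sum, rule linI) (simp_all add: linfD[OF l1] scale_left_distrib)
  have "inj g"
  proof (rule injI)
    fix v w assume "g v = g w"
    then have "g (v - w) = (\<Sum>b\<in>bas. 0 *s b)" by (simp add: linD(4)[OF g])
    then have "B (v - w) b = 0" if "b \<in> bas" for b using coeff[OF _ that, of "B (v - w)" "\<lambda>_. 0"] by (simp add: g_def)
    then have "B (v - w) x = 0" for x using linf_eq_on_bas[OF l2 linf_zero, of "v - w" x] by simp
    then show "v = w" using inj by (metis right_minus_eq)
  qed
  then have "surj g" by (rule linear_inj_imp_surj[OF g])
  then obtain w where "g w = (\<Sum>b\<in>bas. f b *s b)" by (metis surjD)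
  then have "B w b = f b" if "b \<in> bas" for b using coeff[OF _ that] by (simp add: g_def)
  then show ?thesis using linf_eq_on_bas[OF l2 f] by metis
qed

lemma nondeg_left:
  assumes \<theta>: "nondeg \<theta>" and f: "linf f" shows "\<exists>w. \<forall>x. f x = \<theta> (w * x)"
  using \<theta> unfolding nondeg_def
  by (intro nondegenerate_pairing_represents[of "\<lambda>w x. \<theta> (w * x)"] f) (auto intro: linf_comp lin_mult_left lin_mult_right)

lemma nondeg_right:
  assumes \<theta>: "nondeg \<theta>" and f: "linf f" shows "\<exists>w. \<forall>x. f x = \<theta> (x * w)"
  using \<theta> unfolding nondeg_def
  by (intro nondegenerate_pairing_represents[of "\<lambda>w x. \<theta> (x * w)"] f) (auto intro: linf_comp lin_mult_left lin_mult_right)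

text \<open>
  Left legs of integrals span \<open>H\<close>, and multiplication by \<open>c \<in> Ht\<close> on an integral only affects its left leg.
\<close>
lemma L_faithful_Ht_right:
  assumes c: "c \<in> Ht" and 0: "\<And>l. l \<in> L \<Longrightarrow> l * c = 0" shows "c = 0"
proof -
  have "sw (E m) (\<lambda>p q. cf i (S q) *s (p * c)) = sw (E m * c) (\<lambda>p q. cf i (S q) *s p)" for m i
    by (rule sw_Ht_right[symmetric]) (simp_all add: c lins3)
  then have "sw (E m) (\<lambda>p q. cf i (S q) *s (p * c)) = 0" for m i
    by (simp add: 0 E_in_L sw_0 lins3)
  then show ?thesis using left_leg_expand[OF lin_mult_right[of c], of 1] by simp
qed

text \<open>
  A dimension count. The Frobenius form gives \<open>dim L = dim Hs\<close>, so only a generator is missing. Take \<open>l\<^sub>0\<close>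
  with \<open>dim (l\<^sub>0 Hs)\<close> maximal; its annihilator is \<open>f Hs\<close> for an idempotent \<open>f\<close>, and \<open>L = l\<^sub>0 Hs \<oplus> L'\<close> with
  \<open>dim L' = dim (f Hs)\<close> and, by maximality, \<open>L' f = 0\<close>. Attach to each \<open>z \<in> Ht\<close> an \<open>Hs\<close>-linear endomorphism
  \<open>T z\<close> of \<open>L\<close>. These are injectively parametrised by \<open>Ht\<close>, whereas by \<open>L_endomorphism\<close> all
  \<open>Hs\<close>-linear endomorphisms are also parametrised by \<open>Ht\<close>; so every one of them is some \<open>T z\<close>. The
  endomorphism \<open>l \<mapsto> \<kappa>(f) \<alpha>(l)\<close> below can only be a \<open>T z\<close> if \<open>f = 0\<close>.
\<close>
lemma L_cyclic:
  assumes \<theta>: "nondeg \<theta>"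
  obtains l where "l \<in> L" "\<And>l'. l' \<in> L \<Longrightarrow> \<exists>y\<in>Hs. l' = l * y" "\<And>y. y \<in> Hs \<Longrightarrow> l * y = 0 \<Longrightarrow> y = 0"
proof -
  have \<theta>_linf: "linf \<theta>" using \<theta> by (simp add: nondeg_def)
  note [simp] = linfD[OF \<theta>_linf]
  interpret pp: finite_dimensional_vector_space_pair scale bas scale bas by unfold_locales
  have "\<exists>w. \<forall>h. \<epsilon> (z * h) = \<theta> (h * w)" for z
    using nondeg_right[OF \<theta> linf_comp[OF counit_linear lin_mult_left[of z]]] .
  (* omega z represents the functional eps(z -); on Hs it is a linear bijection onto L. *)
  then obtain \<omega> where \<omega>: "\<And>z h. \<epsilon> (z * h) = \<theta> (h * \<omega> z)" by metis
  have \<theta>eq: "x = y" if "\<And>h. \<theta> (h * x) = \<theta> (h * y)" for x y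
  proof -
    have "\<theta> (h * (x - y)) = 0" for h using that by (simp add: right_diff_distrib)
    then have "x - y = 0" using \<theta> unfolding nondeg_def by blast
    then show ?thesis by simp
  qed
  have \<omega>_lin: "lin \<omega>"
    by (rule linI; rule \<theta>eq; simp add: \<omega>[symmetric] lins)
  have \<omega>L: "\<omega> z \<in> L" for z
  proof -
    have "h * \<omega> z = et h * \<omega> z" for h
    proof (rule \<theta>eq)
      fix x have "\<epsilon> (z * (x * h)) = \<epsilon> (z * (x * et h))" by (metis \<epsilon>_et mult.assoc)
      then show "\<theta> (x * (h * \<omega> z)) = \<theta> (x * (et h * \<omega> z))" by (simp add: mult.assoc[symmetric] \<omega>[symmetric])
    qed
    then show ?thesis by (simp add: L_def)
  qed
  have \<omega>inj: "y = 0" if "y \<in> Hs" "\<omega> y = 0" for y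
    using Hs_nondeg_right[OF that(1)] \<omega>[of y] that(2) by simp
  have \<omega>surj: "\<exists>y\<in>Hs. l = \<omega> y" if l: "l \<in> L" for l
  proof
    define y where "y = sw 1 (\<lambda>a b. \<theta> (b * l) *s a)"
    show "y \<in> Hs" unfolding y_def by (rule sw_1_in_Hs, rule linfI) (simp_all add: lins)
    show "l = \<omega> y"
    proof (rule \<theta>eq)
      fix h
      have "\<epsilon> (y * h) = sw 1 (\<lambda>a b. \<theta> (\<epsilon> (a * h) *s b * l))"
        unfolding y_def by (simp add: sws lins mult.commute)
      also have "\<dots> = \<theta> (et h * l)" unfolding et_def sw_mult_right linf_sw[OF \<theta>_linf] ..
      finally show "\<theta> (h * l) = \<theta> (h * \<omega> y)" using l by (simp add: \<omega> L_def)
    qed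
  qed
  have L\<omega>: "L = \<omega> ` Hs" using \<omega>L \<omega>surj by blast
  have dimL: "dim L = dim Hs" unfolding L\<omega> by (rule dim_image_inj[OF \<omega>_lin Hs_subspace \<omega>inj])
  define A where "A l = (\<lambda>y. l * y) ` Hs" for l
  have A_sub: "subspace (A l)" for l
    unfolding A_def by (rule pp.linear_subspace_image[OF lin_mult_left Hs_subspace])
  (* A generator l0 of a submodule of the largest possible dimension. *)
  have "\<exists>l. l \<in> L \<and> (\<forall>l'. l' \<in> L \<longrightarrow> dim (A l') \<le> dim (A l))"
  proof (rule ex_has_greatest_nat[of "\<lambda>l. l \<in> L" 0 "\<lambda>l. dim (A l)" "dimension + 1"])
    show "0 \<in> L" using subspace_0[OF L_subspace] .
    show "\<forall>l. l \<in> L \<longrightarrow> dim (A l) < dimension + 1" by (simp add: dim_subset_UNIV less_Suc_eq_le)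
  qed
  then obtain l0 where l0: "l0 \<in> L" and max: "\<And>l. l \<in> L \<Longrightarrow> dim (A l) \<le> dim (A l0)" by blast
  have A0L: "A l0 \<subseteq> L" using l0 L_right_ideal by (auto simp: A_def)
  define J where "J = {y \<in> Hs. l0 * y = 0}"
  have J_sub: "subspace J"
    using Hs_subspace by (auto simp: subspace_def J_def distrib_left scale_mult_right)
  obtain f where fJ: "f \<in> J" and fx: "\<And>x. x \<in> J \<Longrightarrow> f * x = x"
  proof (rule Hs_right_ideal[OF J_sub])
    show "J \<subseteq> Hs" by (auto simp: J_def)
    show "x * y \<in> J" if "x \<in> J" "y \<in> Hs" for x y
      using that by (auto simp: J_def Hs_mult mult.assoc[symmetric])
  qed blast
  have f: "f \<in> Hs" "l0 * f = 0" "f * f = f" using fJ fx by (auto simp: J_def)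
  have f1: "1 - f \<in> Hs" using f(1) by (simp add: subspace_diff Hs_subspace)
  have l0f: "l0 * (1 - f) = l0" by (simp add: right_diff_distrib f)
  have AHs: "x * y \<in> A l0" if "x \<in> A l0" "y \<in> Hs" for x y
    using that by (auto simp: A_def mult.assoc Hs_mult)
  obtain P where P: "lin P" "\<And>x. P x \<in> A l0" "\<And>x. x \<in> A l0 \<Longrightarrow> P x = x" "\<And>x y. y \<in> Hs \<Longrightarrow> P (x * y) = P x * y"
    by (rule Hs_split_right[OF A_sub AHs]) blast+
  note [simp] = linD[OF P(1)]
  define L' where "L' = {l \<in> L. P l = 0}"
  have L'_sub: "subspace L'"
    using L_subspace by (auto simp: subspace_def L'_def)
  have L'Hs: "x * y \<in> L'" if "x \<in> L'" "y \<in> Hs" for x y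
    using that by (auto simp: L'_def L_right_ideal P(4))
  have diffL': "l - P l \<in> L'" if "l \<in> L" for l
    using that P(2)[of l] P(3)[OF P(2)] A0L L_subspace by (auto simp: L'_def subspace_diff)
  (* If x f were nonzero, the submodule generated by l0 + x f would be larger than that of l0:
     it contains l0 = (l0 + x f) (1 - f) and x f = (l0 + x f) f. *)
  have L'f: "x * f = 0" if x: "x \<in> L'" for x
  proof (rule ccontr)
    assume nz: "x * f \<noteq> 0"
    define l1 where "l1 = l0 + x * f"
    have "l1 \<in> L" using l0 x L_right_ideal L_subspace by (auto simp: l1_def L'_def subspace_add)
    have l1f: "l1 * (1 - f) = l0" by (simp add: l1_def distrib_right l0f right_diff_distrib mult.assoc f)
    have l1f': "l1 * f = x * f" by (simp add: l1_def distrib_right mult.assoc f)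
    have "A l0 \<subseteq> A l1"
    proof
      fix v assume "v \<in> A l0"
      then obtain y where y: "y \<in> Hs" "v = l0 * y" by (auto simp: A_def)
      then have "v = l1 * ((1 - f) * y)" by (simp add: mult.assoc[symmetric] l1f)
      then show "v \<in> A l1" using f1 y by (auto simp: A_def Hs_mult)
    qed
    moreover have "x * f \<in> A l1" unfolding A_def l1f'[symmetric] using f by blast
    moreover have "x * f \<notin> A l0"
      using P(3)[of "x * f"] P(4)[OF f(1), of x] x nz by (auto simp: L'_def)
    ultimately have "span (A l0) \<subset> span (A l1)" using A_sub by (auto simp: span_eq_iff[THEN iffD2])
    then have "dim (A l0) < dim (A l1)" by (rule dim_psubset)
    then show False using max[OF \<open>l1 \<in> L\<close>] by simp
  qed
  define fA where "fA = (\<lambda>y. f * y) ` Hs"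
  define gA where "gA = (\<lambda>y. (1 - f) * y) ` Hs"
  have fA_sub: "subspace fA" and gA_sub: "subspace gA"
    unfolding fA_def gA_def by (rule pp.linear_subspace_image[OF lin_mult_left Hs_subspace])+
  have f1f: "(1 - f) * f = 0" "f * (1 - f) = 0" by (simp_all add: left_diff_distrib right_diff_distrib f)
  have gA_inj: "y = 0" if "y \<in> gA" "l0 * y = 0" for y
  proof -
    obtain v where v: "v \<in> Hs" "y = (1 - f) * v" using \<open>y \<in> gA\<close> by (auto simp: gA_def)
    then have "y \<in> J" using that f1 by (simp add: J_def Hs_mult)
    then have "y = f * y" by (simp add: fx)
    then show ?thesis by (simp add: v mult.assoc[symmetric] f1f)
  qed
  have dimHs: "dim Hs = dim fA + dim gA"
  proof (rule dim_direct_sum[OF fA_sub gA_sub])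
    show "fA \<inter> gA \<subseteq> {0}"
    proof
      fix x assume "x \<in> fA \<inter> gA"
      then obtain a b where xa: "x = f * a" and xb: "x = (1 - f) * b" unfolding fA_def gA_def by blast
      have "f * x = x" unfolding xa by (simp add: mult.assoc[symmetric] f)
      moreover have "f * x = 0" unfolding xb by (simp add: mult.assoc[symmetric] f1f)
      ultimately show "x \<in> {0}" by simp
    qed
    show "Hs = {x + y |x y. x \<in> fA \<and> y \<in> gA}"
    proof (intro equalityI subsetI)
      fix y assume "y \<in> Hs"
      moreover have "y = f * y + (1 - f) * y" by (simp add: left_diff_distrib)
      ultimately show "y \<in> {x + y |x y. x \<in> fA \<and> y \<in> gA}" unfolding fA_def gA_def by blast
    qed (auto simp: fA_def gA_def intro!: Hs_add Hs_mult f f1)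
  qed
  have A0: "A l0 = (\<lambda>y. l0 * y) ` gA"
  proof -
    have "l0 * y = l0 * ((1 - f) * y)" for y by (simp add: mult.assoc[symmetric] l0f)
    then show ?thesis by (auto simp: A_def gA_def image_image)
  qed
  have dimA0: "dim (A l0) = dim gA" unfolding A0 by (rule dim_image_inj[OF lin_mult_left gA_sub gA_inj])
  have dimL2: "dim L = dim (A l0) + dim L'"
  proof (rule dim_direct_sum[OF A_sub L'_sub])
    show "A l0 \<inter> L' \<subseteq> {0}" using P(3) by (auto simp: L'_def)
    show "L = {x + y |x y. x \<in> A l0 \<and> y \<in> L'}"
    proof (intro equalityI subsetI)
      fix l assume "l \<in> L"
      then have "l = P l + (l - P l) \<and> P l \<in> A l0 \<and> l - P l \<in> L'" using diffL' P(2) by simp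
      then show "l \<in> {x + y |x y. x \<in> A l0 \<and> y \<in> L'}" by blast
    qed (use A0L L_subspace in \<open>auto simp: L'_def intro!: subspace_add\<close>)
  qed
  (* kappa is linear only, with no compatibility with the action of Hs. *)
  have "dim fA = dim L'" using dimHs dimA0 dimL2 dimL by simp
  then obtain \<kappa> where \<kappa>: "lin \<kappa>" "\<kappa> ` fA = L'" "inj_on \<kappa> fA"
    using pp.subspace_isomorphism[OF fA_sub L'_sub] by blast
  note [simp] = linD[OF \<kappa>(1)]
  have \<kappa>in: "\<kappa> v \<in> L'" if "v \<in> fA" for v using \<kappa>(2) that by blast
  have \<kappa>L': "\<kappa> (f * y) \<in> L'" if "y \<in> Hs" for y using that by (intro \<kappa>in) (auto simp: fA_def)
  have \<kappa>0: "f * y = 0" if "y \<in> Hs" "\<kappa> (f * y) = 0" for y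
    using inj_onD[OF \<kappa>(3), of "f * y" 0] that subspace_0[OF fA_sub] by (auto simp: fA_def)
  obtain g where g: "lin g" "\<And>x. g x \<in> Hs" "\<And>x. x \<in> A l0 \<Longrightarrow> l0 * g x = x"
    using pp.linear_exists_right_inverse_on[OF lin_mult_left[of l0] Hs_subspace] unfolding A_def by blast
  note [simp] = linD[OF g(1)]
  (* alpha is the coordinate of the component in l0 Hs: P l = l0 * alpha l with alpha l in (1 - f) Hs. *)
  define \<alpha> where "\<alpha> l = (1 - f) * g (P l)" for l
  have \<alpha>gA: "\<alpha> l \<in> gA" for l using g(2) by (auto simp: \<alpha>_def gA_def)
  have \<alpha>Hs: "\<alpha> l \<in> Hs" for l using g(2) f1 by (auto simp: \<alpha>_def Hs_mult)
  have l0\<alpha>: "l0 * \<alpha> l = P l" for l by (simp add: \<alpha>_def mult.assoc[symmetric] l0f g P)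
  have \<alpha>_unique: "\<alpha> l = y" if "y \<in> gA" "l0 * y = P l" for l y
  proof -
    have "\<alpha> l - y = 0"
    proof (rule gA_inj)
      show "\<alpha> l - y \<in> gA" by (rule subspace_diff[OF gA_sub \<alpha>gA that(1)])
      show "l0 * (\<alpha> l - y) = 0" by (simp only: right_diff_distrib l0\<alpha> that(2) diff_self)
    qed
    then show ?thesis by simp
  qed
  have \<alpha>_lin: "lin \<alpha>" by (rule linI) (simp_all add: \<alpha>_def lins)
  note [simp] = linD[OF \<alpha>_lin]
  have \<alpha>Hs_mult: "\<alpha> (l * y) = \<alpha> l * y" if y: "y \<in> Hs" for l y
  proof (rule \<alpha>_unique)
    show "\<alpha> l * y \<in> gA" using y g(2) by (auto simp: \<alpha>_def gA_def mult.assoc Hs_mult)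
    show "l0 * (\<alpha> l * y) = P (l * y)" by (simp add: mult.assoc[symmetric] l0\<alpha> P(4) y)
  qed
  have \<alpha>l0: "\<alpha> l0 = 1 - f"
  proof (rule \<alpha>_unique)
    show "1 - f \<in> gA" unfolding gA_def by (rule image_eqI[of _ _ 1]) simp_all
    have "l0 \<in> A l0" unfolding A_def by (rule image_eqI[of _ _ 1]) simp_all
    then show "l0 * (1 - f) = P l0" by (simp add: l0f P)
  qed
  (* phi z is the Hs-linear map from L to Hs that satisfies eps(phi z l) = theta(z l). *)
  define \<phi> where "\<phi> z l = sw 1 (\<lambda>a b. \<theta> (z * l * a) *s S b)" for z l
  have \<phi>_lin: "lin (\<phi> z)" "lin (\<lambda>z. \<phi> z l)" for z l
    by (rule linI; simp add: \<phi>_def lins3 sws)+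
  note [simp] = linD[OF \<phi>_lin(1)] linD[OF \<phi>_lin(2)]
  have \<phi>Hs: "\<phi> z l \<in> Hs" for z l
  proof -
    have "\<phi> z l = sw 1 (\<lambda>a b. \<theta> (z * l * a) *s S (et b))"
      unfolding \<phi>_def by (rule sw_1_et[symmetric]) (simp add: lins3)
    also have "\<dots> \<in> Hs" by (rule sw_in_subspace[OF Hs_subspace]) (simp add: Hs_scale)
    finally show ?thesis .
  qed
  have \<phi>_mult: "\<phi> z (l * y) = \<phi> z l * y" if y: "y \<in> Hs" for z l y
  proof -
    obtain w where w: "w \<in> Ht" "S w = y" using y by (rule Hs_S_image)
    have "\<phi> z (l * y) = sw 1 (\<lambda>a b. \<theta> (z * l * (S w * a)) *s S b)" by (simp add: \<phi>_def w mult.assoc)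
    also have "\<dots> = sw 1 (\<lambda>a b. \<theta> (z * l * a) *s S (w * b))"
      by (rule sw_1_Ht_left[symmetric]) (simp_all add: lins3 w)
    also have "\<dots> = \<phi> z l * y" by (simp add: \<phi>_def sw_mult_right S_mult w scale_mult_left)
    finally show ?thesis .
  qed
  have \<epsilon>\<phi>: "\<epsilon> (\<phi> z l) = \<theta> (z * l)" for z l
  proof -
    have "\<epsilon> (\<phi> z l) = \<theta> (z * l * sw 1 (\<lambda>a b. \<epsilon> b *s a))"
      unfolding \<phi>_def by (simp add: sw_mult_left sws linf_sw[OF \<theta>_linf] lins \<epsilon>_S)
    then show ?thesis by (simp add: counit_right_sw)
  qed
  (* The two summands take values in l0 Hs and in L', so both can be recovered from T z. *)
  define T where "T z l = l0 * \<phi> z l + \<kappa> (f * \<phi> z l0) * \<alpha> l" for z l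
  have L_add: "x + y \<in> L" if "x \<in> L" "y \<in> L" for x y using that by (rule subspace_add[OF L_subspace])
  have \<kappa>inL: "\<kappa> (f * y) \<in> L" if "y \<in> Hs" for y using \<kappa>L'[OF that] by (simp add: L'_def)
  have "\<exists>c. c \<in> Ht \<and> (\<forall>l\<in>L. T z l = l * c)" for z
  proof -
    have "lin (T z)" by (rule linI) (simp_all add: T_def lins)
    then obtain c where "c \<in> Ht" "\<And>l. l \<in> L \<Longrightarrow> T z l = l * c"
      by (rule L_endomorphism)
        (auto simp: T_def distrib_right mult.assoc \<phi>_mult \<alpha>Hs_mult intro!: L_add L_right_ideal l0 \<kappa>inL \<phi>Hs)
    then show ?thesis by blast
  qed
  then obtain G where G: "\<And>z. G z \<in> Ht" "\<And>z l. l \<in> L \<Longrightarrow> T z l = l * G z" by metis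
  have Guniq: "x = y" if "x \<in> Ht" "y \<in> Ht" "\<And>l. l \<in> L \<Longrightarrow> l * x = l * y" for x y
    using L_faithful_Ht_right[of "x - y"] that subspace_diff[OF Ht_subspace] by (simp add: right_diff_distrib)
  have G_lin: "lin G"
  proof (rule linI)
    show "G (x + y) = G x + G y" for x y
      by (rule Guniq) (simp_all add: G Ht_add distrib_left G(2)[symmetric] T_def lins)
    show "G (r *s x) = r *s G x" for r x
      by (rule Guniq) (simp_all add: G Ht_scale scale_mult_right G(2)[symmetric] T_def lins)
  qed
  have key: "l0 * \<phi> z l = 0 \<and> f * \<phi> z l0 = w" if w: "w \<in> fA" and z: "\<And>l. l \<in> L \<Longrightarrow> T z l = \<kappa> w * \<alpha> l" and l: "l \<in> L" for z w l
  proof -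
    have \<kappa>wL': "\<kappa> w \<in> L'" using w \<kappa>(2) by blast
    have P\<kappa>: "P (\<kappa> v * \<alpha> l) = 0" if "v \<in> fA" for v l
      using \<kappa>in[OF that] \<alpha>Hs by (simp add: P(4) L'_def)
    have f\<phi>: "f * \<phi> z l0 \<in> fA" using \<phi>Hs by (auto simp: fA_def)
    have 1: "l0 * \<phi> z l = 0" if l: "l \<in> L" for l
    proof -
      have "P (T z l) = P (\<kappa> w * \<alpha> l)" using z[OF l] by simp
      then have "P (l0 * \<phi> z l) = 0" by (simp add: T_def P\<kappa> w f\<phi>)
      moreover have "l0 * \<phi> z l \<in> A l0" using \<phi>Hs by (simp add: A_def)
      ultimately show ?thesis using P(3) by simp
    qed
    have "\<kappa> (f * \<phi> z l0) * (1 - f) = \<kappa> w * (1 - f)"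
      using z[OF l0] by (simp add: T_def 1 l0 \<alpha>l0)
    moreover have "\<kappa> v * (1 - f) = \<kappa> v" if "v \<in> fA" for v
      using L'f[OF \<kappa>in[OF that]] by (simp add: right_diff_distrib)
    ultimately have "\<kappa> (f * \<phi> z l0) = \<kappa> w" using w f\<phi> by simp
    then have "f * \<phi> z l0 = w" using inj_onD[OF \<kappa>(3)] w f\<phi> by blast
    then show ?thesis using 1[OF l] by simp
  qed
  (* If T z = 0 then phi z maps L into f Hs and kills l0. Its values on L' form a right ideal whose
     left unit e = phi z l' satisfies e x = phi z (l' f x) = 0, so phi z = 0 and theta(z -) vanishes on L. *)
  have G_inj: "z = 0" if z: "z \<in> Ht" and Gz: "G z = 0" for z
  proof -
    have 1: "l0 * \<phi> z l = 0 \<and> f * \<phi> z l0 = 0" if "l \<in> L" for l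
      using that by (intro key[of 0]) (simp_all add: fA_sub subspace_0 G(2) Gz)
    have \<phi>J: "f * \<phi> z l = \<phi> z l" if "l \<in> L" for l using 1[OF that] \<phi>Hs by (intro fx) (simp add: J_def)
    have \<phi>l0: "\<phi> z l0 = 0" using \<phi>J[OF l0] 1[OF l0] by simp
    define X where "X = \<phi> z ` L'"
    have X1: "subspace X" unfolding X_def by (rule pp.linear_subspace_image[OF \<phi>_lin(1) L'_sub])
    have X2: "X \<subseteq> Hs" using \<phi>Hs by (auto simp: X_def)
    have X3: "x * y \<in> X" if "x \<in> X" "y \<in> Hs" for x y
      using that L'Hs by (auto simp: X_def \<phi>_mult[symmetric])
    obtain e where e: "e \<in> X" "\<And>x. x \<in> X \<Longrightarrow> e * x = x"
      by (rule Hs_right_ideal[OF X1 X2 X3]) blast+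
    then obtain l' where l': "l' \<in> L'" "e = \<phi> z l'" by (auto simp: X_def)
    have XX: "e * x = 0" if "x \<in> X" for x
    proof -
      from that obtain l'' where l'': "l'' \<in> L'" "x = \<phi> z l''" by (auto simp: X_def)
      then have fx': "f * x = x" using \<phi>J by (auto simp: L'_def)
      have "e * x = \<phi> z (l' * (f * x))" using \<phi>_mult[of x z l'] \<phi>Hs l'' l' fx' by simp
      also have "\<dots> = 0" by (simp add: mult.assoc[symmetric] L'f l')
      finally show ?thesis .
    qed
    have \<phi>L': "\<phi> z x = 0" if "x \<in> L'" for x using e XX that by (force simp: X_def)
    have \<phi>0: "\<phi> z l = 0" if l: "l \<in> L" for l
    proof -
      have "\<phi> z (P l) = \<phi> z (l0 * \<alpha> l)" by (simp add: l0\<alpha>)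
      also have "\<dots> = 0" by (simp add: \<phi>_mult \<alpha>Hs \<phi>l0)
      finally have "\<phi> z (P l) = 0" .
      then show ?thesis using \<phi>L'[OF diffL'[OF l]] by simp
    qed
    have "\<epsilon> (x * z) = 0" for x using \<epsilon>\<phi>[of z "\<omega> x"] \<phi>0[OF \<omega>L] \<omega>[of x z] by simp
    then show "z = 0" using Ht_nondeg_left[OF z] by blast
  qed
  have "G ` Ht = Ht" by (rule lin_inj_on_image_eq[OF G_lin Ht_subspace _ G_inj]) (use G in auto)
  have f_in: "f \<in> fA" unfolding fA_def by (rule image_eqI[of _ _ 1]) simp_all
  (* The endomorphism l |-> kappa f * alpha l equals T z for some z, and then f = f phi(l0), while
     phi(l0) = phi(l0 (1 - f)) = phi(l0) (1 - f). *)
  obtain c where c: "c \<in> Ht" "\<And>l. l \<in> L \<Longrightarrow> \<kappa> f * \<alpha> l = l * c"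
  proof (rule L_endomorphism[of "\<lambda>l. \<kappa> f * \<alpha> l"])
    show "lin (\<lambda>l. \<kappa> f * \<alpha> l)" by (rule linI) (simp_all add: lins)
    show "\<kappa> f * \<alpha> l \<in> L" if "l \<in> L" for l using \<kappa>in[OF f_in] by (intro L_right_ideal) (simp add: L'_def)
  qed (simp_all add: \<alpha>Hs_mult mult.assoc)
  then obtain z where "G z = c" using \<open>G ` Ht = Ht\<close> by (metis imageE)
  then have "f * \<phi> z l0 = f" using key[OF f_in _ l0, of z] c G by simp
  moreover have "\<phi> z l0 = \<phi> z l0 * (1 - f)" using \<phi>_mult[OF f1, of z l0] l0f by simp
  ultimately have "f = f * (\<phi> z l0 * (1 - f))" by simp
  also have "\<dots> = f * (1 - f)" using \<open>f * \<phi> z l0 = f\<close> by (simp add: mult.assoc[symmetric])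
  finally have "f = 0" by (simp add: f1f)
  have inj0: "y = 0" if "y \<in> Hs" "l0 * y = 0" for y using fx[of y] that \<open>f = 0\<close> by (simp add: J_def)
  have "dim (A l0) = dim Hs" unfolding A_def by (rule dim_image_inj[OF lin_mult_left Hs_subspace inj0])
  then have "A l0 = L" using dimL by (intro subspace_dim_equal A_sub L_subspace A0L) simp
  then show thesis using that[OF l0 _ inj0] by (auto simp: A_def)
qed

text \<open>
  For \<open>c = l\<^sub>1 \<theta>(l\<^sub>2)\<close> one has \<open>l\<^sub>1 \<theta>(h l\<^sub>2) = S(h) c\<close>. As all integrals lie in \<open>l Hs\<close> and all functionals have the form
  \<open>\<theta>(h -)\<close>, every left leg of an integral lies in \<open>H c\<close>; these legs span \<open>H\<close>, so \<open>c\<close> is a unit. The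
  form \<open>\<mu>\<close> is \<open>\<theta>\<close> translated by \<open>k = S\<^sup>-\<^sup>1(c\<^sup>-\<^sup>1)\<close>.
\<close>
lemma nondegenerate_integral:
  assumes \<theta>: "nondeg \<theta>"
  obtains l \<mu> where "l \<in> L" "nondeg \<mu>" "\<And>h. sw l (\<lambda>a b. \<mu> (h * b) *s a) = S h"
    "\<And>l'. l' \<in> L \<Longrightarrow> \<exists>y\<in>Hs. l' = l * y" "\<And>y. y \<in> Hs \<Longrightarrow> l * y = 0 \<Longrightarrow> y = 0"
proof -
  obtain l where l: "l \<in> L" "\<And>l'. l' \<in> L \<Longrightarrow> \<exists>y\<in>Hs. l' = l * y" "\<And>y. y \<in> Hs \<Longrightarrow> l * y = 0 \<Longrightarrow> y = 0"
    by (rule L_cyclic[OF \<theta>]) blast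
  have \<theta>_linf: "linf \<theta>" using \<theta> by (simp add: nondeg_def)
  define c where "c = rslice \<theta> l"
  have Sc: "sw l (\<lambda>a b. \<theta> (h * b) *s a) = S h * c" for h
    using L_mult_right_leg[OF l(1) bil_linf_right[OF \<theta>_linf], of h] by (simp add: c_def rslice_def sw_mult_left scale_mult_right)
  let ?Hc = "(\<lambda>x. x * c) ` UNIV"
  interpret pp: finite_dimensional_vector_space_pair scale bas scale bas by unfold_locales
  have Hc: "subspace ?Hc" by (rule pp.linear_subspace_image[OF lin_mult_right]) simp
  have sl: "sw l' (\<lambda>a b. \<psi> b *s a) \<in> ?Hc" if l': "l' \<in> L" and \<psi>: "linf \<psi>" for l' \<psi>
  proof -
    obtain y where y: "y \<in> Hs" "l' = l * y" using l(2)[OF l'] by blast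
    have "sw l' (\<lambda>a b. \<psi> b *s a) = sw l (\<lambda>a b. \<psi> (b * y) *s a)"
      unfolding y by (rule sw_Hs_right[OF bil_linf_right[OF \<psi>] y(1)])
    moreover obtain h where "\<And>b. \<psi> (b * y) = \<theta> (h * b)"
      using nondeg_left[OF \<theta> linf_comp[OF \<psi> lin_mult_right[of y]]] by blast
    ultimately show ?thesis using Sc by simp
  qed
  have "sw (E (i * 1)) (\<lambda>p q. cf i (S q) *s p) \<in> ?Hc" for i
    by (intro sl E_in_L linf_comp[OF cf_linf S_lin])
  then have "1 \<in> ?Hc" by (subst E_reconstruct[symmetric]) (intro subspace_sum[OF Hc])
  then obtain x where x: "x * c = 1" by auto
  then have cx: "c * x = 1" by (rule left_inverse_imp)
  define k where "k = Si x"
  have k: "k * Si c = 1" "Si c * k = 1" by (simp_all add: k_def Si_mult[symmetric] x cx)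
  show thesis
  proof (rule that[OF l(1) _ _ l(2,3), of "\<lambda>b. \<theta> (k * b)"])
    show "nondeg (\<lambda>b. \<theta> (k * b))"
      unfolding nondeg_def
    proof (intro conjI allI impI)
      show "linf (\<lambda>b. \<theta> (k * b))" by (rule linf_comp[OF \<theta>_linf lin_mult_left])
      show "a = 0" if "\<forall>b. \<theta> (k * (a * b)) = 0" for a
      proof -
        have "k * a = 0" using \<theta> that by (simp add: nondeg_def mult.assoc)
        then have "Si c * (k * a) = 0" by simp
        then show ?thesis by (simp add: mult.assoc[symmetric] k)
      qed
      show "b = 0" if "\<forall>a. \<theta> (k * (a * b)) = 0" for b
      proof -
        have "\<theta> (a * b) = 0" for a using that[rule_format, of "Si c * a"] by (simp add: mult.assoc[symmetric] k)
        then show ?thesis using \<theta> by (simp add: nondeg_def)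
      qed
    qed
    show "sw l (\<lambda>a b. \<theta> (k * (h * b)) *s a) = S h" for h
      using Sc[of "k * h"] by (simp add: S_mult mult.assoc k_def x)
  qed
qed

section \<open>Radford's formula\<close>

definition invertible :: "'h \<Rightarrow> bool" where "invertible x \<longleftrightarrow> (\<exists>x'. x * x' = 1 \<and> x' * x = 1)"

lemma invertibleI_right: "x * x' = 1 \<Longrightarrow> invertible x" using left_inverse_imp unfolding invertible_def by blast
lemma invertibleI_left: "x' * x = 1 \<Longrightarrow> invertible x" using left_inverse_imp unfolding invertible_def by blast
lemma invertible_mult: "invertible x \<Longrightarrow> invertible y \<Longrightarrow> invertible (x * y)"
proof -
  assume "invertible x" "invertible y"
  then obtain x' y' where "x * x' = 1" "y * y' = 1" unfolding invertible_def by blast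
  then have "x * y * (y' * x') = 1" by (metis mult.assoc mult_1_left)
  then show ?thesis by (rule invertibleI_right)
qed
lemma invertible_S: "invertible x \<Longrightarrow> invertible (S x)"
proof -
  assume "invertible x"
  then obtain x' where "x * x' = 1" unfolding invertible_def by blast
  then have "S x' * S x = 1" by (simp add: S_mult[symmetric])
  then show ?thesis by (rule invertibleI_left)
qed
lemma invertible_1[simp]: "invertible 1" by (rule invertibleI_right[of 1 1]) simp

text \<open>
  Twisted grouplike elements: \<open>\<Delta>(x) = (a \<otimes> b) \<Delta>(1)\<close> with units \<open>a\<close>, \<open>b\<close>. In contrast to grouplike elements they
  include the units of both bases. A definition cannot quantify over the target type of \<open>F\<close>; values in
  \<open>H\<close> are enough here, since a product of two functionals can be turned into such a map by multiplying it
  with a fixed vector.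
\<close>
definition tw_grouplike :: "'h \<Rightarrow> bool" where
  "tw_grouplike x \<longleftrightarrow> (\<exists>a b. invertible a \<and> invertible b \<and> (\<forall>F :: 'h \<Rightarrow> 'h \<Rightarrow> 'h. bil F \<longrightarrow> sw x F = sw 1 (\<lambda>p q. F (a * p) (b * q))))"

definition algebra_aut :: "('h \<Rightarrow> 'h) \<Rightarrow> bool" where
  "algebra_aut T \<longleftrightarrow> lin T \<and> bij T \<and> T 1 = 1 \<and> (\<forall>x y. T (x * y) = T x * T y)"
text \<open>
  \<open>\<Delta>(T x) = x\<^sub>1 \<otimes> T x\<^sub>2\<close> and, in the next definition, \<open>\<Delta>(T x) = T x\<^sub>1 \<otimes> x\<^sub>2\<close>: linearity over the dual algebra
  for the left and the right regular coaction.
\<close>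
definition left_colinear :: "('h \<Rightarrow> 'h) \<Rightarrow> bool" where
  "left_colinear T \<longleftrightarrow> (\<forall>F :: 'h \<Rightarrow> 'h \<Rightarrow> 'h. \<forall>x. bil F \<longrightarrow> sw (T x) F = sw x (\<lambda>p q. F p (T q)))"
definition right_colinear :: "('h \<Rightarrow> 'h) \<Rightarrow> bool" where
  "right_colinear T \<longleftrightarrow> (\<forall>F :: 'h \<Rightarrow> 'h \<Rightarrow> 'h. \<forall>x. bil F \<longrightarrow> sw (T x) F = sw x (\<lambda>p q. F (T p) q))"

lemma tw_grouplike_SS: assumes "tw_grouplike x" shows "tw_grouplike (S (S x))"
proof -
  obtain a b where ab: "invertible a" "invertible b" and x: "\<And>F :: 'h \<Rightarrow> 'h \<Rightarrow> 'h. bil F \<Longrightarrow> sw x F = sw 1 (\<lambda>p q. F (a * p) (b * q))"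
    using assms unfolding tw_grouplike_def by blast
  have "sw (S (S x)) F = sw 1 (\<lambda>p q. F (S (S a) * p) (S (S b) * q))" if F: "bil F" for F :: "'h \<Rightarrow> 'h \<Rightarrow> 'h"
  proof -
    note [simp] = bilD[OF F]
    have "sw (S (S x)) F = sw (S x) (\<lambda>p q. F (S q) (S p))" by (rule sw_S[OF F])
    also have "\<dots> = sw x (\<lambda>p q. F (S (S p)) (S (S q)))" by (rule sw_S) (simp add: lins3)
    also have "\<dots> = sw 1 (\<lambda>p q. F (S (S (a * p))) (S (S (b * q))))" by (rule x) (simp add: lins3)
    also have "\<dots> = sw 1 (\<lambda>p q. F (S (S a) * S (S p)) (S (S b) * S (S q)))" by (simp only: S_mult)
    also have "\<dots> = sw 1 (\<lambda>p q. F (S (S a) * S q) (S (S b) * S p))"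
      by (rule sw_1_S[of "\<lambda>p q. F (S (S a) * S q) (S (S b) * S p)"]) (simp add: lins3)
    also have "\<dots> = sw 1 (\<lambda>p q. F (S (S a) * p) (S (S b) * q))"
      by (rule sw_1_S[of "\<lambda>p q. F (S (S a) * p) (S (S b) * q)"]) (simp add: lins3)
    finally show ?thesis .
  qed
  moreover have "invertible (S (S a))" "invertible (S (S b))" using ab by (simp_all add: invertible_S)
  ultimately show ?thesis unfolding tw_grouplike_def by blast
qed

lemma bil_expand_left:
  assumes F: "bil F" shows "F a b = (\<Sum>k\<in>bas. F k (cf k a *s b))"
proof -
  have "bil (\<lambda>p q. F q p)" using bilD[OF F] by (simp add: balanced2_def)
  from bil_expand_right[OF this, of a b] show ?thesis .
qed

end

text \<open>
  The output of \<open>nondegenerate_integral\<close>: a generator of the integrals with a dual Frobenius form.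
\<close>
locale integral_pair = fd_weak_hopf_algebra scale \<Delta> \<epsilon> S
  for scale :: "'k::field \<Rightarrow> 'h::{ring, monoid_mult} \<Rightarrow> 'h" (infixr \<open>*s\<close> 75)
    and \<Delta> :: "'h \<Rightarrow> ('h \<times> 'h) list" and \<epsilon> :: "'h \<Rightarrow> 'k" and S :: "'h \<Rightarrow> 'h" +
  fixes l :: 'h and \<mu> :: "'h \<Rightarrow> 'k"
  assumes l: "l \<in> L" and \<mu>: "nondeg \<mu>" and l_S: "sw l (\<lambda>a b. \<mu> (h * b) *s a) = S h"
    and l_gen: "l' \<in> L \<Longrightarrow> \<exists>y\<in>Hs. l' = l * y" and l_free: "y \<in> Hs \<Longrightarrow> l * y = 0 \<Longrightarrow> y = 0"
begin

lemma \<mu>_linf: "linf \<mu>" using \<mu> by (simp add: nondeg_def)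
lemmas \<mu>D[simp] = linfD[OF \<mu>_linf]

lemma \<mu>_eqR: assumes "\<And>h. \<mu> (h * x) = \<mu> (h * y)" shows "x = y"
proof -
  have "\<mu> (h * (x - y)) = 0" for h using assms by (simp add: right_diff_distrib)
  then have "x - y = 0" using \<mu> unfolding nondeg_def by blast
  then show ?thesis by simp
qed
lemma \<mu>_eqL: assumes "\<And>h. \<mu> (x * h) = \<mu> (y * h)" shows "x = y"
proof -
  have "\<mu> ((x - y) * h) = 0" for h using assms by (simp add: left_diff_distrib)
  then have "x - y = 0" using \<mu> unfolding nondeg_def by blast
  then show ?thesis by simp
qed

definition nakayama :: "'h \<Rightarrow> 'h" where "nakayama b = (SOME h. \<forall>x. \<mu> (x * b) = \<mu> (h * x))"
lemma nakayama: "\<mu> (nakayama b * x) = \<mu> (x * b)"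
  unfolding nakayama_def
  by (rule someI_ex[OF nondeg_left[OF \<mu> linf_comp[OF \<mu>_linf lin_mult_right[of b]]], rule_format, symmetric])

lemma nakayama_lin: "lin nakayama" by (rule linI; rule \<mu>_eqL; simp add: nakayama lins)
lemma nakayama_mult: "nakayama (a * b) = nakayama a * nakayama b"
proof (rule \<mu>_eqL)
  fix x
  have "\<mu> (nakayama a * nakayama b * x) = \<mu> (nakayama b * (x * a))" by (simp add: mult.assoc nakayama)
  then show "\<mu> (nakayama (a * b) * x) = \<mu> (nakayama a * nakayama b * x)" by (simp add: nakayama mult.assoc)
qed
lemma nakayama_1: "nakayama 1 = 1" by (rule \<mu>_eqL) (simp add: nakayama)
lemma nakayama_bij: "bij nakayama"
proof -
  have "inj nakayama"
  proof (rule injI)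
    fix x y assume "nakayama x = nakayama y" then show "x = y" by (intro \<mu>_eqR) (metis nakayama)
  qed
  then show ?thesis using linear_inj_imp_surj[OF nakayama_lin] by (simp add: bij_def)
qed

lemma dual_basis: "sw l (\<lambda>a b. \<mu> (Si a * x) *s b) = x"
proof (rule \<mu>_eqR)
  fix h
  have "\<mu> (h * sw l (\<lambda>a b. \<mu> (Si a * x) *s b)) = \<mu> (Si (sw l (\<lambda>a b. \<mu> (h * b) *s a)) * x)"
    by (simp add: sw_mult_left linf_sw[OF \<mu>_linf] scale_mult_right lin_sw[OF Si_lin] sw_mult_right Si_scale scale_mult_left mult.commute)
  then show "\<mu> (h * sw l (\<lambda>a b. \<mu> (Si a * x) *s b)) = \<mu> (h * x)" by (simp add: l_S)
qed

definition mu_t :: "'h \<Rightarrow> 'h" where "mu_t x = rslice \<mu> x"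
lemma mu_t_lin: "lin mu_t" unfolding mu_t_def by (rule rslice_lin[OF \<mu>_linf])
lemmas mu_tD[simp] = linD[OF mu_t_lin]

text \<open>
  Writing \<open>x\<close> in the dual basis supplied by \<open>l\<close> and using \<open>l\<^sub>1 \<mu>(l\<^sub>2) = 1\<close> turns \<open>x\<^sub>1 \<mu>(x\<^sub>2)\<close> into a
  contraction of \<open>\<Delta>(1)\<close>: the form \<open>\<mu>\<close> is itself an integral on \<open>H\<close>.
\<close>
lemma mu_t_Ht: "mu_t x \<in> Ht"
proof -
  have b: "bil (\<lambda>p q. \<mu> q *s p)" by (rule bil_linf_right[OF \<mu>_linf])
  have "mu_t x = sw l (\<lambda>a b. sw b (\<lambda>p q. (\<mu> (Si a * x) * \<mu> q) *s p))"
    unfolding mu_t_def rslice_def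
    by (subst dual_basis[symmetric, of x]) (simp add: sw_sw_arg[OF b] sw_scale[OF b] mult.commute)
  also have "\<dots> = sw l (\<lambda>c q. sw c (\<lambda>a p. (\<mu> (Si a * x) * \<mu> q) *s p))"
    by (rule coassoc_sw[symmetric]) (simp add: lins3)
  also have "\<dots> = sw (sw l (\<lambda>c q. \<mu> (1 * q) *s c)) (\<lambda>a p. \<mu> (Si a * x) *s p)"
    by (subst sw_sw_arg) (simp_all add: lins3)
  also have "\<dots> = sw 1 (\<lambda>a p. \<mu> (Si a * x) *s p)" unfolding l_S by simp
  also have "\<dots> \<in> Ht" by (rule sw_1_in_Ht, rule linfI) (simp_all add: lins3)
  finally show ?thesis .
qed

definition T1 :: "'h \<Rightarrow> 'h" where "T1 b = S (S (nakayama b))"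

text \<open>
  Evaluating \<open>S(\<nu>(b)) = l\<^sub>1 \<mu>(l\<^sub>2 b)\<close> with \<open>b\<close> inserted as a coproduct. The second factor lies in \<open>Hs\<close>, so
  the coproduct of \<open>T1 b\<close> can be read off.
\<close>
lemma T1_formula: "T1 b = sw b (\<lambda>x y. x * S (mu_t (l * y)))"
proof -
  have "sw b (\<lambda>x y. mu_t (l * y) * Si x) = sw b (\<lambda>x y. sw y (\<lambda>u v. sw l (\<lambda>p q. \<mu> (q * v) *s (p * (u * Si x)))))"
    unfolding mu_t_def rslice_def
    by (rule sw_cong, subst mult_sw) (simp_all add: bil_linf_right[OF \<mu>_linf] sw_mult_right scale_mult_left mult.assoc sw_swap[of l])
  also have "\<dots> = sw b (\<lambda>c v. sw c (\<lambda>x u. sw l (\<lambda>p q. \<mu> (q * v) *s (p * (u * Si x)))))"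
    by (rule coassoc_sw[symmetric]) (simp add: lins3)
  also have "\<dots> = sw b (\<lambda>c v. sw l (\<lambda>p q. \<mu> (q * v) *s (p * Si (et c))))"
  proof (rule sw_cong)
    fix c v
    have "sw c (\<lambda>x u. u * Si x) = Si (et c)"
      by (simp add: antipode_right_sw[symmetric] lin_sw[OF Si_lin] Si_mult)
    then show "sw c (\<lambda>x u. sw l (\<lambda>p q. \<mu> (q * v) *s (p * (u * Si x)))) = sw l (\<lambda>p q. \<mu> (q * v) *s (p * Si (et c)))"
      by (subst sw_swap) (simp add: sw_scale_out[symmetric] sw_mult_left[symmetric])
  qed
  also have "\<dots> = sw 1 (\<lambda>m n. sw l (\<lambda>p q. \<mu> (q * (n * b)) *s (p * Si (S m))))"
    by (rule sw_et_left) (simp add: lins3)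
  also have "\<dots> = sw l (\<lambda>p q. sw 1 (\<lambda>m n. \<mu> (q * n * b) *s (p * m)))"
    by (subst sw_swap) (simp add: mult.assoc)
  also have "\<dots> = sw l (\<lambda>p q. \<mu> (q * b) *s p)"
    by (rule sw_one_mult(2)) (simp add: lins3)
  also have "\<dots> = S (nakayama b)" using l_S[of "nakayama b"] by (simp add: nakayama)
  finally have "S (nakayama b) = sw b (\<lambda>x y. mu_t (l * y) * Si x)" ..
  then show ?thesis by (simp add: T1_def sws S_mult)
qed

lemma T1_algebra_aut: "algebra_aut T1"
proof -
  have "T1 = S \<circ> (S \<circ> nakayama)" by (auto simp: T1_def)
  then have "bij T1" using S_bij nakayama_bij bij_comp by metis
  moreover have "lin T1" unfolding T1_def[abs_def] by (rule lin_comp[OF S_lin lin_comp[OF S_lin nakayama_lin]])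
  ultimately show ?thesis by (simp add: algebra_aut_def T1_def nakayama_mult S_mult nakayama_1)
qed

lemma T1_left_colinear: "left_colinear T1"
  unfolding left_colinear_def
proof (intro allI impI)
  fix F :: "'h \<Rightarrow> 'h \<Rightarrow> 'h" and b assume F: "bil F"
  note [simp] = bilD[OF F]
  have "sw (T1 b) F = sw b (\<lambda>x y. sw x (\<lambda>p q. F p (q * S (mu_t (l * y)))))"
    unfolding T1_formula sw_sw_arg[OF F] by (simp add: sw_Hs_right[OF F] mu_t_Ht)
  also have "\<dots> = sw b (\<lambda>p d. sw d (\<lambda>q y. F p (q * S (mu_t (l * y)))))"
    by (rule coassoc_sw) (simp add: lins3)
  also have "\<dots> = sw b (\<lambda>p d. F p (T1 d))" by (simp only: T1_formula bil_sw2[OF F])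
  finally show "sw (T1 b) F = sw b (\<lambda>p q. F p (T1 q))" .
qed

text \<open>
  The integrals form a right ideal, generated freely by \<open>l\<close> over \<open>Hs\<close>; so \<open>l b = l y\<close> for a unique
  \<open>y \<in> Hs\<close>. For ordinary Hopf algebras this is the modular function.
\<close>
definition modular :: "'h \<Rightarrow> 'h" where "modular b = (SOME y. y \<in> Hs \<and> l * b = l * y)"
lemma modular: "modular b \<in> Hs" "l * modular b = l * b"
proof -
  have "\<exists>y. y \<in> Hs \<and> l * b = l * y" using l_gen[OF L_right_ideal[OF l]] by blast
  from someI_ex[OF this] show "modular b \<in> Hs" "l * modular b = l * b" unfolding modular_def by auto
qed
lemma modular_unique: "x \<in> Hs \<Longrightarrow> y \<in> Hs \<Longrightarrow> l * x = l * y \<Longrightarrow> x = y"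
  using l_free[of "x - y"] subspace_diff[OF Hs_subspace] by (simp add: right_diff_distrib)
lemma modular_lin: "lin modular"
  by (rule linI; rule modular_unique) (simp_all add: modular Hs_add Hs_scale distrib_left scale_mult_right)
lemmas modularD[simp] = linD[OF modular_lin]

text \<open>
  The element \<open>\<mu>(l\<^sub>1) l\<^sub>2\<close>, the distinguished grouplike element of Radford's formula.
\<close>
definition modulus :: 'h where "modulus = slice \<mu> l"

definition T2 :: "'h \<Rightarrow> 'h" where "T2 b = sw b (\<lambda>x y. y * Si (modular x))"

lemma modulus_left: "x * modulus = sw l (\<lambda>a b. \<mu> (S x * a) *s b)"
  unfolding modulus_def slice_mult_left[OF \<mu>_linf l] by (simp add: slice_def)

lemma modulus_unit: "invertible modulus"
proof -
  have "x = y" if "x * modulus = y * modulus" for x y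
  proof -
    have "\<mu> (S x * S h) = \<mu> (S y * S h)" for h
    proof -
      have *: "\<mu> (S x * S h) = \<mu> (h * (x * modulus))" for x
        unfolding modulus_left l_S[symmetric, of h]
        by (simp add: sw_mult_left linf_sw[OF \<mu>_linf] scale_mult_right mult.commute)
      show ?thesis using that by (simp add: *)
    qed
    then have "\<mu> (S x * h) = \<mu> (S y * h)" for h using S_Si[of h] by metis
    then show ?thesis using \<mu>_eqL S_eq_iff by blast
  qed
  then have "inj (\<lambda>x. x * modulus)" by (rule injI)
  then have "surj (\<lambda>x. x * modulus)" by (rule linear_inj_imp_surj[OF lin_mult_right])
  then obtain x where "x * modulus = 1" by (metis surjD)
  then show ?thesis by (rule invertibleI_left)
qed

text \<open>
  Both sides are \<open>\<mu>(l\<^sub>1 b) l\<^sub>2\<close>.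
\<close>
lemma T2_conj: "modulus * S (T2 b) = Si (nakayama b) * modulus"
proof -
  have ST2: "S (T2 b) = sw b (\<lambda>x y. modular x * S y)" by (simp add: T2_def sws S_mult)
  have "modulus * S (T2 b) = sw b (\<lambda>x y. (modulus * modular x) * S y)" by (simp add: ST2 sw_mult_left mult.assoc)
  also have "\<dots> = sw b (\<lambda>x y. sw x (\<lambda>u v. sw l (\<lambda>a c. \<mu> (a * u) *s (c * (v * S y)))))"
  proof (rule sw_cong)
    fix x y
    have "modulus * modular x = sw (l * modular x) (\<lambda>a c. \<mu> a *s c)"
      by (simp add: sw_Hs_right[OF bil_linf_left[OF \<mu>_linf] modular(1)] modulus_def slice_def sw_mult_right scale_mult_left)
    also have "\<dots> = sw (l * x) (\<lambda>a c. \<mu> a *s c)" by (simp only: modular(2))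
    also have "\<dots> = sw x (\<lambda>u v. sw l (\<lambda>a c. \<mu> (a * u) *s (c * v)))"
      by (subst mult_sw[OF bil_linf_left[OF \<mu>_linf]], rule sw_swap)
    finally show "modulus * modular x * S y = sw x (\<lambda>u v. sw l (\<lambda>a c. \<mu> (a * u) *s (c * (v * S y))))"
      by (simp add: sw_mult_right scale_mult_left mult.assoc)
  qed
  also have "\<dots> = sw b (\<lambda>u d. sw d (\<lambda>v y. sw l (\<lambda>a c. \<mu> (a * u) *s (c * (v * S y)))))"
    by (rule coassoc_sw) (simp add: lins3)
  also have "\<dots> = sw b (\<lambda>u d. sw l (\<lambda>a c. \<mu> (a * u) *s (c * et d)))"
    by (rule sw_cong, subst sw_swap) (simp only: sw_scale_out[symmetric] sw_mult_left[symmetric] antipode_right_sw)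
  also have "\<dots> = sw 1 (\<lambda>m n. sw l (\<lambda>a c. \<mu> (a * (m * b)) *s (c * n)))"
    by (rule sw_et_right) (simp add: lins3)
  also have "\<dots> = sw l (\<lambda>a c. sw 1 (\<lambda>m n. \<mu> (a * m * b) *s (c * n)))"
    by (subst sw_swap) (simp add: mult.assoc)
  also have "\<dots> = sw l (\<lambda>a c. \<mu> (a * b) *s c)"
    by (rule sw_one_mult(2)) (simp add: lins3)
  also have "\<dots> = Si (nakayama b) * modulus" by (simp add: modulus_left nakayama)
  finally show ?thesis .
qed

lemma T2_right_colinear: "right_colinear T2"
  unfolding right_colinear_def
proof (intro allI impI)
  fix F :: "'h \<Rightarrow> 'h \<Rightarrow> 'h" and b assume F: "bil F"
  note [simp] = bilD[OF F]
  have "sw (T2 b) F = sw b (\<lambda>x y. sw y (\<lambda>p q. F (p * Si (modular x)) q))"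
    unfolding T2_def sw_sw_arg[OF F] by (simp add: sw_Ht_right[OF F] modular)
  also have "\<dots> = sw b (\<lambda>c q. sw c (\<lambda>x p. F (p * Si (modular x)) q))"
    by (rule coassoc_sw[symmetric]) (simp add: lins3)
  also have "\<dots> = sw b (\<lambda>c q. F (T2 c) q)" by (rule sw_cong) (simp only: T2_def bil_sw1[OF F])
  finally show "sw (T2 b) F = sw b (\<lambda>p q. F (T2 p) q)" .
qed

text \<open>
  Colinearity is visible from the definition of \<open>T2\<close>; multiplicativity follows from \<open>T2_conj\<close>, which
  shows that \<open>T2\<close> is conjugate to \<open>S\<^sup>-\<^sup>2 \<nu>\<close>.
\<close>
lemma T2_algebra_aut: "algebra_aut T2"
proof -
  obtain g' where g': "modulus * g' = 1" "g' * modulus = 1" using modulus_unit unfolding invertible_def by blast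
  have T2: "T2 b = Si modulus * Si (Si (nakayama b)) * Si g'" for b
  proof -
    have "S (T2 b) = g' * (modulus * S (T2 b))" by (simp add: mult.assoc[symmetric] g')
    then have "S (T2 b) = g' * (Si (nakayama b) * modulus)" by (simp add: T2_conj)
    then have "T2 b = Si (g' * (Si (nakayama b) * modulus))" by (metis Si_S)
    then show ?thesis by (simp add: Si_mult mult.assoc)
  qed
  have gi: "Si modulus * Si g' = 1" "Si g' * Si modulus = 1" by (simp_all add: Si_mult[symmetric] g')
  have "T2 (x * y) = T2 x * T2 y" for x y
  proof -
    have "T2 x * T2 y = Si modulus * Si (Si (nakayama x)) * (Si g' * Si modulus) * Si (Si (nakayama y)) * Si g'" by (simp add: T2 mult.assoc)
    then show ?thesis by (simp add: gi T2 nakayama_mult Si_mult mult.assoc)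
  qed
  moreover have lin: "lin T2" unfolding T2
    by (rule linI) (simp_all add: linD[OF nakayama_lin] lins3)
  moreover have "inj T2"
  proof (rule injI)
    fix x y assume "T2 x = T2 y"
    then have "Si (nakayama x) * modulus = Si (nakayama y) * modulus" by (simp add: T2_conj[symmetric])
    then have "Si (nakayama x) = Si (nakayama y)" by (metis g'(1) mult.assoc mult_1_right)
    then have "nakayama x = nakayama y" by (metis S_Si)
    then show "x = y" using nakayama_bij by (simp add: bij_def inj_eq)
  qed
  moreover from this have "bij T2" using linear_inj_imp_surj[OF lin] by (simp add: bij_def)
  moreover have "T2 1 = 1" by (simp add: T2 nakayama_1 gi)
  ultimately show ?thesis by (simp add: algebra_aut_def)
qed

text \<open>
  The functional \<open>\<mu>(x\<^sub>1) f(x\<^sub>2)\<close> has the form \<open>\<mu>(w -)\<close>. Here \<open>w \<in> Hs\<close>, because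
  \<open>S(w) = l\<^sub>1 \<mu>(w l\<^sub>2) = l\<^sub>1 \<mu>(l\<^sub>2) f(l\<^sub>3)\<close> lies in \<open>Ht\<close> by \<open>mu_t_Ht\<close>.
\<close>
lemma modulus_slices: assumes f: "linf f" shows "\<exists>v\<in>Ht. slice f modulus = v * modulus"
proof -
  note [simp] = linfD[OF f]
  define m where "m c = sw c (\<lambda>a p. \<mu> a * f p)" for c
  have mk: "linf m" unfolding m_def by (rule sw_linf) (simp_all add: lins3)
  then obtain w where w: "\<And>x. m x = \<mu> (w * x)" using nondeg_left[OF \<mu>] by blast
  have "S w = sw l (\<lambda>a b. m b *s a)" using l_S[of w] by (simp add: w)
  also have "\<dots> = sw l (\<lambda>a b. sw b (\<lambda>p q. (\<mu> p * f q) *s a))" by (simp add: m_def sw_scale_left)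
  also have "\<dots> = sw l (\<lambda>c q. sw c (\<lambda>a p. (\<mu> p * f q) *s a))"
    by (rule coassoc_sw[symmetric]) (simp add: lins3)
  also have "\<dots> = sw l (\<lambda>c q. f q *s mu_t c)" by (simp add: mu_t_def rslice_def sw_scale_out mult.commute)
  also have "\<dots> \<in> Ht" by (rule sw_in_subspace[OF Ht_subspace]) (simp add: Ht_scale mu_t_Ht)
  finally have wHs: "w \<in> Hs" by (simp add: S_in_Ht)
  have "slice f modulus = sw l (\<lambda>a b. sw b (\<lambda>p q. (\<mu> a * f p) *s q))"
    unfolding modulus_def slice_def sw_sw_arg[OF bil_linf_left[OF f]] sw_scale[OF bil_linf_left[OF f]] by simp
  also have "\<dots> = sw l (\<lambda>c q. sw c (\<lambda>a p. (\<mu> a * f p) *s q))"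
    by (rule coassoc_sw[symmetric]) (simp add: lins3)
  also have "\<dots> = sw l (\<lambda>c q. \<mu> (w * c) *s q)" by (simp add: w[symmetric] m_def sw_scale_left)
  also have "\<dots> = Si w * modulus" by (simp add: modulus_left)
  finally show ?thesis using wHs by (intro bexI[of _ "Si w"]) simp_all
qed

text \<open>
  By \<open>modulus_slices\<close>, the second leg of \<open>\<Delta>(g)\<close> lies in \<open>Ht g\<close>. Inserting \<open>\<Delta>(1)\<close> in front, the elements
  of \<open>Ht\<close> move to the first leg and are collected in \<open>a\<close>.
\<close>
lemma modulus_comult:
  obtains a where "invertible a" "\<And>F :: 'h \<Rightarrow> 'h \<Rightarrow> 'h. bil F \<Longrightarrow> sw modulus F = sw 1 (\<lambda>p q. F (p * a) (q * modulus))"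
proof -
  obtain v where v: "\<And>k. v k \<in> Ht" "\<And>k. slice (cf k) modulus = v k * modulus" using modulus_slices[OF cf_linf] by metis
  define a where "a = (\<Sum>k\<in>bas. Si (v k) * k)"
  have sum2: "F p (\<Sum>k\<in>bas. g k) = (\<Sum>k\<in>bas. F p (g k))" if "bil F" for F :: "'h \<Rightarrow> 'h \<Rightarrow> 'h" and g p
    using bil_sum_left[of "\<lambda>x y. F y x"] bilD[OF that] by (simp add: balanced2_def)
  have *: "sw modulus F = sw 1 (\<lambda>p q. F (p * a) (q * modulus))" if F: "bil F" for F :: "'h \<Rightarrow> 'h \<Rightarrow> 'h"
  proof -
    note [simp] = bilD[OF F]
    have 1: "sw modulus G = (\<Sum>k\<in>bas. G k (v k * modulus))" if G: "bil G" for G :: "'h \<Rightarrow> 'h \<Rightarrow> 'h"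
    proof -
      have "sw modulus G = sw modulus (\<lambda>x y. \<Sum>k\<in>bas. G k (cf k x *s y))" by (rule sw_cong) (rule bil_expand_left[OF G])
      also have "\<dots> = (\<Sum>k\<in>bas. G k (slice (cf k) modulus))" unfolding sw_sum slice_def bil_sw2[OF G] ..
      finally show ?thesis by (simp add: v)
    qed
    have "sw modulus F = sw 1 (\<lambda>p q. sw modulus (\<lambda>x y. F (p * x) (q * y)))" by (rule sw_one_mult(1)[OF F, symmetric])
    also have "\<dots> = sw 1 (\<lambda>p q. \<Sum>k\<in>bas. F (p * k) (q * (v k * modulus)))"
      by (rule sw_cong, rule 1) (simp add: lins3)
    also have "\<dots> = (\<Sum>k\<in>bas. sw 1 (\<lambda>p q. F (p * k) (q * S (Si (v k)) * modulus)))" by (simp add: sw_sum mult.assoc)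
    also have "\<dots> = (\<Sum>k\<in>bas. sw 1 (\<lambda>p q. F (p * Si (v k) * k) (q * modulus)))"
      by (intro sum.cong HOL.refl sw_1_Hs_right[symmetric]) (simp_all add: lins3 v)
    also have "\<dots> = sw 1 (\<lambda>p q. F (p * a) (q * modulus))"
      by (simp add: a_def sum_distrib_left bil_sum_left[OF F] sw_sum[symmetric] mult.assoc)
    finally show ?thesis .
  qed
  have "modulus = sw modulus (\<lambda>p q. \<epsilon> q *s p)" by (simp add: counit_right_sw)
  also have "\<dots> = sw 1 (\<lambda>p q. \<epsilon> (q * modulus) *s p) * a"
    by (subst *) (simp_all add: lins sw_mult_right)
  finally have ga: "modulus = sw 1 (\<lambda>p q. \<epsilon> (q * modulus) *s p) * a" .
  obtain g' where "g' * modulus = 1" using modulus_unit unfolding invertible_def by blast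
  then have "(g' * sw 1 (\<lambda>p q. \<epsilon> (q * modulus) *s p)) * a = 1" using ga by (metis mult.assoc)
  then have "invertible a" by (rule invertibleI_left)
  then show thesis using * that by blast
qed

lemma tw_grouplike_S_modulus: "tw_grouplike (S modulus)"
proof -
  obtain a where a: "invertible a" "\<And>F :: 'h \<Rightarrow> 'h \<Rightarrow> 'h. bil F \<Longrightarrow> sw modulus F = sw 1 (\<lambda>p q. F (p * a) (q * modulus))"
    by (rule modulus_comult) blast
  have "sw (S modulus) F = sw 1 (\<lambda>p q. F (S modulus * p) (S a * q))" if F: "bil F" for F :: "'h \<Rightarrow> 'h \<Rightarrow> 'h"
  proof -
    note [simp] = bilD[OF F]
    have "sw (S modulus) F = sw modulus (\<lambda>p q. F (S q) (S p))" by (rule sw_S[OF F])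
    also have "\<dots> = sw 1 (\<lambda>p q. F (S (q * modulus)) (S (p * a)))" by (rule a(2)) (simp add: lins3)
    also have "\<dots> = sw 1 (\<lambda>p q. F (S modulus * S q) (S a * S p))" by (simp only: S_mult)
    also have "\<dots> = sw 1 (\<lambda>p q. F (S modulus * p) (S a * q))"
      by (rule sw_1_S[of "\<lambda>p q. F (S modulus * p) (S a * q)"]) (simp add: lins3)
    finally show ?thesis .
  qed
  then show ?thesis unfolding tw_grouplike_def using invertible_S[OF modulus_unit] invertible_S[OF a(1)] by blast
qed

lemma S4_T2:
  assumes g': "modulus * g' = 1"
  shows "S (S (S (S (T2 b)))) = S (S (S modulus)) * T1 b * S (S (S g'))"
proof -
  have g2: "g' * modulus = 1" using g' by (rule left_inverse_imp)
  have "S (T2 b) = g' * (modulus * S (T2 b))" by (simp add: mult.assoc[symmetric] g2)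
  then have "S (T2 b) = g' * (Si (nakayama b) * modulus)" by (simp add: T2_conj)
  then show ?thesis by (simp add: S_mult T1_def mult.assoc)
qed

end

text \<open>
  Combines \<open>g S(T\<^sub>2 b) = S\<^sup>-\<^sup>1(\<nu> b) g\<close> with \<open>T\<^sub>1 = S\<^sup>2 \<nu>\<close>.
\<close>
lemma (in fd_weak_hopf_algebra) radford:
  assumes \<theta>: "nondeg \<theta>"
  obtains T1 T2 G G' where "algebra_aut T1" "left_colinear T1" "algebra_aut T2" "right_colinear T2" "tw_grouplike G" "G * G' = 1" "G' * G = 1"
    "\<And>b. S (S (S (S (T2 b)))) = G * T1 b * G'"
proof -
  obtain l \<mu> where l: "l \<in> L" "nondeg \<mu>" "\<And>h. sw l (\<lambda>a b. \<mu> (h * b) *s a) = S h"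
    "\<And>l'. l' \<in> L \<Longrightarrow> \<exists>y\<in>Hs. l' = l * y" "\<And>y. y \<in> Hs \<Longrightarrow> l * y = 0 \<Longrightarrow> y = 0"
    by (rule nondegenerate_integral[OF \<theta>]) blast
  interpret integral_pair scale \<Delta> \<epsilon> S l \<mu> by unfold_locales (use l in auto)
  obtain g' where g': "modulus * g' = 1" "g' * modulus = 1" using modulus_unit unfolding invertible_def by blast
  have "S (S (S modulus)) * S (S (S g')) = 1" "S (S (S g')) * S (S (S modulus)) = 1"
    using g' by (simp_all add: S_mult[symmetric])
  then show thesis
    by (rule that[OF T1_algebra_aut T1_left_colinear T2_algebra_aut T2_right_colinear tw_grouplike_SS[OF tw_grouplike_S_modulus] _ _ S4_T2[OF g'(1)]])
qed

section \<open>Isomorphic members in sequences of semisimple submodules\<close>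

text \<open>
  Modules over an unspecified ring, given by the additive operators with which it acts on one
  finite-dimensional space.
\<close>
locale operators = finite_dimensional_vector_space scale Basis
  for scale :: "'k::field \<Rightarrow> 'b::ab_group_add \<Rightarrow> 'b" (infixr \<open>*s\<close> 75) and Basis :: "'b set" +
  fixes ops :: "('b \<Rightarrow> 'b) set"
  assumes ops_add: "f \<in> ops \<Longrightarrow> f (x + y) = f x + f y"
begin

definition submodule :: "'b set \<Rightarrow> bool" where
  "submodule X \<longleftrightarrow> subspace X \<and> (\<forall>f\<in>ops. \<forall>x\<in>X. f x \<in> X)"

definition plus_set :: "'b set \<Rightarrow> 'b set \<Rightarrow> 'b set" where "plus_set X Y = {x + y | x y. x \<in> X \<and> y \<in> Y}"

definition simple :: "'b set \<Rightarrow> bool" where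
  "simple X \<longleftrightarrow> submodule X \<and> X \<noteq> {0} \<and> (\<forall>Y. submodule Y \<longrightarrow> Y \<subseteq> X \<longrightarrow> Y = {0} \<or> Y = X)"

definition semisimple :: "'b set \<Rightarrow> bool" where
  "semisimple X \<longleftrightarrow> submodule X \<and> (\<forall>Y. submodule Y \<longrightarrow> Y \<subseteq> X \<longrightarrow> (\<exists>Z. submodule Z \<and> Z \<subseteq> X \<and> Y \<inter> Z = {0} \<and> X = plus_set Y Z))"

definition module_iso :: "'b set \<Rightarrow> 'b set \<Rightarrow> ('b \<Rightarrow> 'b) \<Rightarrow> bool" where
  "module_iso X Y u \<longleftrightarrow> bij_betw u X Y \<and> (\<forall>x\<in>X. \<forall>y\<in>X. u (x + y) = u x + u y) \<and> (\<forall>r. \<forall>x\<in>X. u (r *s x) = r *s u x) \<and>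
     (\<forall>f\<in>ops. \<forall>x\<in>X. u (f x) = f (u x))"

definition isomorphic :: "'b set \<Rightarrow> 'b set \<Rightarrow> bool" where "isomorphic X Y \<longleftrightarrow> (\<exists>u. module_iso X Y u)"

lemma submoduleD: assumes "submodule X" shows "subspace X" "0 \<in> X" "x \<in> X \<Longrightarrow> y \<in> X \<Longrightarrow> x + y \<in> X" "x \<in> X \<Longrightarrow> y \<in> X \<Longrightarrow> x - y \<in> X"
  "x \<in> X \<Longrightarrow> r *s x \<in> X" "f \<in> ops \<Longrightarrow> x \<in> X \<Longrightarrow> f x \<in> X"
  using assms unfolding submodule_def by (auto intro: subspace_0 subspace_add subspace_diff subspace_scale)

lemma ops_0: "f \<in> ops \<Longrightarrow> f 0 = 0" using ops_add[of f 0 0] by simp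

lemma submodule_zero: "submodule {0}" by (auto simp: submodule_def ops_0)
lemma submodule_inter: "submodule X \<Longrightarrow> submodule Y \<Longrightarrow> submodule (X \<inter> Y)" by (auto simp: submodule_def subspace_inter)
lemma submodule_plus: "submodule X \<Longrightarrow> submodule Y \<Longrightarrow> submodule (plus_set X Y)"
  unfolding submodule_def plus_set_def by (auto simp: ops_add intro!: subspace_sums) blast

lemma isomorphic_refl: "isomorphic X X" unfolding isomorphic_def module_iso_def by (rule exI[of _ id]) auto
lemma isomorphic_trans: assumes "isomorphic X Y" "isomorphic Y Z" shows "isomorphic X Z"
proof -
  obtain u v where u: "module_iso X Y u" and v: "module_iso Y Z v" using assms by (auto simp: isomorphic_def)
  have "u x \<in> Y" if "x \<in> X" for x using u that by (auto simp: module_iso_def bij_betw_def)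
  then have "module_iso X Z (v \<circ> u)" using u v by (auto simp: module_iso_def intro: bij_betw_trans)
  then show ?thesis by (auto simp: isomorphic_def)
qed
lemma isomorphic_sym: assumes X: "submodule X" and XY: "isomorphic X Y" shows "isomorphic Y X"
proof -
  obtain u where u: "module_iso X Y u" using XY by (auto simp: isomorphic_def)
  define v where "v = inv_into X u"
  have v: "v y \<in> X" "u (v y) = y" if "y \<in> Y" for y
    using u that by (auto simp: module_iso_def bij_betw_def v_def inv_into_into f_inv_into_f)
  have vu: "v (u x) = x" if "x \<in> X" for x using u that by (auto simp: module_iso_def bij_betw_def v_def)
  have "module_iso Y X v"
    unfolding module_iso_def
  proof (intro conjI ballI allI)
    show "bij_betw v Y X" using u by (auto simp: module_iso_def v_def intro: bij_betw_inv_into)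
    show "v (x + y) = v x + v y" if "x \<in> Y" "y \<in> Y" for x y
      using vu[of "v x + v y"] u v[OF that(1)] v[OF that(2)] submoduleD(3)[OF X] by (auto simp: module_iso_def)
    show "v (r *s x) = r *s v x" if "x \<in> Y" for x r
      using vu[of "r *s v x"] u v[OF that] submoduleD(5)[OF X] by (auto simp: module_iso_def)
    show "v (f x) = f (v x)" if "f \<in> ops" "x \<in> Y" for x f
      using vu[of "f (v x)"] u v[OF that(2)] submoduleD(6)[OF X] that by (auto simp: module_iso_def)
  qed
  then show ?thesis by (auto simp: isomorphic_def)
qed

lemma decomp_unique:
  assumes "submodule X" "submodule Y" "X \<inter> Y = {0}" "x \<in> X" "x' \<in> X" "y \<in> Y" "y' \<in> Y" "x + y = x' + y'"
  shows "x = x' \<and> y = y'"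
proof -
  have "x - x' = y' - y" using assms(8) by (simp add: algebra_simps)
  moreover have "x - x' \<in> X" "y' - y \<in> Y" using assms submoduleD(4) by blast+
  ultimately have "x - x' \<in> X \<inter> Y" by simp
  then have "x - x' = 0" using assms(3) by blast
  then show ?thesis using assms(8) by simp
qed

lemma projection:
  assumes XY: "submodule X" "submodule Y" "X \<inter> Y = {0}"
  obtains p where "\<And>x y. x \<in> X \<Longrightarrow> y \<in> Y \<Longrightarrow> p (x + y) = x"
proof
  fix x y assume x: "x \<in> X" and y: "y \<in> Y"
  define v where "v = x + y"
  have "x \<in> X \<and> v - x \<in> Y" using x y by (simp add: v_def)
  then have "(SOME a. a \<in> X \<and> v - a \<in> Y) \<in> X \<and> v - (SOME a. a \<in> X \<and> v - a \<in> Y) \<in> Y" by (rule someI)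
  then show "(\<lambda>v. SOME a. a \<in> X \<and> v - a \<in> Y) (x + y) = x"
    using decomp_unique[OF XY _ x _ y, of "SOME a. a \<in> X \<and> v - a \<in> Y" "v - (SOME a. a \<in> X \<and> v - a \<in> Y)"]
    by (simp add: v_def)
qed

lemma isomorphic_plus:
  assumes X: "submodule X" "submodule Y" "X \<inter> Y = {0}" and X': "submodule X'" "submodule Y'" "X' \<inter> Y' = {0}"
    and iX: "isomorphic X X'" and iY: "isomorphic Y Y'"
  shows "isomorphic (plus_set X Y) (plus_set X' Y')"
proof -
  obtain u v where u: "module_iso X X' u" and v: "module_iso Y Y' v" using iX iY by (auto simp: isomorphic_def)
  obtain p where p: "\<And>x y. x \<in> X \<Longrightarrow> y \<in> Y \<Longrightarrow> p (x + y) = x" by (rule projection[OF X]) blast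
  define w where "w a = u (p a) + v (a - p a)" for a
  have w: "w (x + y) = u x + v y" if "x \<in> X" "y \<in> Y" for x y using p[OF that] by (simp add: w_def)
  have uX: "u x \<in> X'" if "x \<in> X" for x using u that by (auto simp: module_iso_def bij_betw_def)
  have vY: "v x \<in> Y'" if "x \<in> Y" for x using v that by (auto simp: module_iso_def bij_betw_def)
  have "module_iso (plus_set X Y) (plus_set X' Y') w"
    unfolding module_iso_def
  proof (intro conjI ballI allI)
    show "bij_betw w (plus_set X Y) (plus_set X' Y')"
      unfolding bij_betw_def
    proof
      show "inj_on w (plus_set X Y)"
      proof (rule inj_onI)
        fix a b assume "a \<in> plus_set X Y" "b \<in> plus_set X Y" and ab: "w a = w b"
        then obtain x y x' y' where xy: "a = x + y" "x \<in> X" "y \<in> Y" "b = x' + y'" "x' \<in> X" "y' \<in> Y"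
          unfolding plus_set_def by blast
        then have "u x = u x' \<and> v y = v y'" using ab w uX vY by (intro decomp_unique[OF X']) auto
        then show "a = b" using xy u v by (auto simp: module_iso_def bij_betw_def inj_on_def)
      qed
      show "w ` plus_set X Y = plus_set X' Y'"
      proof
        show "w ` plus_set X Y \<subseteq> plus_set X' Y'" using w uX vY unfolding plus_set_def by force
        show "plus_set X' Y' \<subseteq> w ` plus_set X Y"
        proof
          fix a assume "a \<in> plus_set X' Y'"
          then obtain x' y' where "a = x' + y'" "x' \<in> X'" "y' \<in> Y'" unfolding plus_set_def by blast
          moreover have "X' = u ` X" "Y' = v ` Y" using u v by (auto simp: module_iso_def bij_betw_def)
          ultimately obtain x y where "a = u x + v y" "x \<in> X" "y \<in> Y" by blast
          then have "a = w (x + y)" "x + y \<in> plus_set X Y" using w unfolding plus_set_def by auto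
          then show "a \<in> w ` plus_set X Y" by blast
        qed
      qed
    qed
    fix a assume "a \<in> plus_set X Y"
    then obtain x y where a: "a = x + y" "x \<in> X" "y \<in> Y" unfolding plus_set_def by blast
    show "w (a + b) = w a + w b" if b: "b \<in> plus_set X Y" for b
    proof -
      obtain x' y' where b: "b = x' + y'" "x' \<in> X" "y' \<in> Y" using b unfolding plus_set_def by blast
      have "a + b = (x + x') + (y + y')" by (simp add: a b)
      then have "w (a + b) = u (x + x') + v (y + y')" using w submoduleD(3) X a b by metis
      then show ?thesis using u v a b by (simp add: module_iso_def w)
    qed
    show "w (r *s a) = r *s w a" for r
      using u v a w[of "r *s x" "r *s y"] X by (simp add: module_iso_def w scale_right_distrib submoduleD(5))
    show "w (f a) = f (w a)" if "f \<in> ops" for f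
      using u v a w[of "f x" "f y"] X that by (simp add: module_iso_def w ops_add submoduleD(6))
  qed
  then show ?thesis by (auto simp: isomorphic_def)
qed

text \<open>
  The projection of \<open>X\<close> to \<open>Y\<close> along \<open>A\<close> would otherwise be an isomorphism.
\<close>
lemma simple_noniso:
  assumes X: "simple X" and Y: "simple Y" and A: "submodule A" and AY: "A \<inter> Y = {0}" and XAY: "X \<subseteq> plus_set A Y"
    and n: "\<not> isomorphic X Y"
  shows "X \<subseteq> A"
proof (rule ccontr)
  assume nA: "\<not> X \<subseteq> A"
  have sX: "submodule X" and sY: "submodule Y" using X Y by (auto simp: simple_def)
  have "submodule (X \<inter> A)" "X \<inter> A \<subseteq> X" using submodule_inter[OF sX A] by auto
  then have XA: "X \<inter> A = {0}" using X nA unfolding simple_def by blast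
  have YA: "Y \<inter> A = {0}" using AY by blast
  obtain p where p: "\<And>y a. y \<in> Y \<Longrightarrow> a \<in> A \<Longrightarrow> p (y + a) = y" by (rule projection[OF sY A YA]) blast
  have dec: "\<exists>a y. x = y + a \<and> a \<in> A \<and> y \<in> Y \<and> p x = y" if x: "x \<in> X" for x
  proof -
    obtain a y where "x = a + y" "a \<in> A" "y \<in> Y" using x XAY unfolding plus_set_def by blast
    then show ?thesis using p[of y a] by (auto simp: add.commute)
  qed
  have padd: "p (x + x') = p x + p x'" if x: "x \<in> X" "x' \<in> X" for x x'
  proof -
    obtain a y a' y' where d: "x = y + a" "a \<in> A" "y \<in> Y" "p x = y" "x' = y' + a'" "a' \<in> A" "y' \<in> Y" "p x' = y'"
      using dec[OF x(1)] dec[OF x(2)] by blast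
    have "x + x' = (y + y') + (a + a')" by (simp add: d)
    then show ?thesis using p d submoduleD(3) sY A by metis
  qed
  have pscale: "p (r *s x) = r *s p x" if x: "x \<in> X" for x r
  proof -
    obtain a y where d: "x = y + a" "a \<in> A" "y \<in> Y" "p x = y" using dec[OF x] by blast
    then show ?thesis using p[of "r *s y" "r *s a"] submoduleD(5)[OF sY] submoduleD(5)[OF A] by (simp add: scale_right_distrib)
  qed
  have pops: "p (f x) = f (p x)" if x: "x \<in> X" and f: "f \<in> ops" for x f
  proof -
    obtain a y where d: "x = y + a" "a \<in> A" "y \<in> Y" "p x = y" using dec[OF x] by blast
    then show ?thesis using p[of "f y" "f a"] submoduleD(6)[OF sY f] submoduleD(6)[OF A f] by (simp add: ops_add f)
  qed
  have p0: "x = 0" if "x \<in> X" "p x = 0" for x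
  proof -
    have "x \<in> A" using dec[OF that(1)] that(2) by auto
    then show ?thesis using XA that by blast
  qed
  have inj: "inj_on p X"
  proof (rule inj_onI)
    fix x x' assume x: "x \<in> X" "x' \<in> X" "p x = p x'"
    have "p (x - x') + p x' = p x" using padd[of "x - x'" x'] submoduleD(4)[OF sX] x by simp
    then have "p (x - x') = 0" using x(3) by simp
    then have "x - x' = 0" using p0[OF submoduleD(4)[OF sX x(1,2)]] by simp
    then show "x = x'" by simp
  qed
  have "submodule (p ` X)"
    unfolding submodule_def subspace_def
  proof (intro conjI ballI allI)
    have "p 0 = 0" using pscale[OF submoduleD(2)[OF sX], of 0] by simp
    then show "0 \<in> p ` X" using submoduleD(2)[OF sX] by force
    show "u + v \<in> p ` X" if uv: "u \<in> p ` X" "v \<in> p ` X" for u v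
    proof -
      obtain x y where "x \<in> X" "y \<in> X" "u = p x" "v = p y" using uv by blast
      then show ?thesis using imageI[OF submoduleD(3)[OF sX], of x y p] by (simp add: padd)
    qed
    show "r *s u \<in> p ` X" if "u \<in> p ` X" for u r
      using that submoduleD(5)[OF sX] pscale by (auto intro!: image_eqI[where x="_ *s _"])
    show "f u \<in> p ` X" if "u \<in> p ` X" "f \<in> ops" for u f
      using that submoduleD(6)[OF sX that(2)] pops by (auto intro!: image_eqI[where x="f _"])
  qed
  moreover have "p ` X \<subseteq> Y" using dec by auto
  moreover have "p ` X \<noteq> {0}"
  proof
    assume "p ` X = {0}"
    then have "X \<subseteq> {0}" using p0 by blast
    then show False using X submoduleD(2)[OF sX] by (auto simp: simple_def)
  qed
  ultimately have "p ` X = Y" using Y unfolding simple_def by blast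
  then have "module_iso X Y p" using inj padd pscale pops by (auto simp: module_iso_def bij_betw_def)
  then show False using n by (auto simp: isomorphic_def)
qed

primrec psum :: "(nat \<Rightarrow> 'b set) \<Rightarrow> nat \<Rightarrow> 'b set" where
  "psum X 0 = {0}" | "psum X (Suc n) = plus_set (psum X n) (X n)"

lemma psum_submodule: "(\<And>n. simple (X n)) \<Longrightarrow> submodule (psum X n)"
  by (induction n) (auto simp: submodule_zero simple_def intro: submodule_plus)

lemma psum_inter:
  assumes X: "\<And>n. simple (X n)" and n: "\<And>m n. m \<noteq> n \<Longrightarrow> \<not> isomorphic (X m) (X n)"
  shows "psum X n \<inter> X n = {0}"
proof (induction n rule: less_induct)
  case (less n)
  have "\<not> X n \<subseteq> psum X k" if "k \<le> n" for k
    using that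
  proof (induction k)
    case 0
    have "X n \<noteq> {0}" "0 \<in> X n" using X[of n] submoduleD(2) by (auto simp: simple_def)
    then show ?case by auto
  next
    case (Suc k)
    then show ?case
      using simple_noniso[OF X X psum_submodule[of X k, OF X] less.IH[of k] _ n[of n k]] by auto
  qed
  then have "\<not> X n \<subseteq> psum X n" by simp
  moreover have "submodule (psum X n \<inter> X n)" using psum_submodule[of X n, OF X] X[of n] by (auto simp: simple_def intro: submodule_inter)
  ultimately show ?case using X[of n] unfolding simple_def by blast
qed

text \<open>
  Pairwise non-isomorphic simple submodules are independent, so there are at most \<open>dimension\<close> many of them.
\<close>
lemma dim_psum:
  assumes X: "\<And>n. simple (X n)" and n: "\<And>m n. m \<noteq> n \<Longrightarrow> \<not> isomorphic (X m) (X n)"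
  shows "n \<le> dim (psum X n)"
proof (induction n)
  case (Suc n)
  have s: "subspace (psum X n)" "subspace (X n)" using psum_submodule[of X n, OF X] X[of n] submoduleD(1) by (auto simp: simple_def)
  have "dim (psum X (Suc n)) + dim (psum X n \<inter> X n) = dim (psum X n) + dim (X n)"
    unfolding psum.simps plus_set_def by (rule dim_sums_Int[OF s])
  moreover have "dim (psum X n \<inter> X n) = 0" proof -
    have "psum X n \<inter> X n = {0}" by (rule psum_inter) (rule X, erule n)
    then show ?thesis by simp
  qed
  moreover have "dim (X n) \<noteq> 0" using X[of n] s(2) subspace_0[OF s(2)] by (auto simp: simple_def)
  ultimately show ?case using Suc by linarith
qed simp

text \<open>
  Only finitely many isomorphism types of simple submodules occur, hence one of them occurs infinitely often.
\<close>
lemma simple_classes: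
  assumes I: "infinite (I :: nat set)" and X: "\<And>i. i \<in> I \<Longrightarrow> simple (X i)"
  obtains J where "J \<subseteq> I" "infinite J" "\<And>i j. i \<in> J \<Longrightarrow> j \<in> J \<Longrightarrow> isomorphic (X i) (X j)"
proof -
  have sX: "submodule (X i)" if "i \<in> I" for i using X[OF that] by (simp add: simple_def)
  define f where "f i = (SOME j. j \<in> I \<and> isomorphic (X i) (X j))" for i
  have f: "f i \<in> I \<and> isomorphic (X i) (X (f i))" if "i \<in> I" for i
    unfolding f_def by (rule someI[of _ i]) (simp add: that isomorphic_refl)
  have f_eq: "f i = f j" if "isomorphic (X i) (X j)" "i \<in> I" "j \<in> I" for i j
  proof -
    have "(\<lambda>k. k \<in> I \<and> isomorphic (X i) (X k)) = (\<lambda>k. k \<in> I \<and> isomorphic (X j) (X k))"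
    proof (rule ext)
      fix k
      show "(k \<in> I \<and> isomorphic (X i) (X k)) = (k \<in> I \<and> isomorphic (X j) (X k))"
        using isomorphic_trans[OF that(1)] isomorphic_trans[OF isomorphic_sym[OF sX[OF that(2)] that(1)]] by blast
    qed
    then show ?thesis by (simp add: f_def)
  qed
  have "finite (f ` I)"
  proof (rule ccontr)
    assume "infinite (f ` I)"
    then obtain g :: "nat \<Rightarrow> nat" where g: "inj g" "range g \<subseteq> f ` I" using infinite_countable_subset by blast
    have gI: "g n \<in> I" and gf: "f (g n) = g n" for n
    proof -
      have "g n \<in> f ` I" using g(2) by blast
      then obtain i where i: "i \<in> I" "g n = f i" by blast
      show "g n \<in> I" using f[OF i(1)] i(2) by simp
      show "f (g n) = g n" using f_eq[of i "f i"] f[OF i(1)] i by simp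
    qed
    have n: "\<not> isomorphic (X (g m)) (X (g n))" if "m \<noteq> n" for m n
      using f_eq[OF _ gI gI, of m n] injD[OF g(1), of m n] that by (auto simp: gf)
    have "Suc dimension \<le> dim (psum (\<lambda>n. X (g n)) (Suc dimension))"
      by (rule dim_psum[of "\<lambda>n. X (g n)"]) (simp_all add: X gI n)
    then show False using dim_subset_UNIV[of "psum (\<lambda>n. X (g n)) (Suc dimension)"] by linarith
  qed
  from pigeonhole_infinite[OF I this] obtain i0 where i0: "i0 \<in> I" "infinite {a \<in> I. f a = f i0}" by blast
  show thesis
  proof (rule that[OF _ i0(2)])
    fix i j assume "i \<in> {a \<in> I. f a = f i0}" "j \<in> {a \<in> I. f a = f i0}"
    then have ij: "i \<in> I" "j \<in> I" "f i = f j" by simp_all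
    show "isomorphic (X i) (X j)"
      using isomorphic_trans[OF conjunct2[OF f[OF ij(1)]], unfolded ij(3), OF isomorphic_sym[OF sX[OF ij(2)] conjunct2[OF f[OF ij(2)]]]] .
  qed auto
qed

lemma exists_simple:
  assumes V: "submodule V" "V \<noteq> {0}" obtains X where "simple X" "X \<subseteq> V"
proof -
  define P where "P X \<longleftrightarrow> submodule X \<and> X \<subseteq> V \<and> X \<noteq> {0}" for X
  obtain X where X: "P X" and min: "\<And>Y. P Y \<Longrightarrow> dim X \<le> dim Y"
    using ex_has_least_nat[of P V dim] V by (auto simp: P_def)
  have "Y = {0} \<or> Y = X" if "submodule Y" "Y \<subseteq> X" for Y
  proof (rule disjCI)
    assume "Y \<noteq> X"
    show "Y = {0}"
    proof (rule ccontr)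
      assume "Y \<noteq> {0}"
      then have "P Y" using that X by (auto simp: P_def)
      then have "Y = X" using subspace_dim_equal[OF submoduleD(1)[OF that(1)] _ that(2) min] X submoduleD(1) by (auto simp: P_def)
      then show False using \<open>Y \<noteq> X\<close> by simp
    qed
  qed
  then show thesis using that[of X] X by (auto simp: simple_def P_def)
qed

lemma semisimple_submodule:
  assumes V: "semisimple V" and W: "submodule W" "W \<subseteq> V" shows "semisimple W"
  unfolding semisimple_def
proof (intro conjI allI impI W(1))
  fix Y assume Y: "submodule Y" "Y \<subseteq> W"
  then obtain Z where Z: "submodule Z" "Y \<inter> Z = {0}" "V = plus_set Y Z" using V W unfolding semisimple_def by (meson order_trans)
  show "\<exists>Z. submodule Z \<and> Z \<subseteq> W \<and> Y \<inter> Z = {0} \<and> W = plus_set Y Z"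
  proof (intro exI[of _ "Z \<inter> W"] conjI)
    show "submodule (Z \<inter> W)" by (rule submodule_inter[OF Z(1) W(1)])
    show "Y \<inter> (Z \<inter> W) = {0}" using Z(2) submoduleD(2)[OF W(1)] by blast
    show "W = plus_set Y (Z \<inter> W)"
    proof
      show "plus_set Y (Z \<inter> W) \<subseteq> W" using Y submoduleD(3)[OF W(1)] unfolding plus_set_def by blast
      show "W \<subseteq> plus_set Y (Z \<inter> W)"
      proof
        fix w assume w: "w \<in> W"
        then obtain y z where yz: "w = y + z" "y \<in> Y" "z \<in> Z" using Z(3) W(2) unfolding plus_set_def by blast
        then have "z = w - y" by simp
        then have "z \<in> W" using w yz Y submoduleD(4)[OF W(1)] by blast
        then show "w \<in> plus_set Y (Z \<inter> W)" using yz unfolding plus_set_def by blast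
      qed
    qed
  qed simp
qed

text \<open>
  Induction on the dimension: split a simple submodule off each member, pass to a subsequence in
  which these are isomorphic, and apply the induction hypothesis to the complements.
\<close>
lemma semisimple_classes:
  assumes "infinite (I :: nat set)" "\<And>i. i \<in> I \<Longrightarrow> semisimple (V i)" "\<And>i. i \<in> I \<Longrightarrow> dim (V i) \<le> d"
  shows "\<exists>J. J \<subseteq> I \<and> infinite J \<and> (\<forall>i\<in>J. \<forall>j\<in>J. isomorphic (V i) (V j))"
  using assms
proof (induction d arbitrary: I V rule: less_induct)
  case (less d)
  define I0 where "I0 = {i \<in> I. V i = {0}}"
  show ?case
  proof (cases "infinite I0")
    case True then show ?thesis by (intro exI[of _ I0]) (auto simp: I0_def isomorphic_refl)
  next
    case False
    define I1 where "I1 = I - I0"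
    have I1: "infinite I1" using less.prems(1) False by (simp add: I1_def)
    have V: "semisimple (V i)" "V i \<noteq> {0}" "submodule (V i)" "dim (V i) \<le> d" if "i \<in> I1" for i
      using that less.prems by (auto simp: I1_def I0_def semisimple_def)
    have "\<exists>X. simple X \<and> X \<subseteq> V i" if "i \<in> I1" for i using exists_simple[OF V(3,2)[OF that]] by blast
    then obtain X where X: "\<And>i. i \<in> I1 \<Longrightarrow> simple (X i)" "\<And>i. i \<in> I1 \<Longrightarrow> X i \<subseteq> V i" by metis
    have "\<exists>Z. submodule Z \<and> Z \<subseteq> V i \<and> X i \<inter> Z = {0} \<and> V i = plus_set (X i) Z" if "i \<in> I1" for i
      using V(1)[OF that] X[OF that] unfolding semisimple_def simple_def by blast
    then obtain Z where Z: "\<And>i. i \<in> I1 \<Longrightarrow> submodule (Z i)" "\<And>i. i \<in> I1 \<Longrightarrow> Z i \<subseteq> V i"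
      "\<And>i. i \<in> I1 \<Longrightarrow> X i \<inter> Z i = {0}" "\<And>i. i \<in> I1 \<Longrightarrow> V i = plus_set (X i) (Z i)" by metis
    have sX: "submodule (X i)" if "i \<in> I1" for i using X(1)[OF that] by (simp add: simple_def)
    obtain J where J: "J \<subseteq> I1" "infinite J" "\<And>i j. i \<in> J \<Longrightarrow> j \<in> J \<Longrightarrow> isomorphic (X i) (X j)"
      by (rule simple_classes[OF I1 X(1)]) blast+
    have dimZ: "dim (Z i) < d" if i: "i \<in> I1" for i
    proof -
      have "\<not> X i \<subseteq> Z i" using Z(3)[OF i] X(1)[OF i] unfolding simple_def by blast
      then have "Z i \<subset> V i" using X(2)[OF i] Z(2)[OF i] by blast
      then have "span (Z i) \<subset> span (V i)" using submoduleD(1)[OF Z(1)[OF i]] submoduleD(1)[OF V(3)[OF i]]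
        by (simp only: span_eq_iff[THEN iffD2])
      from dim_psubset[OF this] V(4)[OF i] show ?thesis by (rule less_le_trans)
    qed
    obtain i0 where "i0 \<in> J" using infinite_imp_nonempty[OF J(2)] by blast
    then have d0: "d - 1 < d" using dimZ J(1) by fastforce
    have "\<exists>K. K \<subseteq> J \<and> infinite K \<and> (\<forall>i\<in>K. \<forall>j\<in>K. isomorphic (Z i) (Z j))"
    proof (rule less.IH[OF d0 J(2)])
      fix i assume "i \<in> J"
      then have i: "i \<in> I1" using J(1) by blast
      show "semisimple (Z i)" by (rule semisimple_submodule[OF V(1)[OF i] Z(1)[OF i] Z(2)[OF i]])
      show "dim (Z i) \<le> d - 1" using dimZ[OF i] by simp
    qed
    then obtain K where K: "K \<subseteq> J" "infinite K" "\<And>i j. i \<in> K \<Longrightarrow> j \<in> K \<Longrightarrow> isomorphic (Z i) (Z j)" by blast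
    show ?thesis
    proof (intro exI[of _ K] conjI ballI K(2))
      show "K \<subseteq> I" using K(1) J(1) by (auto simp: I1_def)
      fix i j assume ij: "i \<in> K" "j \<in> K"
      then have i: "i \<in> I1" "j \<in> I1" "i \<in> J" "j \<in> J" using K(1) J(1) by auto
      show "isomorphic (V i) (V j)"
        unfolding Z(4)[OF i(1)] Z(4)[OF i(2)]
        by (rule isomorphic_plus[OF sX[OF i(1)] Z(1)[OF i(1)] Z(3)[OF i(1)] sX[OF i(2)] Z(1)[OF i(2)] Z(3)[OF i(2)]
              J(3)[OF i(3,4)] K(3)[OF ij]])
    qed
  qed
qed

lemma isomorphic_pair:
  assumes V: "\<And>i :: nat. semisimple (V i)"
  obtains i j where "i < j" "isomorphic (V i) (V j)"
proof -
  obtain J where J: "infinite J" "\<And>i j. i \<in> J \<Longrightarrow> j \<in> J \<Longrightarrow> isomorphic (V i) (V j)"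
    using semisimple_classes[of UNIV V dimension] V dim_subset_UNIV by auto
  obtain i where i: "i \<in> J" using infinite_imp_nonempty[OF J(1)] by blast
  have "\<not> J \<subseteq> {..i}" using J(1) finite_subset by blast
  then obtain j where "j \<in> J" "i < j" using not_le by blast
  then show thesis using that J(2) i by blast
qed

text \<open>
  For an injective parametrisation \<open>g\<close> of a submodule by \<open>U\<close>, complements can be looked for inside \<open>U\<close>.
\<close>
lemma semisimple_image:
  assumes g: "\<And>p q. g (p + q) = g p + g q" and inj: "\<And>p q. p \<in> U \<Longrightarrow> q \<in> U \<Longrightarrow> g p = g q \<Longrightarrow> p = q"
    and scale: "\<And>r p. g (r *s p) = r *s g p" and U: "subspace U" and gU: "submodule (g ` U)"
    and compl: "\<And>J. subspace J \<Longrightarrow> J \<subseteq> U \<Longrightarrow> submodule (g ` J) \<Longrightarrow>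
      \<exists>K. K \<subseteq> U \<and> submodule (g ` K) \<and> J \<inter> K \<subseteq> {0} \<and> U \<subseteq> plus_set J K"
  shows "semisimple (g ` U)"
  unfolding semisimple_def
proof (intro conjI allI impI gU)
  fix Y assume Y: "submodule Y" "Y \<subseteq> g ` U"
  define J where "J = {p \<in> U. g p \<in> Y}"
  have g0: "g 0 = 0" using scale[of 0 0] by simp
  have "subspace J"
    unfolding subspace_def J_def
    using submoduleD[OF Y(1)] U by (auto simp: g scale g0 subspace_0 subspace_add subspace_scale)
  moreover have gJ: "g ` J = Y" using Y(2) by (auto simp: J_def)
  ultimately obtain K where K: "K \<subseteq> U" "submodule (g ` K)" "J \<inter> K \<subseteq> {0}" "U \<subseteq> plus_set J K"
    using compl[of J] Y(1) by (auto simp: J_def)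
  have "v = 0" if v: "v \<in> Y" "v \<in> g ` K" for v
  proof -
    obtain p where p: "p \<in> K" "v = g p" using v(2) by blast
    then have "p \<in> J" using v(1) K(1) by (auto simp: J_def)
    then show ?thesis using p K(3) g0 by blast
  qed
  then have "Y \<inter> g ` K = {0}" using submoduleD(2)[OF Y(1)] submoduleD(2)[OF K(2)] by blast
  moreover have "g ` U = plus_set Y (g ` K)"
  proof
    have "g ` K \<subseteq> g ` U" using K(1) by blast
    then show "plus_set Y (g ` K) \<subseteq> g ` U" using Y(2) submoduleD(3)[OF gU] unfolding plus_set_def by blast
    show "g ` U \<subseteq> plus_set Y (g ` K)"
    proof
      fix v assume "v \<in> g ` U"
      then obtain p where p: "p \<in> U" "v = g p" by blast
      then obtain a b where "p = a + b" "a \<in> J" "b \<in> K" using K(4) unfolding plus_set_def by blast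
      then have "v = g a + g b" "g a \<in> Y" "g b \<in> g ` K" using p(2) gJ by (auto simp: g)
      then show "v \<in> plus_set Y (g ` K)" unfolding plus_set_def by blast
    qed
  qed
  ultimately show "\<exists>Z. submodule Z \<and> Z \<subseteq> g ` U \<and> Y \<inter> Z = {0} \<and> g ` U = plus_set Y Z"
    using K(1,2) by blast
qed

text \<open>
  The form in which \<open>isomorphic_pair\<close> is applied: the isomorphism is transported to a self-map \<open>T\<close> of
  the parameter space.
\<close>
lemma isomorphic_image_pair:
  assumes ss: "\<And>i :: nat. semisimple (g i ` U)"
  obtains i j u T where "i < j" "module_iso (g i ` U) (g j ` U) u" "\<And>p. p \<in> U \<Longrightarrow> T p \<in> U"
    "\<And>p. p \<in> U \<Longrightarrow> g j (T p) = u (g i p)" "\<And>q. q \<in> U \<Longrightarrow> \<exists>p\<in>U. g j q = u (g i p)"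
proof -
  obtain i j where ij: "i < j" "isomorphic (g i ` U) (g j ` U)" by (rule isomorphic_pair[OF ss])
  then obtain u where u: "module_iso (g i ` U) (g j ` U) u" by (auto simp: isomorphic_def)
  then have im: "u ` g i ` U = g j ` U" by (simp add: module_iso_def bij_betw_def)
  have "\<exists>q\<in>U. g j q = u (g i p)" if "p \<in> U" for p
  proof -
    have "u (g i p) \<in> g j ` U" using im that by blast
    then show ?thesis by (elim imageE) (rule bexI, rule HOL.sym)
  qed
  then obtain T where T: "\<And>p. p \<in> U \<Longrightarrow> T p \<in> U" "\<And>p. p \<in> U \<Longrightarrow> g j (T p) = u (g i p)" by metis
  have "\<exists>p\<in>U. g j q = u (g i p)" if "q \<in> U" for q
  proof -
    have "g j q \<in> u ` g i ` U" using im that by blast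
    then show ?thesis by (elim imageE) blast
  qed
  then show thesis using that[OF ij(1) u T] by blast
qed

end

section \<open>Powers that become inner or factor through the bases\<close>
context fd_weak_hopf_algebra
begin

lemma algebra_aut_funpow: "algebra_aut T \<Longrightarrow> algebra_aut (T ^^ i)"
proof (induction i)
  case 0
  have "lin (\<lambda>x. x)" "bij (\<lambda>x::'h. x)" using bij_id by (auto intro: linI simp: id_def)
  then show ?case by (simp add: algebra_aut_def id_def)
next
  case (Suc i)
  then have a: "algebra_aut (T ^^ i)" by simp
  have "lin (T \<circ> (T ^^ i))" unfolding o_def
    by (rule lin_comp) (use Suc.prems a in \<open>simp_all add: algebra_aut_def\<close>)
  moreover have "bij (T \<circ> (T ^^ i))" by (rule bij_comp) (use Suc.prems a in \<open>simp_all add: algebra_aut_def\<close>)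
  ultimately have "lin (\<lambda>x. T ((T ^^ i) x))" "bij (\<lambda>x. T ((T ^^ i) x))" by (simp_all only: o_def)
  then show ?case using Suc.prems a by (simp add: algebra_aut_def o_def)
qed

lemma left_colinear_funpow: assumes T: "algebra_aut T" "left_colinear T" shows "left_colinear (T ^^ i)"
proof (induction i)
  case 0 show ?case by (simp add: left_colinear_def)
next
  case (Suc i)
  note [simp] = linD[of T] 
  have lT: "lin T" using T by (simp add: algebra_aut_def)
  show ?case
    unfolding left_colinear_def
  proof (intro allI impI)
    fix F :: "'h \<Rightarrow> 'h \<Rightarrow> 'h" and x assume F: "bil F"
    have "bil (\<lambda>p q. F p (T q))" by (simp add: balanced2_def bilD[OF F] linD[OF lT])
    then show "sw ((T ^^ Suc i) x) F = sw x (\<lambda>p q. F p ((T ^^ Suc i) q))"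
      using T(2) Suc F by (simp add: left_colinear_def)
  qed
qed

lemma left_colinear_Hs: assumes T: "lin T" "left_colinear T" and y: "y \<in> Hs" shows "T y \<in> Hs"
proof -
  note [simp] = linD[OF T(1)]
  have "T y = sw (T y) (\<lambda>p q. \<epsilon> q *s p)" by (simp add: counit_right_sw)
  also have "\<dots> = sw (y * 1) (\<lambda>p q. \<epsilon> (T q) *s p)" using T(2) by (simp add: left_colinear_def lins)
  also have "\<dots> = sw 1 (\<lambda>p q. \<epsilon> (T (y * q)) *s p)" by (rule sw_Hs_left) (simp_all add: y lins)
  also have "\<dots> \<in> Hs" by (rule sw_1_in_Hs, rule linfI) (simp_all add: lins)
  finally show ?thesis .
qed

lemma es_Ht_Hs: assumes "z \<in> Ht" "y \<in> Hs" shows "es (y * z) = S z * y"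
  using es_Hs[OF assms(2), of z] by (simp add: Ht_Hs_commute[OF assms, symmetric] S_Ht assms(1))

text \<open>
  For each \<open>i\<close>, the functionals \<open>x \<mapsto> \<epsilon>(p T\<^sup>i(x))\<close> with \<open>p \<in> Hs\<close> form a right \<open>H\<close>-submodule of the dual of \<open>H\<close>, which the
  Frobenius form embeds into \<open>H\<close>. These modules are semisimple copies of \<open>Hs\<close> with action
  \<open>p \<cdot> h = \<epsilon>\<^sub>s(p T\<^sup>i(h))\<close>. An isomorphism between the \<open>i\<close>-th and the \<open>j\<close>-th one is a map \<open>U\<close> on \<open>Hs\<close> with
  \<open>U(\<epsilon>\<^sub>s(p h)) = \<epsilon>\<^sub>s(U(p) T\<^sup>n(h))\<close>; colinearity of \<open>T\<close> then forces \<open>p T\<^sup>n(h) = h p\<close> for \<open>p = U(1)\<close>.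
\<close>
lemma left_colinear_power_inner:
  assumes \<theta>: "nondeg \<theta>" and T: "algebra_aut T" and Tc: "left_colinear T"
  obtains n x x' where "n \<ge> 1" "x \<in> Hs" "x' \<in> Hs" "x * x' = 1" "x' * x = 1" "\<And>h. (T ^^ n) h = x * h * x'"
proof -
  interpret op: operators scale bas "range (\<lambda>h w. w * h)"
    by unfold_locales (auto simp: distrib_right)
  interpret pp: finite_dimensional_vector_space_pair scale bas scale bas by unfold_locales
  have Ti: "lin (T ^^ i)" "(T ^^ i) (x * y) = (T ^^ i) x * (T ^^ i) y" "\<exists>h. (T ^^ i) h = x" for i x y
    using algebra_aut_funpow[OF T, of i] by (auto simp: algebra_aut_def bij_def surj_def) metis
  note [simp] = linD[OF Ti(1)]
  have "\<exists>w. \<forall>x. \<epsilon> (p * (T ^^ i) x) = \<theta> (w * x)" for p i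
    by (rule nondeg_left[OF \<theta>], rule linfI) (simp_all add: lins)
  note W_ex = this
  (* W i p represents the functional eps(p T^i(-)) by means of theta. *)
  define W where "W i p = (SOME w. \<forall>x. \<epsilon> (p * (T ^^ i) x) = \<theta> (w * x))" for i p
  have W: "\<theta> (W i p * x) = \<epsilon> (p * (T ^^ i) x)" for i p x
    unfolding W_def by (rule someI_ex[OF W_ex, rule_format, symmetric])
  have \<theta>_linf: "linf \<theta>" using \<theta> by (simp add: nondeg_def)
  note [simp] = linfD[OF \<theta>_linf]
  have \<theta>eq: "x = y" if "\<And>h. \<theta> (x * h) = \<theta> (y * h)" for x y
  proof -
    have "\<theta> ((x - y) * h) = 0" for h using that by (simp add: left_diff_distrib)
    then have "x - y = 0" using \<theta> unfolding nondeg_def by blast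
    then show ?thesis by simp
  qed
  have W_lin: "lin (W i)" for i by (rule linI; rule \<theta>eq) (simp_all add: W lins)
  note [simp] = linD[OF W_lin]
  have W_inj0: "p = 0" if "p \<in> Hs" "W i p = 0" for i p
  proof (rule Hs_nondeg_right[OF that(1)])
    fix a obtain h where "(T ^^ i) h = a" using Ti(3) by blast
    then show "\<epsilon> (p * a) = 0" using W[of i p h] that(2) by simp
  qed
  have W_inj: "p = q" if "p \<in> Hs" "q \<in> Hs" "W i p = W i q" for i p q
    using W_inj0[of "p - q" i] that subspace_diff[OF Hs_subspace] by simp
  have W_mult: "W i p * h = W i (es (p * (T ^^ i) h))" for i p h
  proof (rule \<theta>eq)
    fix x
    have "\<theta> (W i p * h * x) = \<epsilon> (p * (T ^^ i) (h * x))" by (simp only: mult.assoc W)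
    also have "\<dots> = \<epsilon> (p * (T ^^ i) h * (T ^^ i) x)" by (simp only: Ti(2) mult.assoc)
    finally show "\<theta> (W i p * h * x) = \<theta> (W i (es (p * (T ^^ i) h)) * x)" by (simp only: W \<epsilon>_es)
  qed
  have subI: "op.submodule (W i ` J)" if J: "subspace J" and Jc: "\<And>p h. p \<in> J \<Longrightarrow> es (p * h) \<in> J" for i J
    unfolding op.submodule_def using pp.linear_subspace_image[OF W_lin J] Jc by (auto simp: W_mult)
  have V: "op.semisimple (W i ` Hs)" for i
  proof (rule op.semisimple_image)
    show "op.submodule (W i ` Hs)" by (rule subI[OF Hs_subspace]) simp
    fix J assume J: "subspace J" "J \<subseteq> Hs" "op.submodule (W i ` J)"
    have J2: "es (p * h) \<in> J" if p: "p \<in> J" for p h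
    proof -
      obtain h' where h': "(T ^^ i) h' = h" using Ti(3) by blast
      have "W i p * h' \<in> W i ` J" using op.submoduleD(6)[OF J(3), of "\<lambda>w. w * h'" "W i p"] p by simp
      then obtain q where q: "q \<in> J" "W i (es (p * h)) = W i q" by (auto simp: W_mult h')
      then have "es (p * h) = q" using J(2) by (intro W_inj[of "es (p * h)" q i]) auto
      then show ?thesis using q by simp
    qed
    (* J is stable under the action, hence a two-sided ideal of Hs: acting with elements of Hs gives
       right multiplication, acting with z in Ht gives left multiplication by S z. *)
    obtain e where e: "e \<in> J" "e \<in> Hs" "\<And>x. x \<in> J \<Longrightarrow> e * x = x" "\<And>x. x \<in> J \<Longrightarrow> x * e = x"
      "\<And>y. y \<in> Hs \<Longrightarrow> e * y = y * e" "e * e = e" "S (S e) = e"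
    proof (rule Hs_ideal[OF J(1,2)])
      fix e assume *: "e \<in> J" "e \<in> Hs" "\<And>x. x \<in> J \<Longrightarrow> e * x = x" "\<And>x. x \<in> J \<Longrightarrow> x * e = x"
        "\<And>y. y \<in> Hs \<Longrightarrow> e * y = y * e" "e * e = e" "S (S e) = e"
      show thesis by (rule that[OF *])
    next
      show "x * y \<in> J" if "x \<in> J" "y \<in> Hs" for x y
      proof -
        have "es (x * y) = x * y" using that J(2) Hs_mult[of x y] by (auto simp: Hs_iff)
        then show ?thesis using J2[OF that(1), of y] by simp
      qed
      show "y * x \<in> J" if xy: "x \<in> J" "y \<in> Hs" for x y
      proof -
        obtain z where z: "z \<in> Ht" "S z = y" using xy(2) by (rule Hs_S_image)
        have "x \<in> Hs" using xy J(2) by blast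
        then show ?thesis using J2[OF xy(1), of z] z by (simp add: es_Ht_Hs)
      qed
    qed
    (* Stability of J = e Hs is a statement about eps(e x e); the corner lemma converts it into the one
       that is needed for stability of the complement (1 - e) Hs. *)
    have c1: "\<epsilon> (e * x * e) = \<epsilon> (e * x)" for x
    proof -
      have "es (e * x * e) = es (e * x)" using e(4)[OF J2[OF e(1)]] es_Hs[OF e(2)] by simp
      then show ?thesis by (metis \<epsilon>_es mult_1_right)
    qed
    have c2: "\<epsilon> (e * x * e) = \<epsilon> (x * e)" for x by (rule \<epsilon>_corner[OF e(2,7) c1])
    have c3: "e * es (p * h) = 0" if p: "p \<in> Hs" "e * p = 0" for p h
    proof (rule Hs_nondeg_right)
      show "e * es (p * h) \<in> Hs" using e(2) by (simp add: Hs_mult)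
      fix a assume a: "a \<in> Hs"
      have "\<epsilon> (e * es (p * h) * a) = \<epsilon> (es (p * h * e) * a)" by (simp add: e(5) es_Hs e(2))
      also have "\<dots> = \<epsilon> (p * h * e * a)" by (simp add: \<epsilon>_es)
      also have "\<dots> = \<epsilon> ((p * h * a) * e)" using e(5)[OF a] by (simp add: mult.assoc)
      also have "\<dots> = \<epsilon> (e * (p * h * a) * e)" by (rule c2[symmetric])
      also have "\<dots> = 0" using p(2) by (simp flip: mult.assoc)
      finally show "\<epsilon> (e * es (p * h) * a) = 0" .
    qed
    define K where "K = {p \<in> Hs. e * p = 0}"
    have "subspace K" using Hs_subspace by (auto simp: subspace_def K_def distrib_left scale_mult_right)
    then have "op.submodule (W i ` K)" by (rule subI) (use c3 in \<open>simp add: K_def\<close>)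
    moreover have "K \<subseteq> Hs" by (auto simp: K_def)
    moreover have "J \<inter> K \<subseteq> {0}" using e(3) by (auto simp: K_def)
    moreover have "Hs \<subseteq> op.plus_set J K"
    proof
      fix p assume p: "p \<in> Hs"
      have ep: "e * p \<in> Hs" using e p by (simp add: Hs_mult)
      then have "e * p \<in> J" using J2[OF e(1), of p] by (simp add: Hs_iff)
      moreover have "p - e * p \<in> K"
        using p ep Hs_subspace e(6) by (simp add: K_def subspace_diff right_diff_distrib flip: mult.assoc)
      moreover have "p = e * p + (p - e * p)" by simp
      ultimately show "p \<in> op.plus_set J K" unfolding op.plus_set_def by blast
    qed
    ultimately show "\<exists>K. K \<subseteq> Hs \<and> op.submodule (W i ` K) \<and> J \<inter> K \<subseteq> {0} \<and> Hs \<subseteq> op.plus_set J K"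
      by blast
  qed (simp_all add: Hs_subspace W_inj)
  obtain i j u U where ij: "i < j" and u: "op.module_iso (W i ` Hs) (W j ` Hs) u" and U: "\<And>p. p \<in> Hs \<Longrightarrow> U p \<in> Hs"
    "\<And>p. p \<in> Hs \<Longrightarrow> W j (U p) = u (W i p)" and surj: "\<And>q. q \<in> Hs \<Longrightarrow> \<exists>p\<in>Hs. W j q = u (W i p)"
    by (rule op.isomorphic_image_pair[of W Hs, OF V], rule that)
  define n where "n = j - i"
  have n: "(T ^^ j) x = (T ^^ n) ((T ^^ i) x)" for x
    using ij funpow_add[of n i T] by (simp add: n_def)
  have U_es: "U (es (p * h)) = es (U p * (T ^^ n) h)" if p: "p \<in> Hs" for p h
  proof (rule W_inj[of _ _ j])
    obtain h' where h': "(T ^^ i) h' = h" using Ti(3) by blast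
    have "W j (U (es (p * h))) = u (W i p * h')" by (simp add: U W_mult h')
    also have "\<dots> = u (W i p) * h'" using u p by (auto simp: op.module_iso_def)
    also have "\<dots> = W j (es (U p * (T ^^ n) h))" by (simp add: U(2)[symmetric] p W_mult n h')
    finally show "W j (U (es (p * h))) = W j (es (U p * (T ^^ n) h))" .
  qed (simp_all add: U)
  define p where "p = U 1"
  have pHs: "p \<in> Hs" by (simp add: p_def U)
  have coT: "left_colinear (T ^^ n)" by (rule left_colinear_funpow[OF T Tc])
  have Ues: "U (es h) = es (p * (T ^^ n) h)" for h using U_es[of 1 h] by (simp add: p_def)
  have U_Hs: "U y = p * (T ^^ n) y" if "y \<in> Hs" for y
    using Ues[of y] that Hs_mult[OF pHs left_colinear_Hs[OF Ti(1) coT that]] by (simp add: Hs_iff)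
  have key: "\<epsilon> (p * (T ^^ n) (es h)) = \<epsilon> (p * (T ^^ n) h)" for h
    using U_Hs[of "es h"] Ues[of h] \<epsilon>_es[of "p * (T ^^ n) h" 1] by simp
  have "\<exists>y\<in>Hs. U y = 1"
  proof -
    obtain y where y: "y \<in> Hs" "W j 1 = u (W i y)" using surj[OF one_in_Hs] by blast
    then have "U y = 1" by (intro W_inj[of "U y" 1 j]) (simp_all add: U)
    then show ?thesis using y by blast
  qed
  then obtain y where y: "y \<in> Hs" "U y = 1" by blast
  define p' where "p' = (T ^^ n) y"
  have p'Hs: "p' \<in> Hs" unfolding p'_def by (rule left_colinear_Hs[OF Ti(1) coT y(1)])
  have pp': "p * p' = 1" using U_Hs[OF y(1)] y by (simp add: p'_def)
  then have p'p: "p' * p = 1" by (rule left_inverse_imp)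
  (* Compute p T^n(h) by its coproduct. By the identity key its second leg enters only through es,
     and h1 (x) es(h2) = h 1_1 (x) S(1_2) pulls h out to the left. *)
  define q where "q = sw 1 (\<lambda>a b. \<epsilon> (p * (T ^^ n) (S b)) *s a)"
  have Tq: "p * (T ^^ n) h = h * q" for h
  proof -
    have "p * (T ^^ n) h = sw (p * (T ^^ n) h) (\<lambda>a b. \<epsilon> b *s a)" by (simp add: counit_right_sw)
    also have "\<dots> = sw ((T ^^ n) h) (\<lambda>a b. \<epsilon> (p * b) *s a)" by (rule sw_Hs_left) (simp_all add: pHs lins)
    also have "\<dots> = sw h (\<lambda>a b. \<epsilon> (p * (T ^^ n) b) *s a)" using coT by (simp add: left_colinear_def lins)
    also have "\<dots> = sw h (\<lambda>a b. \<epsilon> (p * (T ^^ n) (es b)) *s a)" by (simp add: key)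
    also have "\<dots> = sw 1 (\<lambda>a b. \<epsilon> (p * (T ^^ n) (S b)) *s (h * a))" by (rule sw_es_right) (simp add: lins)
    finally show ?thesis by (simp add: q_def sw_mult_left scale_mult_right)
  qed
  have T1: "(T ^^ n) 1 = 1" using algebra_aut_funpow[OF T] by (simp add: algebra_aut_def)
  have "q = p" using Tq[of 1] T1 by simp
  then have "(T ^^ n) h = p' * h * p" for h using Tq[of h] p'p by (metis mult.assoc mult_1_left)
  moreover have "n \<ge> 1" using ij by (simp add: n_def)
  ultimately show thesis using that p'Hs pHs pp' p'p by blast
qed

text \<open>
  The map \<open>S T S\<^sup>-\<^sup>1\<close> is left colinear, and \<open>S\<close> exchanges the two bases.
\<close>
lemma right_colinear_power_inner:
  assumes \<theta>: "nondeg \<theta>" and T: "algebra_aut T" and Tc: "right_colinear T"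
  obtains n x x' where "n \<ge> 1" "x \<in> Ht" "x' \<in> Ht" "x * x' = 1" "x' * x = 1" "\<And>h. (T ^^ n) h = x * h * x'"
proof -
  define T' where "T' x = S (T (Si x))" for x
  have lT: "lin T" using T by (simp add: algebra_aut_def)
  note [simp] = linD[OF lT]
  have "T' = S \<circ> (T \<circ> Si)" by (auto simp: T'_def)
  moreover have "bij Si" unfolding Si_def by (rule bij_imp_bij_inv[OF S_bij])
  ultimately have "bij T'" using T S_bij bij_comp by (metis algebra_aut_def)
  moreover have "lin T'" by (rule linI) (simp_all add: T'_def lins3)
  ultimately have T'a: "algebra_aut T'" using T by (simp add: algebra_aut_def T'_def Si_mult S_mult)
  have T'c: "left_colinear T'"
    unfolding left_colinear_def
  proof (intro allI impI)
    fix F :: "'h \<Rightarrow> 'h \<Rightarrow> 'h" and x assume F: "bil F"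
    note [simp] = bilD[OF F]
    have "sw (T' x) F = sw (T (Si x)) (\<lambda>p q. F (S q) (S p))" unfolding T'_def by (rule sw_S[OF F])
    also have "\<dots> = sw (Si x) (\<lambda>p q. F (S q) (S (T p)))" using Tc by (simp add: right_colinear_def lins3)
    also have "\<dots> = sw x (\<lambda>p q. F (S (Si p)) (S (T (Si q))))" by (rule sw_Si) (simp add: lins3)
    finally show "sw (T' x) F = sw x (\<lambda>p q. F p (T' q))" by (simp add: T'_def)
  qed
  obtain n x x' where n: "n \<ge> 1" "x \<in> Hs" "x' \<in> Hs" "x * x' = 1" "x' * x = 1" "\<And>h. (T' ^^ n) h = x * h * x'"
    by (rule left_colinear_power_inner[OF \<theta> T'a T'c]) blast
  have "(T' ^^ i) (S h) = S ((T ^^ i) h)" for i h by (induction i) (simp_all add: T'_def)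
  then have "S ((T ^^ n) h) = x * S h * x'" for h using n(6) by metis
  then have "(T ^^ n) h = Si x' * h * Si x" for h by (metis Si_S Si_mult mult.assoc)
  moreover have "Si x' * Si x = 1" "Si x * Si x' = 1" by (simp_all add: Si_mult[symmetric] n)
  ultimately show thesis using that[of n "Si x'" "Si x"] n by simp
qed

lemma Hs_unit_inverse:
  assumes y: "y \<in> Hs" "invertible y" obtains y' where "y' \<in> Hs" "y * y' = 1" "y' * y = 1"
proof -
  obtain w where w: "w * y = 1" using y(2) unfolding invertible_def by blast
  have "(\<lambda>v. y * v) ` Hs = Hs"
  proof (rule lin_inj_on_image_eq[OF lin_mult_left Hs_subspace])
    show "(\<lambda>v. y * v) ` Hs \<subseteq> Hs" using Hs_mult[OF y(1)] by blast
    show "x = 0" if "y * x = 0" for x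
    proof -
      have "w * (y * x) = 0" using that by simp
      then show ?thesis by (simp add: w flip: mult.assoc)
    qed
  qed
  then obtain y' where "y' \<in> Hs" "y * y' = 1" using one_in_Hs by (metis imageE)
  then show thesis using that left_inverse_imp by blast
qed

lemma rslice_Hs: assumes y: "y \<in> Hs" and \<psi>: "linf \<psi>"
  shows "rslice \<psi> y = sw 1 (\<lambda>p q. \<psi> (y * q) *s p)" "rslice \<psi> y \<in> Hs"
proof -
  note [simp] = linfD[OF \<psi>]
  show 1: "rslice \<psi> y = sw 1 (\<lambda>p q. \<psi> (y * q) *s p)"
    unfolding rslice_def using sw_Hs_left[OF bil_linf_right[OF \<psi>] y, of 1] by simp
  show "rslice \<psi> y \<in> Hs" unfolding 1 by (rule sw_1_in_Hs[OF linf_comp[OF \<psi> lin_mult_left]])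
qed

text \<open>
  Subcomodules of \<open>Hs\<close> are ideals \<open>e Hs\<close>, as multiplication by base elements is a contraction of the
  coproduct. Invariance of \<open>e Hs\<close> under contractions gives \<open>S(e) = e\<close>, and for such \<open>e\<close> the complement
  \<open>(1 - e) Hs\<close> is a subcomodule too.
\<close>
lemma Hs_subcomodule:
  assumes J: "subspace J" "J \<subseteq> Hs" and sl: "\<And>\<psi> y. linf \<psi> \<Longrightarrow> y \<in> J \<Longrightarrow> rslice \<psi> y \<in> J"
  obtains e where "e \<in> J" "\<And>x. x \<in> J \<Longrightarrow> e * x = x" "\<And>y. y \<in> Hs \<Longrightarrow> e * y \<in> J"
    "\<And>y. y \<in> Hs \<Longrightarrow> e * y = y * e" "e * e = e"
    "\<And>\<psi> y. linf \<psi> \<Longrightarrow> y \<in> Hs \<Longrightarrow> e * y = 0 \<Longrightarrow> e * rslice \<psi> y = 0"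
proof -
  have r: "x * y \<in> J" if "x \<in> J" "y \<in> Hs" for x y
    using sl[OF linf_comp[OF counit_linear lin_mult_right[of y]] that(1)] that(2) by (simp add: rslice_def sw_eps)
  have l: "y * x \<in> J" if "x \<in> J" "y \<in> Hs" for x y
    using sl[OF linf_comp[OF counit_linear lin_mult_left[of y]] that(1)] that(2) by (simp add: rslice_def sw_eps)
  obtain e where e: "e \<in> J" "e \<in> Hs" "\<And>x. x \<in> J \<Longrightarrow> e * x = x" "\<And>x. x \<in> J \<Longrightarrow> x * e = x"
      "\<And>y. y \<in> Hs \<Longrightarrow> e * y = y * e" "e * e = e" "S (S e) = e"
  proof (rule Hs_ideal[OF J r l])
    fix e assume *: "e \<in> J" "e \<in> Hs" "\<And>x. x \<in> J \<Longrightarrow> e * x = x" "\<And>x. x \<in> J \<Longrightarrow> x * e = x"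
      "\<And>y. y \<in> Hs \<Longrightarrow> e * y = y * e" "e * e = e" "S (S e) = e"
    show thesis by (rule that[OF *])
  qed
  have 1: "sw 1 (\<lambda>p q. F p (e * q)) = sw 1 (\<lambda>p q. F (e * p) (e * q))" if F: "bil F" for F :: "'h \<Rightarrow> 'h \<Rightarrow> 'h"
  proof -
    have *: "sw 1 (\<lambda>p q. F (g p) (e * q)) = (\<Sum>k\<in>bas. F (sw 1 (\<lambda>p q. cf k (e * q) *s g p)) k)" for g
      unfolding bil_sw1[OF F] sw_sum[symmetric] by (rule sw_cong) (rule bil_expand_right[OF F])
    have "sw 1 (\<lambda>p q. cf k (e * q) *s (e * p)) = sw 1 (\<lambda>p q. cf k (e * q) *s p)" for k
      using e(3)[OF sl[OF cf_linf e(1)], of k] by (simp add: rslice_Hs(1)[OF e(2) cf_linf] sw_mult_left scale_mult_right)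
    then show ?thesis using *[of "\<lambda>p. p"] *[of "\<lambda>p. e * p"] by simp
  qed
  (* 1_1 (x) e 1_2 = e 1_1 (x) e 1_2, and e 1_1 (x) 1_2 = 1_1 (x) w 1_2 for w = S^{-1}(e); applying eps to the
     first leg gives e = e w. *)
  define w where "w = Si e"
  have w: "w \<in> Ht" "S w = e" using e(2) by (simp_all add: w_def)
  have "e = sw 1 (\<lambda>p q. \<epsilon> p *s (e * q))"
    using counit_left_sw[of 1] by (simp add: sw_mult_left[symmetric] scale_mult_right[symmetric])
  also have "\<dots> = sw 1 (\<lambda>p q. \<epsilon> (S w * p) *s (e * q))" unfolding w(2) by (rule 1) (simp add: lins)
  also have "\<dots> = sw 1 (\<lambda>p q. \<epsilon> p *s (e * (w * q)))"
    by (rule sw_1_Ht_left[symmetric]) (simp_all add: w lins)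
  also have "\<dots> = e * w"
    using counit_left_sw[of 1] by (simp add: sw_mult_left[symmetric] scale_mult_right[symmetric])
  finally have ew: "e = e * w" .
  have Se: "S e = e * S e" using arg_cong[OF ew, of S] by (simp add: S_mult w)
  have "e = e * S e" using arg_cong[OF Se, of S] e(7) by (simp add: S_mult)
  then have See: "S e = e" using Se by simp
  then have eHt: "e \<in> Ht" using S_Hs_in[OF e(2)] by simp
  have "e * rslice \<psi> y = 0" if \<psi>: "linf \<psi>" and y: "y \<in> Hs" "e * y = 0" for \<psi> y
  proof -
    note [simp] = linfD[OF \<psi>]
    have "e * rslice \<psi> y = sw 1 (\<lambda>p q. \<psi> (y * q) *s (S e * p))"
      by (simp add: rslice_Hs(1)[OF y(1) \<psi>] sw_mult_left scale_mult_right See)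
    also have "\<dots> = sw 1 (\<lambda>p q. \<psi> (y * (e * q)) *s p)"
      by (rule sw_1_Ht_left[symmetric]) (simp_all add: eHt lins)
    also have "\<dots> = 0" using e(5)[OF y(1)] y(2) by (simp flip: mult.assoc)
    finally show ?thesis .
  qed
  then show thesis using that e r by blast
qed

lemma power_inverse: fixes x x' :: 'h assumes "x * x' = 1" shows "x ^ i * x' ^ i = 1"
proof (induction i)
  case (Suc i)
  have "x ^ Suc i * x' ^ Suc i = (x ^ i * x) * (x' * x' ^ i)" by (simp only: power_Suc2[of x] power_Suc[of x'])
  also have "\<dots> = x ^ i * (x * x') * x' ^ i" by (simp only: mult.assoc)
  finally show ?case using Suc assms by simp
qed simp

text \<open>
  The subspaces \<open>G\<^sup>i Hs\<close> are subcomodules of \<open>H\<close>, semisimple because those of \<open>Hs\<close> are. With \<open>g\<close> chosen such that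
  \<open>\<Delta>(G) = (G \<otimes> g) \<Delta>(1)\<close>, an isomorphism from \<open>G\<^sup>i Hs\<close> to \<open>G\<^sup>j Hs\<close> is given by a map \<open>U\<close> on \<open>Hs\<close> with
  \<open>U(1\<^sub>1) \<otimes> 1\<^sub>2 = y\<^sub>1 \<otimes> g\<^sup>n y\<^sub>2\<close>, where \<open>y = U(1)\<close>. Applying \<open>\<epsilon>\<close> to the first leg puts \<open>g\<^sup>n y\<close> into \<open>Ht\<close>, and \<open>y\<close> turns
  out to be a unit; so \<open>g\<^sup>n \<in> Ht Hs\<close>, and the same follows for \<open>G\<^sup>n\<close>.
\<close>
lemma tw_grouplike_power:
  assumes Q: "tw_grouplike G" and GU: "invertible G"
  obtains n z y where "n \<ge> 1" "z \<in> Ht" "y \<in> Hs" "G ^ n = z * y"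
proof -
  obtain a b where ab: "invertible a" "invertible b" and G0: "\<And>F :: 'h \<Rightarrow> 'h \<Rightarrow> 'h. bil F \<Longrightarrow> sw G F = sw 1 (\<lambda>p q. F (a * p) (b * q))"
    using Q unfolding tw_grouplike_def by blast
  (* Normalise the pair (a, b): applying eps to the second leg gives G = a y1 with a unit y1 of Hs,
     which can be moved to the other leg, so that the first entry becomes G itself. *)
  define y1 where "y1 = sw 1 (\<lambda>p q. \<epsilon> (b * q) *s p)"
  have y1Hs: "y1 \<in> Hs" unfolding y1_def by (rule sw_1_in_Hs[OF linf_comp[OF counit_linear lin_mult_left]])
  have Gy1: "G = a * y1"
    using G0[of "\<lambda>p q. \<epsilon> q *s p"] by (simp add: counit_right_sw lins y1_def sw_mult_left)
  obtain a' where a': "a' * a = 1" "a * a' = 1" using ab unfolding invertible_def by blast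
  have y1a: "y1 = a' * G" by (simp add: Gy1 a' flip: mult.assoc)
  have "invertible y1" unfolding y1a by (rule invertible_mult[OF invertibleI_right[OF a'(1)] GU])
  then obtain y1' where y1': "y1' \<in> Hs" "y1 * y1' = 1" "y1' * y1 = 1" using Hs_unit_inverse[OF y1Hs] by blast
  define w where "w = Si y1'"
  have w: "w \<in> Ht" "S w = y1'" using y1' by (simp_all add: w_def)
  have "invertible w" unfolding w_def by (rule invertibleI_right[of _ "Si y1"]) (simp add: Si_mult[symmetric] y1')
  define g where "g = b * w"
  have gU: "invertible g" unfolding g_def by (rule invertible_mult[OF ab(2) \<open>invertible w\<close>])
  have G1: "sw G F = sw 1 (\<lambda>p q. F (G * p) (g * q))" if F: "bil F" for F :: "'h \<Rightarrow> 'h \<Rightarrow> 'h"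
  proof -
    note [simp] = bilD[OF F]
    have "a = G * S w" by (simp add: w Gy1 mult.assoc y1')
    then have "sw G F = sw 1 (\<lambda>p q. F (G * (S w * p)) (b * q))" using G0[OF F] by (simp add: mult.assoc)
    also have "\<dots> = sw 1 (\<lambda>p q. F (G * p) (b * (w * q)))"
      by (rule sw_1_Ht_left[symmetric]) (simp_all add: w lins)
    finally show ?thesis by (simp add: g_def mult.assoc)
  qed
  have GP: "sw (G ^ i * y) F = sw 1 (\<lambda>p q. F (G ^ i * p) (g ^ i * (y * q)))" if y: "y \<in> Hs" and F: "bil F"
    for i y and F :: "'h \<Rightarrow> 'h \<Rightarrow> 'h"
    using F
  proof (induction i arbitrary: F)
    case 0 then show ?case using sw_Hs_left[OF 0 y, of 1] by simp
  next
    case (Suc i)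
    note [simp] = bilD[OF Suc.prems]
    have "sw (G ^ Suc i * y) F = sw G (\<lambda>p q. sw (G ^ i * y) (\<lambda>u v. F (p * u) (q * v)))"
      unfolding power_Suc mult.assoc by (rule mult_sw[OF Suc.prems])
    also have "\<dots> = sw 1 (\<lambda>p q. sw (G ^ i * y) (\<lambda>u v. F (G * p * u) (g * q * v)))"
      by (rule G1) (simp add: lins)
    also have "\<dots> = sw (1 * (G ^ i * y)) (\<lambda>u v. F (G * u) (g * v))"
      by (subst mult_sw) (simp_all add: lins)
    also have "\<dots> = sw (G ^ i * y) (\<lambda>u v. F (G * u) (g * v))" by simp
    also have "\<dots> = sw 1 (\<lambda>p q. F (G * (G ^ i * p)) (g * (g ^ i * (y * q))))"
      by (rule Suc.IH) (simp add: lins)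
    finally show ?case by (simp add: mult.assoc)
  qed
  obtain G' where G': "G * G' = 1" "G' * G = 1" using GU unfolding invertible_def by blast
  obtain g' where g': "g * g' = 1" "g' * g = 1" using gU unfolding invertible_def by blast
  have Gi: "G' ^ i * G ^ i = 1" "G ^ i * G' ^ i = 1" and gi: "g' ^ i * g ^ i = 1" "g ^ i * g' ^ i = 1" for i
    by (rule power_inverse, fact)+
  have Ginj: "x = y" if "G ^ i * x = G ^ i * y" for i x y
    using arg_cong[OF that, of "\<lambda>v. G' ^ i * v"] by (simp add: Gi flip: mult.assoc)
  have rsl: "rslice \<phi> (G ^ i * y) = G ^ i * rslice (\<lambda>q. \<phi> (g ^ i * q)) y" if \<phi>: "linf \<phi>" and y: "y \<in> Hs" for \<phi> i y
    using GP[OF y bil_linf_right[OF \<phi>], of i] rslice_Hs(1)[OF y linf_comp[OF \<phi> lin_mult_left[of "g ^ i"]]]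
    by (simp add: rslice_def sw_mult_left scale_mult_right)
  interpret op: operators scale bas "{rslice \<phi> | \<phi>. linf \<phi>}"
    by unfold_locales (auto simp: linD[OF rslice_lin])
  interpret pp: finite_dimensional_vector_space_pair scale bas scale bas by unfold_locales
  have subI: "op.submodule ((\<lambda>y. G ^ i * y) ` J)"
    if J: "subspace J" "J \<subseteq> Hs" and Jc: "\<And>\<psi> y. linf \<psi> \<Longrightarrow> y \<in> J \<Longrightarrow> rslice \<psi> y \<in> J" for i J
    unfolding op.submodule_def
  proof (intro conjI ballI)
    show "subspace ((\<lambda>y. G ^ i * y) ` J)" by (rule pp.linear_subspace_image[OF lin_mult_left J(1)])
    fix f x assume "f \<in> {rslice \<phi> | \<phi>. linf \<phi>}" "x \<in> (\<lambda>y. G ^ i * y) ` J"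
    then obtain \<phi> y where "f = rslice \<phi>" "linf \<phi>" "y \<in> J" "x = G ^ i * y" by blast
    then show "f x \<in> (\<lambda>y. G ^ i * y) ` J"
      using J(2) Jc[OF linf_comp[OF _ lin_mult_left]] by (auto simp: rsl)
  qed
  have V: "op.semisimple ((\<lambda>y. G ^ i * y) ` Hs)" for i
  proof (rule op.semisimple_image)
    show "op.submodule ((\<lambda>y. G ^ i * y) ` Hs)" by (rule subI[OF Hs_subspace]) (simp_all add: rslice_Hs(2))
    fix J assume J: "subspace J" "J \<subseteq> Hs" "op.submodule ((\<lambda>y. G ^ i * y) ` J)"
    have J2: "rslice \<psi> y \<in> J" if \<psi>: "linf \<psi>" and y: "y \<in> J" for \<psi> y
    proof -
      have \<phi>: "linf (\<lambda>x. \<psi> (g' ^ i * x))" by (rule linf_comp[OF \<psi> lin_mult_left])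
      have "rslice (\<lambda>x. \<psi> (g' ^ i * x)) (G ^ i * y) = G ^ i * rslice \<psi> y"
        using rsl[OF \<phi>, of y i] y J(2) by (auto simp: gi simp flip: mult.assoc)
      moreover have "rslice (\<lambda>x. \<psi> (g' ^ i * x)) (G ^ i * y) \<in> (\<lambda>y. G ^ i * y) ` J"
        using op.submoduleD(6)[OF J(3)] \<phi> y by blast
      ultimately obtain q where q: "q \<in> J" "G ^ i * rslice \<psi> y = G ^ i * q" by auto
      from Ginj[OF q(2)] q(1) show ?thesis by simp
    qed
    obtain e where e: "e \<in> J" "\<And>x. x \<in> J \<Longrightarrow> e * x = x" "\<And>y. y \<in> Hs \<Longrightarrow> e * y \<in> J"
      "\<And>y. y \<in> Hs \<Longrightarrow> e * y = y * e" "e * e = e"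
      "\<And>\<psi> y. linf \<psi> \<Longrightarrow> y \<in> Hs \<Longrightarrow> e * y = 0 \<Longrightarrow> e * rslice \<psi> y = 0"
    proof (rule Hs_subcomodule[OF J(1,2) J2])
      fix e assume *: "e \<in> J" "\<And>x. x \<in> J \<Longrightarrow> e * x = x" "\<And>y. y \<in> Hs \<Longrightarrow> e * y \<in> J"
        "\<And>y. y \<in> Hs \<Longrightarrow> e * y = y * e" "e * e = e"
        "\<And>\<psi> y. linf \<psi> \<Longrightarrow> y \<in> Hs \<Longrightarrow> e * y = 0 \<Longrightarrow> e * rslice \<psi> y = 0"
      show thesis by (rule that[OF *])
    qed
    define K where "K = {p \<in> Hs. e * p = 0}"
    have "subspace K" using Hs_subspace by (auto simp: subspace_def K_def distrib_left scale_mult_right)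
    then have "op.submodule ((\<lambda>y. G ^ i * y) ` K)"
      by (rule subI) (use e(6) rslice_Hs(2) in \<open>auto simp: K_def\<close>)
    moreover have "K \<subseteq> Hs" by (auto simp: K_def)
    moreover have "J \<inter> K \<subseteq> {0}" using e(2) by (auto simp: K_def)
    moreover have "Hs \<subseteq> op.plus_set J K"
    proof
      fix p assume p: "p \<in> Hs"
      have ep: "e * p \<in> J" by (rule e(3)[OF p])
      moreover have "p - e * p \<in> K"
        using p ep J(2) Hs_subspace e(5) by (auto simp: K_def subspace_diff right_diff_distrib simp flip: mult.assoc)
      moreover have "p = e * p + (p - e * p)" by simp
      ultimately show "p \<in> op.plus_set J K" unfolding op.plus_set_def by blast
    qed
    ultimately show "\<exists>K. K \<subseteq> Hs \<and> op.submodule ((\<lambda>y. G ^ i * y) ` K) \<and> J \<inter> K \<subseteq> {0} \<and> Hs \<subseteq> op.plus_set J K"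
      by blast
  qed (auto simp: Hs_subspace distrib_left scale_mult_right intro: Ginj)
  obtain i j u U where ij: "i < j" and u: "op.module_iso ((\<lambda>y. G ^ i * y) ` Hs) ((\<lambda>y. G ^ j * y) ` Hs) u"
    and U: "\<And>p. p \<in> Hs \<Longrightarrow> U p \<in> Hs" "\<And>p. p \<in> Hs \<Longrightarrow> G ^ j * U p = u (G ^ i * p)"
    and surj: "\<And>q. q \<in> Hs \<Longrightarrow> \<exists>p\<in>Hs. G ^ j * q = u (G ^ i * p)"
    by (rule op.isomorphic_image_pair[of "\<lambda>i y. G ^ i * y" Hs, OF V], rule that)
  define n where "n = j - i"
  have n1: "n \<ge> 1" using ij by (simp add: n_def)
  have gn: "g' ^ i * (g ^ j * x) = g ^ n * x" for x
  proof -
    have "g ^ j = g ^ i * g ^ n" using ij by (simp add: n_def flip: power_add)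
    then show ?thesis by (simp add: gi flip: mult.assoc)
  qed
  have U_add: "U (p + q) = U p + U q" if "p \<in> Hs" "q \<in> Hs" for p q
  proof (rule Ginj[of j])
    have "u (G ^ i * p + G ^ i * q) = u (G ^ i * p) + u (G ^ i * q)"
      using u that by (auto simp: op.module_iso_def)
    then show "G ^ j * U (p + q) = G ^ j * (U p + U q)" using that by (simp add: U Hs_add distrib_left)
  qed
  have U_scale: "U (r *s p) = r *s U p" if "p \<in> Hs" for p r
  proof (rule Ginj[of j])
    have "u (r *s (G ^ i * p)) = r *s u (G ^ i * p)"
      using u that by (auto simp: op.module_iso_def)
    then show "G ^ j * U (r *s p) = G ^ j * r *s U p" using that by (simp add: U Hs_scale scale_mult_right)
  qed
  define y where "y = U 1"
  have yHs: "y \<in> Hs" by (simp add: y_def U)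
  have U1: "U (rslice \<psi> 1) = rslice (\<lambda>x. \<psi> (g ^ n * x)) y" if \<psi>: "linf \<psi>" for \<psi>
  proof (rule Ginj[of j])
    have \<phi>: "linf (\<lambda>x. \<psi> (g' ^ i * x))" by (rule linf_comp[OF \<psi> lin_mult_left])
    have 1: "rslice (\<lambda>x. \<psi> (g' ^ i * x)) (G ^ i * 1) = G ^ i * rslice \<psi> 1"
      using rsl[OF \<phi>, of 1 i] by (simp add: gi flip: mult.assoc)
    have "G ^ j * U (rslice \<psi> 1) = u (rslice (\<lambda>x. \<psi> (g' ^ i * x)) (G ^ i * 1))"
      unfolding 1 by (rule U(2)) (rule rslice_Hs(2)[OF one_in_Hs \<psi>])
    also have "\<dots> = rslice (\<lambda>x. \<psi> (g' ^ i * x)) (u (G ^ i * 1))"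
      using u \<phi> imageI[OF one_in_Hs, of "\<lambda>y. G ^ i * y"] unfolding op.module_iso_def by blast
    also have "\<dots> = rslice (\<lambda>x. \<psi> (g' ^ i * x)) (G ^ j * y)" by (simp only: y_def U(2)[OF one_in_Hs])
    also have "\<dots> = G ^ j * rslice (\<lambda>x. \<psi> (g ^ n * x)) y"
      using rsl[OF \<phi> yHs, of j] by (simp add: gn)
    finally show "G ^ j * U (rslice \<psi> 1) = G ^ j * rslice (\<lambda>x. \<psi> (g ^ n * x)) y" .
  qed
  define z where "z = sw 1 (\<lambda>p q. \<epsilon> (U (es p)) *s q)"
  have Ues: "lin (\<lambda>p. U (es p))" by (rule linI) (simp_all add: es_add es_scale U_add U_scale)
  note [simp] = linD[OF Ues]
  have zHt: "z \<in> Ht" unfolding z_def by (rule sw_1_in_Ht[OF linf_comp[OF counit_linear Ues]])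
  have gz: "g ^ n * y = z"
  proof (rule linf_eqI)
    fix \<psi> assume \<psi>: "linf \<psi>"
    note [simp] = linfD[OF \<psi>]
    have "\<psi> (g ^ n * y) = \<epsilon> (rslice (\<lambda>x. \<psi> (g ^ n * x)) y)"
    proof -
      have "\<epsilon> (rslice (\<lambda>x. \<psi> (g ^ n * x)) y) = \<psi> (g ^ n * sw y (\<lambda>a b. \<epsilon> a *s b))"
        unfolding rslice_def by (simp add: sws linf_sw[OF \<psi>] scale_mult_right \<epsilon>_scale mult.commute)
      then show ?thesis by (simp add: counit_left_sw)
    qed
    also have "\<dots> = \<epsilon> (U (rslice \<psi> 1))" by (simp add: U1 \<psi>)
    also have "rslice \<psi> 1 = es (rslice \<psi> 1)" using rslice_Hs(2)[OF one_in_Hs \<psi>] by (simp add: Hs_iff)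
    also have "\<epsilon> (U (es (rslice \<psi> 1))) = \<psi> z"
      unfolding rslice_def z_def lin_sw[OF Ues] linf_sw[OF \<psi>]
      by (simp add: sws \<epsilon>_scale mult.commute)
    finally show "\<psi> (g ^ n * y) = \<psi> z" .
  qed
  have Up: "U p = S z * p" if p: "p \<in> Hs" for p
  proof -
    have l: "linf (\<lambda>q. \<epsilon> (p * q))" by (rule linf_comp[OF counit_linear lin_mult_left])
    have "U p = U (rslice (\<lambda>q. \<epsilon> (p * q)) 1)" using p by (simp add: rslice_def sw_eps)
    also have "\<dots> = rslice (\<lambda>x. \<epsilon> (p * (g ^ n * x))) y" by (rule U1[OF l])
    also have "\<dots> = sw 1 (\<lambda>a b. \<epsilon> (p * (g ^ n * y) * b) *s a)"
      using rslice_Hs(1)[OF yHs linf_comp[OF l lin_mult_left[of "g ^ n"]]] by (simp add: mult.assoc)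
    also have "\<dots> = es (p * z)" by (simp add: gz es_def)
    finally show ?thesis by (simp add: es_Ht_Hs zHt p)
  qed
  (* U is left multiplication by S z, and it is onto because the isomorphism is. *)
  have "\<exists>p\<in>Hs. U p = 1"
  proof -
    obtain p where p: "p \<in> Hs" "G ^ j * 1 = u (G ^ i * p)" using surj[OF one_in_Hs] by blast
    then have "G ^ j * U p = G ^ j * 1" using U(2) by metis
    then have "U p = 1" by (rule Ginj)
    then show ?thesis using p by blast
  qed
  then have "invertible (S z)" using Up invertibleI_right by metis
  moreover have "y = S z" using Up[of 1] by (simp add: y_def)
  ultimately obtain y' where y': "y' \<in> Hs" "y * y' = 1" using Hs_unit_inverse[OF yHs] by metis
  have gn': "g ^ n = z * y'" by (simp add: gz[symmetric] mult.assoc y')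
  define z2 where "z2 = sw 1 (\<lambda>p q. \<epsilon> (G ^ n * p) *s q)"
  have z2Ht: "z2 \<in> Ht" unfolding z2_def by (rule sw_1_in_Ht[OF linf_comp[OF counit_linear lin_mult_left]])
  have "G ^ n = sw (G ^ n * 1) (\<lambda>p q. \<epsilon> p *s q)" by (simp add: counit_left_sw)
  also have "\<dots> = sw 1 (\<lambda>p q. \<epsilon> (G ^ n * p) *s (g ^ n * (1 * q)))" by (rule GP) (simp_all add: lins)
  also have "\<dots> = g ^ n * z2" by (simp add: z2_def sw_mult_left scale_mult_right)
  also have "\<dots> = (z * z2) * y'" by (simp add: gn' mult.assoc Ht_Hs_commute[OF z2Ht y'(1)])
  finally have "G ^ n = (z * z2) * y'" .
  then show thesis using that[OF n1 Ht_mult[OF zHt z2Ht] y'(1)] by blast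
qed

end

section \<open>Triviality of a power of the antipode\<close>

lemma tensor2_merge:
  "tensor2_eq sc (map (\<lambda>k. (k, u k)) ks @ map (\<lambda>k. (k, v k)) ks) (map (\<lambda>k. (k, u k + v k)) ks)"
proof (induction ks)
  case Nil show ?case by (simp add: tensor2_eq.refl)
next
  case (Cons k ks)
  let ?U = "map (\<lambda>k. (k, u k)) ks" and ?V = "map (\<lambda>k. (k, v k)) ks"
  have "tensor2_eq sc (?U @ [(k, v k)]) ([(k, v k)] @ ?U)" by (rule tensor2_eq.commute)
  from tensor2_eq.append[OF tensor2_eq.append[OF tensor2_eq.refl[of sc "[(k, u k)]"] this] tensor2_eq.refl[of sc ?V]]
  have 1: "tensor2_eq sc ((k, u k) # ?U @ (k, v k) # ?V) ([(k, u k), (k, v k)] @ (?U @ ?V))" by simp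
  have "tensor2_eq sc ([(k, u k), (k, v k)] @ (?U @ ?V)) ([(k, u k + v k)] @ map (\<lambda>k. (k, u k + v k)) ks)"
    by (rule tensor2_eq.append[OF tensor2_eq.sym[OF tensor2_eq.add2] Cons])
  from tensor2_eq.trans[OF 1 this] show ?case by simp
qed

context fd_weak_hopf_algebra
begin

lemma tensor2_zero_right: "tensor2_eq scale [(a, 0)] []"
proof -
  have "tensor2_eq scale [(a, 0 *s 0)] [(0 *s a, 0)]" by (rule tensor2_eq.sym[OF tensor2_eq.scale])
  then have "tensor2_eq scale [(a, 0)] [(0, 0)]" by simp
  then show ?thesis by (rule tensor2_eq.trans[OF _ tensor2_eq.zero])
qed

lemma tensor2_single:
  "tensor2_eq scale [(\<Sum>k\<leftarrow>ks. c k *s k, b)] (map (\<lambda>k. (k, c k *s b)) ks)"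
proof (induction ks)
  case Nil show ?case by (simp add: tensor2_eq.zero)
next
  case (Cons k ks)
  have "tensor2_eq scale [(c k *s k + (\<Sum>k\<leftarrow>ks. c k *s k), b)] ([(c k *s k, b)] @ [(\<Sum>k\<leftarrow>ks. c k *s k, b)])"
    using tensor2_eq.add1[of scale] by simp
  moreover have "tensor2_eq scale ([(c k *s k, b)] @ [(\<Sum>k\<leftarrow>ks. c k *s k, b)]) ([(k, c k *s b)] @ map (\<lambda>k. (k, c k *s b)) ks)"
    by (rule tensor2_eq.append[OF tensor2_eq.scale Cons])
  ultimately show ?case using tensor2_eq.trans by fastforce
qed

text \<open>
  The entries of this normal form are contractions with coordinate functionals, so equality in \<open>H \<otimes> H\<close> can be
  tested on functionals.
\<close>
lemma tensor2_normal_form: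
  assumes ks: "set ks = bas" "distinct ks"
  shows "tensor2_eq scale xs (map (\<lambda>k. (k, \<Sum>(a, b)\<leftarrow>xs. cf k a *s b)) ks)"
proof (induction xs)
  case Nil
  have "tensor2_eq scale (map (\<lambda>k. (k, 0)) ks) []" for ks :: "'h list"
  proof (induction ks)
    case (Cons k ks)
    from tensor2_eq.append[OF tensor2_zero_right Cons] show ?case by simp
  qed (simp add: tensor2_eq.refl)
  then show ?case by (simp add: tensor2_eq.sym)
next
  case (Cons x xs)
  obtain a b where x: "x = (a, b)" by force
  have "a = (\<Sum>k\<leftarrow>ks. cf k a *s k)" using cf_expand[of a] ks by (simp add: sum_list_distinct_conv_sum_set)
  then have "tensor2_eq scale [(a, b)] (map (\<lambda>k. (k, cf k a *s b)) ks)"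
    using tensor2_single[of "\<lambda>k. cf k a" ks b] by simp
  from tensor2_eq.trans[OF tensor2_eq.append[OF this Cons] tensor2_merge]
  show ?case by (simp add: x)
qed

lemma tensor2_eqI:
  assumes eq: "\<And>f g. linf f \<Longrightarrow> linf g \<Longrightarrow> (\<Sum>(a, b)\<leftarrow>xs. f a * g b) = (\<Sum>(a, b)\<leftarrow>ys. f a * g b)"
  shows "tensor2_eq scale xs ys"
proof -
  obtain ks where ks: "set ks = bas" "distinct ks" using finite_distinct_list[OF bas(1)] by blast
  have g: "g (\<Sum>(a, b)\<leftarrow>zs. f a *s b) = (\<Sum>(a, b)\<leftarrow>zs. f a * g b)" if "linf g" for f g and zs :: "('h \<times> 'h) list"
    using linfD[OF that] by (induction zs) auto
  have "(\<Sum>(a, b)\<leftarrow>xs. cf k a *s b) = (\<Sum>(a, b)\<leftarrow>ys. cf k a *s b)" for k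
    by (rule linf_eqI) (simp add: g eq[OF cf_linf])
  then show ?thesis
    using tensor2_normal_form[OF ks, of xs] tensor2_eq.sym[OF tensor2_normal_form[OF ks, of ys]] tensor2_eq.trans by fastforce
qed

text \<open>
  The Sweedler form of \<open>weak_hopf_automorphism\<close>, suited to calculation.
\<close>
definition wha_aut :: "('h \<Rightarrow> 'h) \<Rightarrow> bool" where
  "wha_aut \<phi> \<longleftrightarrow> algebra_aut \<phi> \<and> (\<forall>F :: 'h \<Rightarrow> 'h \<Rightarrow> 'h. \<forall>h. bil F \<longrightarrow> sw (\<phi> h) F = sw h (\<lambda>a b. F (\<phi> a) (\<phi> b)))
     \<and> (\<forall>h. \<epsilon> (\<phi> h) = \<epsilon> h) \<and> (\<forall>h. \<phi> (S h) = S (\<phi> h))"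

lemma wha_aut_weak_hopf_automorphism: assumes "wha_aut \<phi>" shows "weak_hopf_automorphism \<phi>"
proof -
  have "tensor2_eq scale (\<Delta> (\<phi> h)) [(\<phi> a, \<phi> b). (a, b) \<leftarrow> \<Delta> h]" for h
  proof (rule tensor2_eqI)
    fix f g assume f: "linf f" and g: "linf g"
    note [simp] = linfD[OF f] linfD[OF g]
    have *: "sw (\<phi> h) (\<lambda>a b. (f a * g b) *s v) = sw h (\<lambda>a b. (f (\<phi> a) * g (\<phi> b)) *s v)" for v
    proof -
      have "bil (\<lambda>a b. (f a * g b) *s v)" by (simp add: lins)
      then show ?thesis using assms by (simp add: wha_aut_def)
    qed
    show "(\<Sum>(a, b)\<leftarrow>\<Delta> (\<phi> h). f a * g b) = (\<Sum>(a, b)\<leftarrow>[(\<phi> a, \<phi> b). (a, b) \<leftarrow> \<Delta> h]. f a * g b)" (is "?l = ?r")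
    proof -
      have l: "?l = sw (\<phi> h) (\<lambda>a b. f a * g b)" by (simp add: sw_def)
      have r: "?r = sw h (\<lambda>a b. f (\<phi> a) * g (\<phi> b))" by (simp add: sw_def o_def case_prod_unfold)
      (* Scalar identities are tested on vectors v; in the zero algebra all functionals vanish anyway. *)
      have "?l *s v = ?r *s v" for v unfolding l r sw_scale_left by (rule *)
      then have "(?l - ?r) *s v = 0" for v by (simp add: scale_left_diff_distrib)
      then have 0: "?l - ?r = 0 \<or> (\<forall>v::'h. v = 0)" using scale_eq_0_iff by blast
      show ?thesis
      proof (cases "\<forall>v::'h. v = 0")
        case True
        then have "f v = 0" for v using linfD(3)[OF f] by metis
        then show ?thesis by (simp add: case_prod_unfold o_def)
      next
        case False
        then have "?l - ?r = 0" using 0 by blast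
        then show ?thesis by (rule eq_iff_diff_eq_0[THEN iffD2])
      qed
    qed
  qed
  then show ?thesis using assms by (simp add: weak_hopf_automorphism_def wha_aut_def algebra_aut_def)
qed

lemma wha_aut_SS: "wha_aut (S ^^ 2)"
proof -
  have SS: "S ^^ 2 = S \<circ> S" by (simp add: numeral_2_eq_2)
  have "lin (\<lambda>x. S (S x))" by (rule lin_comp[OF S_lin S_lin])
  moreover have "bij (\<lambda>x. S (S x))" using bij_comp[OF S_bij S_bij] by (simp add: o_def)
  moreover have "sw (S (S h)) F = sw h (\<lambda>a b. F (S (S a)) (S (S b)))" if F: "bil F" for F :: "'h \<Rightarrow> 'h \<Rightarrow> 'h" and h
  proof -
    note [simp] = bilD[OF F]
    have "sw (S (S h)) F = sw (S h) (\<lambda>a b. F (S b) (S a))" by (rule sw_S[OF F])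
    also have "\<dots> = sw h (\<lambda>a b. F (S (S a)) (S (S b)))" by (rule sw_S) (simp add: lins)
    finally show ?thesis .
  qed
  ultimately show ?thesis by (simp add: wha_aut_def algebra_aut_def SS S_mult \<epsilon>_S o_def)
qed

lemma wha_aut_funpow: assumes \<phi>: "wha_aut \<phi>" shows "wha_aut (\<phi> ^^ i)"
proof (induction i)
  case 0
  have "algebra_aut (\<lambda>x::'h. x)" using algebra_aut_funpow[of \<phi> 0] \<phi> by (simp add: wha_aut_def id_def)
  then show ?case by (simp add: wha_aut_def id_def)
next
  case (Suc i)
  have l: "lin \<phi>" using \<phi> by (simp add: wha_aut_def algebra_aut_def)
  have "algebra_aut (\<phi> ^^ Suc i)" by (rule algebra_aut_funpow) (use \<phi> in \<open>simp add: wha_aut_def\<close>)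
  moreover have "sw ((\<phi> ^^ Suc i) h) F = sw h (\<lambda>a b. F ((\<phi> ^^ Suc i) a) ((\<phi> ^^ Suc i) b))" if F: "bil F"
    for F :: "'h \<Rightarrow> 'h \<Rightarrow> 'h" and h
  proof -
    have "bil (\<lambda>a b. F (\<phi> a) (\<phi> b))" by (simp add: balanced2_def bilD[OF F] linD[OF l])
    then show ?thesis using \<phi> Suc F by (simp add: wha_aut_def)
  qed
  moreover have "\<epsilon> ((\<phi> ^^ Suc i) h) = \<epsilon> h" "(\<phi> ^^ Suc i) (S h) = S ((\<phi> ^^ Suc i) h)" for h
    using \<phi> Suc by (simp_all add: wha_aut_def)
  ultimately show ?case unfolding wha_aut_def by blast
qed

lemma source_base_Hs: "source_base = Hs"
  by (simp add: source_base_def Hs_def source_counit_def[abs_def] es_def[abs_def] sw_def)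

lemma Ht_unit_inverse:
  assumes z: "z \<in> Ht" "invertible z" obtains z' where "z' \<in> Ht" "z * z' = 1" "z' * z = 1"
proof -
  have "S z \<in> Hs" "invertible (S z)" using z by (simp_all add: invertible_S)
  then obtain y where y: "y \<in> Hs" "S z * y = 1" "y * S z = 1" by (rule Hs_unit_inverse)
  have "z * Si y = Si (y * S z)" "Si y * z = Si (S z * y)" by (simp_all add: Si_mult)
  then show thesis using that[of "Si y"] y by simp
qed

text \<open>
  Write \<open>\<phi>\<close> as conjugation by \<open>z y\<close>. Computing \<open>\<Delta>(\<phi> h)\<close> from the base relations and from multiplicativity of \<open>\<Delta>\<close>
  gives \<open>h\<^sub>1 \<otimes> h\<^sub>2 = y h\<^sub>1 y\<^sup>-\<^sup>1 \<otimes> z h\<^sub>2 z\<^sup>-\<^sup>1\<close>. Inserting \<open>\<Delta>(1)\<close> on both sides and moving \<open>y\<close> and \<open>y\<^sup>-\<^sup>1\<close> to the second leg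
  shows that \<open>q = z S\<^sup>-\<^sup>1(y)\<close> has inverse \<open>S(y\<^sup>-\<^sup>1) z\<^sup>-\<^sup>1\<close> and is central, so \<open>q = z S(y)\<close>. Hence \<open>z\<close> may be replaced by
  \<open>S(y)\<^sup>-\<^sup>1\<close>, and \<open>\<phi>\<close> is the trivial automorphism of \<open>y\<^sup>-\<^sup>1\<close>.
\<close>
lemma inner_trivial:
  assumes \<phi>: "wha_aut \<phi>" and z: "z \<in> Ht" and y: "y \<in> Hs" and k: "z * y * k = 1"
    and inner: "\<And>h. \<phi> h = z * y * h * k"
  shows "trivial_automorphism \<phi>"
proof -
  have k2: "k * (z * y) = 1" by (rule left_inverse_imp[OF k])
  have zy: "z * y = y * z" by (rule Ht_Hs_commute[OF z y])
  have "invertible z" using k by (intro invertibleI_right[of z "y * k"]) (simp add: mult.assoc)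
  then obtain z' where z': "z' \<in> Ht" "z * z' = 1" "z' * z = 1" using Ht_unit_inverse[OF z] by blast
  have "invertible y" using k2 by (intro invertibleI_left[of "k * z"]) (simp add: mult.assoc)
  then obtain y' where y': "y' \<in> Hs" "y * y' = 1" "y' * y = 1" using Hs_unit_inverse[OF y] by blast
  have "z * y * (y' * z') = z * (y * y') * z'" by (simp only: mult.assoc)
  then have "z * y * (y' * z') = 1" by (simp add: y' z')
  then have "k = k * (z * y * (y' * z'))" by simp
  also have "\<dots> = k * (z * y) * (y' * z')" by (simp only: mult.assoc)
  finally have kyz: "k = y' * z'" by (simp add: k2)
  have c: "y' * z = z * y'" "y * z' = z' * y" "y' * z' = z' * y'" using Ht_Hs_commute z y z' y' by metis+
  have canc: "z * (z' * x) = x" "z' * (z * x) = x" "y * (y' * x) = x" "y' * (y * x) = x" for x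
    by (simp_all add: z' y' flip: mult.assoc)
  have star: "sw h F = sw h (\<lambda>a b. F (y * a * y') (z * b * z'))" if F: "bil F" for F :: "'h \<Rightarrow> 'h \<Rightarrow> 'h" and h
  proof -
    note [simp] = bilD[OF F]
    define G where "G a b = F (z' * a * z) (y' * b * y)" for a b
    have G: "bil G" by (simp add: G_def lins)
    note [simp] = bilD[OF G]
    have "sw (\<phi> h) G = sw (z * (y * (h * (y' * z')))) G" by (simp add: inner kyz mult.assoc)
    also have "\<dots> = sw (y * (h * (y' * z'))) (\<lambda>a b. G (z * a) b)" by (rule sw_Ht_left[OF G z])
    also have "\<dots> = sw (h * (y' * z')) (\<lambda>a b. G (z * a) (y * b))" by (rule sw_Hs_left[OF _ y]) (simp add: lins)
    also have "\<dots> = sw (h * y' * z') (\<lambda>a b. G (z * a) (y * b))" by (simp add: mult.assoc)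
    also have "\<dots> = sw (h * y') (\<lambda>a b. G (z * (a * z')) (y * b))" by (rule sw_Ht_right[OF _ z'(1)]) (simp add: lins)
    also have "\<dots> = sw h (\<lambda>a b. G (z * (a * z')) (y * (b * y')))" by (rule sw_Hs_right[OF _ y'(1)]) (simp add: lins)
    also have "\<dots> = sw h F" by (simp add: G_def mult.assoc z' y' canc)
    finally have 1: "sw (\<phi> h) G = sw h F" .
    have "sw (\<phi> h) G = sw h (\<lambda>a b. G (\<phi> a) (\<phi> b))" using \<phi> G by (simp add: wha_aut_def)
    also have "\<dots> = sw h (\<lambda>a b. F (y * a * y') (z * b * z'))"
    proof (rule sw_cong)
      fix a b
      have "z' * \<phi> a * z = z' * (z * (y * (a * (y' * (z' * z)))))" by (simp only: inner kyz mult.assoc)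
      then have 1: "z' * \<phi> a * z = y * a * y'" by (simp add: canc z' mult.assoc)
      have "y' * \<phi> b * y = y' * (z * y) * b * (y' * z') * y" by (simp only: inner kyz mult.assoc)
      also have "\<dots> = y' * (y * z) * b * (z' * y') * y" by (simp only: zy c)
      also have "\<dots> = z * b * z'" by (simp add: mult.assoc canc y')
      finally show "G (\<phi> a) (\<phi> b) = F (y * a * y') (z * b * z')" by (simp only: G_def 1)
    qed
    finally show ?thesis using 1 by simp
  qed
  define w where "w = Si y"
  have w: "w \<in> Ht" "S w = y" using y by (simp_all add: w_def)
  define q where "q = z * w"
  define q' where "q' = S y' * z'"
  have conj_q: "q * h * q' = h" for h
  proof -
    have "sw h F = sw h (\<lambda>a b. F a (q * b * q'))" if F: "bil F" for F :: "'h \<Rightarrow> 'h \<Rightarrow> 'h"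
    proof -
      note [simp] = bilD[OF F]
      have "sw h F = sw h (\<lambda>a b. F (y * a * y') (z * b * z'))" by (rule star[OF F])
      also have "\<dots> = sw 1 (\<lambda>p q. sw h (\<lambda>a b. F (y * (p * a) * y') (z * (q * b) * z')))"
        by (rule sw_one_mult(1)[symmetric]) (simp add: lins)
      also have "\<dots> = sw 1 (\<lambda>p q. sw h (\<lambda>a b. F (S w * p * a * y') (z * (q * b) * z')))" by (simp add: w mult.assoc)
      also have "\<dots> = sw 1 (\<lambda>p q. sw h (\<lambda>a b. F (p * a * y') (z * (w * q * b) * z')))"
        by (rule sw_1_Ht_left[symmetric, OF _ w(1)]) (simp add: lins)
      also have "\<dots> = sw h (\<lambda>a b. F (a * y') (z * (w * b) * z'))"
        by (subst sw_one_mult(1)[symmetric, of "\<lambda>a b. F (a * y') (z * (w * b) * z')"]) (simp_all add: lins)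
      also have "\<dots> = sw h (\<lambda>a b. sw 1 (\<lambda>p q. F (a * p * y') (z * (w * (b * q)) * z')))"
        by (rule sw_one_mult(2)[symmetric]) (simp add: lins)
      also have "\<dots> = sw h (\<lambda>a b. sw 1 (\<lambda>p q. F (a * (p * y')) (z * (w * (b * q)) * z')))" by (simp add: mult.assoc)
      also have "\<dots> = sw h (\<lambda>a b. sw 1 (\<lambda>p q. F (a * p) (z * (w * (b * (q * S y'))) * z')))"
        by (rule sw_cong, rule sw_1_Hs_right[OF _ y'(1)]) (simp add: lins)
      also have "\<dots> = sw h (\<lambda>a b. F a (z * (w * (b * S y')) * z'))"
        by (subst sw_one_mult(2)[symmetric, of "\<lambda>a b. F a (z * (w * (b * S y')) * z')"]) (simp_all add: lins)
      finally show ?thesis by (simp add: q_def q'_def mult.assoc)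
    qed
    from this[of "\<lambda>a b. \<epsilon> a *s b"] have "h = sw h (\<lambda>a b. \<epsilon> a *s (q * b * q'))" by (simp add: counit_left_sw lins)
    also have "\<dots> = q * sw h (\<lambda>a b. \<epsilon> a *s b) * q'"
      by (simp add: sw_mult_left sw_mult_right scale_mult_left scale_mult_right)
    finally show ?thesis by (simp add: counit_left_sw)
  qed
  have qq': "q * q' = 1" using conj_q[of 1] by simp
  have Sy: "S y * S y' = 1" "S y' * S y = 1" by (simp_all add: y' flip: S_mult)
  have "q = z * S y"
  proof -
    have "q' * (z * S y) = S y' * (z' * z) * S y" by (simp only: q'_def mult.assoc)
    then have "q' * (z * S y) = 1" by (simp add: z' Sy)
    moreover have "q = q * (q' * (z * S y))" using calculation by simp
    moreover have "q * (q' * (z * S y)) = z * S y" by (simp add: qq' flip: mult.assoc)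
    ultimately show ?thesis by simp
  qed
  then have zq: "z = q * S y'" by (simp add: mult.assoc Sy)
  have z'q: "z' = S y * q'" by (simp add: q'_def Sy flip: mult.assoc)
  have form: "\<phi> h = S y' * y * h * S y * y'" for h
  proof -
    have "\<phi> h = z * y * h * (z' * y')" by (simp add: inner kyz c)
    also have "\<dots> = q * (S y' * y * h * y' * S y) * q'"
    proof -
      have "y' * S y = S y * y'" using Ht_Hs_commute[OF S_Hs_in[OF y] y'(1)] by simp
      moreover have "z' * y' = y' * S y * q'" using c(3) by (simp add: z'q mult.assoc)
      ultimately show ?thesis by (simp add: zq mult.assoc)
    qed
    also have "\<dots> = S y' * y * h * y' * S y" by (rule conj_q)
    also have "\<dots> = S y' * y * h * (y' * S y)" by (simp only: mult.assoc)
    also have "y' * S y = S y * y'" using Ht_Hs_commute[OF S_Hs_in[OF y] y'(1)] by simp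
    finally show ?thesis by (simp add: mult.assoc)
  qed
  show ?thesis
    unfolding trivial_automorphism_def source_base_Hs
    using wha_aut_weak_hopf_automorphism[OF \<phi>] form y y' Sy
    by (intro conjI bexI[of _ y'] bexI[of _ y] exI[of _ "S y"]) (simp_all add: inverse_pair_def)
qed

lemma tw_grouplike_mult: assumes "tw_grouplike x" "tw_grouplike y" shows "tw_grouplike (x * y)"
proof -
  obtain a b where ab: "invertible a" "invertible b" and x: "\<And>F :: 'h \<Rightarrow> 'h \<Rightarrow> 'h. bil F \<Longrightarrow> sw x F = sw 1 (\<lambda>p q. F (a * p) (b * q))"
    using assms(1) unfolding tw_grouplike_def by blast
  obtain c d where cd: "invertible c" "invertible d" and y: "\<And>F :: 'h \<Rightarrow> 'h \<Rightarrow> 'h. bil F \<Longrightarrow> sw y F = sw 1 (\<lambda>p q. F (c * p) (d * q))"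
    using assms(2) unfolding tw_grouplike_def by blast
  have "sw (x * y) F = sw 1 (\<lambda>p q. F (a * c * p) (b * d * q))" if F: "bil F" for F :: "'h \<Rightarrow> 'h \<Rightarrow> 'h"
  proof -
    note [simp] = bilD[OF F]
    have "sw (x * y) F = sw x (\<lambda>p q. sw y (\<lambda>u v. F (p * u) (q * v)))" by (rule mult_sw[OF F])
    also have "\<dots> = sw 1 (\<lambda>p q. sw y (\<lambda>u v. F (a * p * u) (b * q * v)))" by (rule x) (simp add: lins)
    also have "\<dots> = sw (1 * y) (\<lambda>u v. F (a * u) (b * v))" by (subst mult_sw) (simp_all add: lins)
    also have "\<dots> = sw y (\<lambda>u v. F (a * u) (b * v))" by simp
    also have "\<dots> = sw 1 (\<lambda>p q. F (a * (c * p)) (b * (d * q)))" by (rule y) (simp add: lins)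
    finally show ?thesis by (simp add: mult.assoc)
  qed
  then show ?thesis unfolding tw_grouplike_def using invertible_mult ab cd by blast
qed

lemma tw_grouplike_Hs: assumes "y \<in> Hs" "invertible y" shows "tw_grouplike y"
  unfolding tw_grouplike_def
proof (intro exI conjI allI impI)
  show "invertible 1" by simp
  show "invertible y" by (rule assms(2))
  fix F :: "'h \<Rightarrow> 'h \<Rightarrow> 'h" assume "bil F"
  from sw_Hs_left[OF this assms(1), of 1] show "sw y F = sw 1 (\<lambda>p q. F (1 * p) (y * q))" by simp
qed

lemma tw_grouplike_Ht: assumes "z \<in> Ht" "invertible z" shows "tw_grouplike z"
  unfolding tw_grouplike_def
proof (intro exI conjI allI impI)
  show "invertible z" by (rule assms(2))
  show "invertible 1" by simp
  fix F :: "'h \<Rightarrow> 'h \<Rightarrow> 'h" assume "bil F"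
  from sw_Ht_left[OF this assms(1), of 1] show "sw z F = sw 1 (\<lambda>p q. F (z * p) (1 * q))" by simp
qed

lemma power_Hs: "x \<in> Hs \<Longrightarrow> x ^ i \<in> Hs" by (induction i) (simp_all add: Hs_mult)
lemma power_Ht: "x \<in> Ht \<Longrightarrow> x ^ i \<in> Ht" by (induction i) (simp_all add: Ht_mult)

lemma inner_funpow:
  fixes x x' :: 'h
  assumes "\<And>h. \<phi> h = x * h * x'" shows "(\<phi> ^^ m) h = x ^ m * h * x' ^ m"
proof (induction m)
  case (Suc m)
  have "(\<phi> ^^ Suc m) h = x * (x ^ m * h * x' ^ m) * x'" by (simp only: funpow.simps o_apply assms Suc)
  also have "\<dots> = x ^ Suc m * h * (x' ^ m * x')" by (simp add: mult.assoc)
  finally show ?case by (simp only: power_Suc2)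
qed simp

text \<open>
  Left and right colinear maps act on different legs.
\<close>
lemma left_right_colinear_commute:
  assumes T1: "algebra_aut T1" "left_colinear T1" and T2: "algebra_aut T2" "right_colinear T2"
  shows "T1 (T2 b) = T2 (T1 b)"
proof -
  have l: "lin T1" "lin T2" using T1 T2 by (simp_all add: algebra_aut_def)
  note [simp] = linD[OF l(1)] linD[OF l(2)]
  have T1f: "T1 b = sw b (\<lambda>p q. \<epsilon> (T1 q) *s p)" for b
  proof -
    have "T1 b = sw (T1 b) (\<lambda>p q. \<epsilon> q *s p)" by (simp add: counit_right_sw)
    then show ?thesis using T1(2) by (simp add: left_colinear_def lins)
  qed
  have "T1 (T2 b) = sw b (\<lambda>p q. \<epsilon> (T1 q) *s T2 p)"
    unfolding T1f[of "T2 b"] using T2(2) by (simp add: right_colinear_def lins)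
  also have "\<dots> = T2 (T1 b)" unfolding T1f[of b] by (simp add: lin_sw[OF l(2)])
  finally show ?thesis .
qed

text \<open>
  Since \<open>T\<^sub>1\<close> and \<open>T\<^sub>2\<close> commute, iterating Radford's formula gives \<open>S\<^sup>4\<^sup>i(T\<^sub>2\<^sup>i b) = X T\<^sub>1\<^sup>i(b) X\<^sup>-\<^sup>1\<close> with \<open>X\<close> a product of
  twisted grouplike elements. When \<open>T\<^sub>1\<^sup>i\<close> and \<open>T\<^sub>2\<^sup>i\<close> are both inner by units of the bases, which are twisted
  grouplike, \<open>S\<^sup>4\<^sup>i\<close> is conjugation by a twisted grouplike element.
\<close>
theorem S4_power_trivial:
  assumes \<theta>: "nondeg \<theta>"
  shows "\<exists>n\<ge>1. trivial_automorphism (S ^^ (4 * n))"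
proof -
  obtain T1 T2 G G' where T1: "algebra_aut T1" "left_colinear T1" and T2: "algebra_aut T2" "right_colinear T2" and G: "tw_grouplike G" "G * G' = 1" "G' * G = 1"
    and S4: "\<And>b. S (S (S (S (T2 b)))) = G * T1 b * G'"
    by (rule radford[OF \<theta>]) blast
  have S4n: "(S ^^ (4 * Suc i)) x = S (S (S (S ((S ^^ (4 * i)) x))))" for i x
    by (simp add: eval_nat_numeral)
  have comm: "(T1 ^^ i) (T2 b) = T2 ((T1 ^^ i) b)" for i b
    by (induction i) (simp_all add: left_right_colinear_commute[OF T1 T2])
  have iter: "\<exists>X X'. tw_grouplike X \<and> X * X' = 1 \<and> (\<forall>b. (S ^^ (4 * i)) ((T2 ^^ i) b) = X * (T1 ^^ i) b * X')" for i
  proof (induction i)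
    case 0
    show ?case by (intro exI[of _ 1]) (simp add: tw_grouplike_Hs)
  next
    case (Suc i)
    then obtain X X' where X: "tw_grouplike X" "X * X' = 1" "\<And>b. (S ^^ (4 * i)) ((T2 ^^ i) b) = X * (T1 ^^ i) b * X'" by blast
    let ?X = "S (S (S (S X))) * G" and ?X' = "G' * S (S (S (S X')))"
    have "(S ^^ (4 * Suc i)) ((T2 ^^ Suc i) b) = ?X * (T1 ^^ Suc i) b * ?X'" for b
    proof -
      have "(S ^^ (4 * Suc i)) ((T2 ^^ Suc i) b) = S (S (S (S (X * (T1 ^^ i) (T2 b) * X'))))"
        unfolding S4n by (simp only: funpow_Suc_right o_apply X(3))
      also have "\<dots> = S (S (S (S X))) * S (S (S (S (T2 ((T1 ^^ i) b))))) * S (S (S (S X')))"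
        by (simp add: S_mult comm mult.assoc)
      finally show ?thesis by (simp add: S4 mult.assoc)
    qed
    moreover have "?X * ?X' = 1"
    proof -
      have "?X * ?X' = S (S (S (S X))) * (G * G') * S (S (S (S X')))" by (simp only: mult.assoc)
      also have "\<dots> = S (S (S (S (X * X'))))" by (simp add: G S_mult)
      finally show ?thesis by (simp add: X)
    qed
    moreover have "tw_grouplike ?X" by (intro tw_grouplike_mult tw_grouplike_SS X G)
    ultimately show ?case by blast
  qed
  obtain n1 x x' where x: "n1 \<ge> 1" "x \<in> Hs" "x' \<in> Hs" "x * x' = 1" "x' * x = 1" "\<And>h. (T1 ^^ n1) h = x * h * x'"
    by (rule left_colinear_power_inner[OF \<theta> T1]) blast
  obtain n2 v v' where v: "n2 \<ge> 1" "v \<in> Ht" "v' \<in> Ht" "v * v' = 1" "v' * v = 1" "\<And>h. (T2 ^^ n2) h = v * h * v'"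
    by (rule right_colinear_power_inner[OF \<theta> T2]) blast
  define N where "N = n1 * n2"
  have T1N: "(T1 ^^ N) h = x ^ n2 * h * x' ^ n2" for h
    using inner_funpow[of "T1 ^^ n1", OF x(6), of n2] by (simp add: N_def funpow_mult)
  have T2N: "(T2 ^^ N) h = v ^ n1 * h * v' ^ n1" for h
    using inner_funpow[of "T2 ^^ n2", OF v(6), of n1] by (simp add: N_def funpow_mult mult.commute)
  obtain X X' where X: "tw_grouplike X" "X * X' = 1" "\<And>b. (S ^^ (4 * N)) ((T2 ^^ N) b) = X * (T1 ^^ N) b * X'"
    using iter[of N] by blast
  define K where "K = X * x ^ n2 * v' ^ n1"
  define K' where "K' = v ^ n1 * x' ^ n2 * X'"
  have K: "(S ^^ (4 * N)) h = K * h * K'" for h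
  proof -
    have "h = (T2 ^^ N) (v' ^ n1 * h * v ^ n1)"
    proof -
      have "(T2 ^^ N) (v' ^ n1 * h * v ^ n1) = (v ^ n1 * v' ^ n1) * h * (v ^ n1 * v' ^ n1)" by (simp only: T2N mult.assoc)
      then show ?thesis by (simp add: power_inverse[OF v(4)])
    qed
    then have "(S ^^ (4 * N)) h = X * (T1 ^^ N) (v' ^ n1 * h * v ^ n1) * X'" using X(3) by metis
    then show ?thesis by (simp add: T1N K_def K'_def mult.assoc)
  qed
  have KK': "K * K' = 1"
  proof -
    have "K * K' = X * (x ^ n2 * ((v' ^ n1 * v ^ n1) * x' ^ n2)) * X'" by (simp only: K_def K'_def mult.assoc)
    then show ?thesis by (simp add: power_inverse[OF v(5)] power_inverse[OF x(4)] X)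
  qed
  have invertible_pow: "invertible (x ^ n2)" "invertible (v' ^ n1)"
    using invertibleI_right[OF power_inverse[OF x(4)]] invertibleI_right[OF power_inverse[OF v(5)]] .
  have "tw_grouplike K" unfolding K_def
    by (intro tw_grouplike_mult X tw_grouplike_Hs tw_grouplike_Ht power_Hs power_Ht x v invertible_pow)
  then obtain n z y where n: "n \<ge> 1" "z \<in> Ht" "y \<in> Hs" "K ^ n = z * y"
    by (rule tw_grouplike_power[OF _ invertibleI_right[OF KK']]) blast
  have inner: "(S ^^ (4 * (N * n))) h = z * y * h * K' ^ n" for h
    using inner_funpow[of "S ^^ (4 * N)", OF K, of n h] by (simp add: funpow_mult n(4) mult.assoc)
  have aut: "wha_aut (S ^^ (4 * (N * n)))"
  proof -
    have "4 * (N * n) = 2 * (2 * (N * n))" by simp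
    then have "S ^^ (4 * (N * n)) = (S ^^ 2) ^^ (2 * (N * n))" by (simp only: funpow_mult)
    then show ?thesis using wha_aut_funpow[OF wha_aut_SS] by simp
  qed
  have "z * y * K' ^ n = 1" using power_inverse[OF KK', of n] by (simp add: n(4))
  then have "trivial_automorphism (S ^^ (4 * (N * n)))" by (rule inner_trivial[OF aut n(2,3) _ inner])
  moreover have "N * n \<ge> 1" using x(1) v(1) n(1) by (simp add: N_def)
  ultimately show ?thesis by blast
qed

end

theorem corollary5p15:
  fixes scale :: "'k::field \<Rightarrow> 'h::{ring, monoid_mult} \<Rightarrow> 'h"
    and \<Delta> :: "'h \<Rightarrow> ('h \<times> 'h) list"
    and \<epsilon> :: "'h \<Rightarrow> 'k"
    and S :: "'h \<Rightarrow> 'h"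
  assumes "weak_hopf_algebra scale \<Delta> \<epsilon> S"
    and "unital_algebra.finite_dim scale"
    and "unital_algebra.frobenius_algebra scale"
  shows "(\<exists>n\<ge>1. weak_hopf_algebra.trivial_automorphism scale \<Delta> \<epsilon> S (S ^^ (4 * n))) \<and>
    weak_hopf_algebra.weak_hopf_automorphism scale \<Delta> \<epsilon> S (S ^^ 2) \<and>
    (\<exists>m\<ge>1. weak_hopf_algebra.trivial_automorphism scale \<Delta> \<epsilon> S ((S ^^ 2) ^^ m))"
proof -
  interpret weak_hopf_algebra scale \<Delta> \<epsilon> S by (rule assms(1))
  interpret fd_weak_hopf_algebra scale \<Delta> \<epsilon> S by unfold_locales (rule assms(2))
  obtain \<theta> where "nondeg \<theta>" using assms(3) unfolding frobenius_algebra_def nondeg_def by blast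
  then obtain n where n: "n \<ge> 1" "trivial_automorphism (S ^^ (4 * n))" using S4_power_trivial by blast
  have "4 * n = 2 * (2 * n)" by simp
  then have "(S ^^ 2) ^^ (2 * n) = S ^^ (4 * n)" by (simp only: funpow_mult)
  then have "trivial_automorphism ((S ^^ 2) ^^ (2 * n))" using n by simp
  moreover have "2 * n \<ge> 1" using n by simp
  ultimately show ?thesis using n wha_aut_weak_hopf_automorphism[OF wha_aut_SS] by blast
qed

end
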